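(* Let $p(k)$, $q(k)$, $r(k)$ and $\mu(k)$ be real polynomials in $k$ of degrees $m$, $n$, $l$ and $s$, respectively, and let $$I(k)=p(k)K(k)+q(k)E(k)+r(k)\Pi(\mu(k),k),\qquad k\in(-1,1).$$ Then the number of zeros of $I(k)$ on $(-1,1)$, taking into account their multiplicities, does not exceed $\psi(m,n,l,s)$, where - if $s\ge2$: $\psi=2\max\{m,n\}+3l+6s+7$ when $l\le\max\{m,n\}+s$, and $\psi=5l+4s+7$ when $l>\max\{m,n\}+s$; - if $s=1$: $\psi=2\max\{m,n\}+3l+15$ when $l\le\max\{m,n\}+1$, and $\psi=5l+13$ when $l>\max\{m,n\}+1$; - if $s=0$: $\psi=2\max\{m,n\}+3l+11$ when $l\le\max\{m,n\}+2$, and $\psi=\max\{m,n\}+4l+9$ when $l>\max\{m,n\}+2$. Moreover, there exist real polynomials $p(k)$, $q(k)$ and $r(k)$, of degrees $m$, $n$ and $l$, such that $I(k)\not\equiv0$ and $I(k)$ has $m+n+l+2$ zeros on the interval $(-1,1)$.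
   Context: The complete elliptic integrals of the first, second and third kinds are, for $k\in(-1,1)$, $$K(k)=\int_0^1\frac{dz}{\sqrt{(1-z^2)(1-k^2z^2)}},\quad E(k)=\int_0^1\frac{\sqrt{1-k^2z^2}}{\sqrt{1-z^2}}dz,\quad \Pi(\mu,k)=\int_0^1\frac{dz}{(1-\mu z^2)\sqrt{(1-z^2)(1-k^2z^2)}}.$$ Standing assumptions: everything is real; $r\not\equiv0$; $\mu$ is non-negative on $(-1,1)$, $\mu(k)\ne1$, $\mu$ is not the function $k^2$, and the integral defining $\Pi(\mu(k),k)$ converges for $k\in(-1,1)$; when $s=0$, $\mu$ is a nonzero constant. The number of zeros of a function always means the number of its isolated zeros, counted with multiplicity where so stated. *)

theory Defs
  imports
    "HOL-Analysis.Analysis"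
    "HOL-Computational_Algebra.Polynomial"
    "HOL-Library.Extended_Nat"
begin

text \<open>
  The improper integrals below are Henstock--Kurzweil integrals over the closed unit interval. By
  Hake's theorem these agree with the usual improper integrals, and \<^term>\<open>(integrable_on)\<close>
  expresses their convergence. The value at \<open>z = 1\<close>, where division by zero yields 0, is irrelevant.
\<close>

definition elliptic_K :: "real \<Rightarrow> real" where
  "elliptic_K k = integral {0..1} (\<lambda>z. 1 / sqrt ((1 - z\<^sup>2) * (1 - k\<^sup>2 * z\<^sup>2)))"

definition elliptic_E :: "real \<Rightarrow> real" where
  "elliptic_E k = integral {0..1} (\<lambda>z. sqrt (1 - k\<^sup>2 * z\<^sup>2) / sqrt (1 - z\<^sup>2))"

definition elliptic_Pi_integrand :: "real \<Rightarrow> real \<Rightarrow> real \<Rightarrow> real" where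
  "elliptic_Pi_integrand \<mu> k z = 1 / ((1 - \<mu> * z\<^sup>2) * sqrt ((1 - z\<^sup>2) * (1 - k\<^sup>2 * z\<^sup>2)))"

definition elliptic_Pi :: "real \<Rightarrow> real \<Rightarrow> real" where
  "elliptic_Pi \<mu> k = integral {0..1} (elliptic_Pi_integrand \<mu> k)"

definition elliptic_comb ::
    "real poly \<Rightarrow> real poly \<Rightarrow> real poly \<Rightarrow> real poly \<Rightarrow> real \<Rightarrow> real" where
  "elliptic_comb p q r \<mu> k =
     poly p k * elliptic_K k + poly q k * elliptic_E k + poly r k * elliptic_Pi (poly \<mu> k) k"

definition isolated_zeros :: "(real \<Rightarrow> real) \<Rightarrow> real set \<Rightarrow> real set" where
  "isolated_zeros f S = {x. x isolated_in {y \<in> S. f y = 0}}"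

text \<open>
  The multiplicity is the order of the first non-vanishing derivative (for a function that is smooth
  near the point); it is \<^term>\<open>\<infinity> :: enat\<close> if all derivatives vanish.
\<close>

definition zero_mult :: "(real \<Rightarrow> real) \<Rightarrow> real \<Rightarrow> enat" where
  "zero_mult f x = (INF j \<in> {j. (deriv ^^ j) f x \<noteq> 0}. enat j)"

text \<open>
  The case distinction is needed because sums over infinite sets are 0 by convention.
\<close>

definition num_zeros_mult :: "(real \<Rightarrow> real) \<Rightarrow> real set \<Rightarrow> enat" where
  "num_zeros_mult f S =
     (if finite (isolated_zeros f S) then (\<Sum>x \<in> isolated_zeros f S. zero_mult f x) else \<infinity>)"

definition zero_bound :: "nat \<Rightarrow> nat \<Rightarrow> nat \<Rightarrow> nat \<Rightarrow> nat" where
  "zero_bound m n l s =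
     (if s \<ge> 2 then
        (if l \<le> max m n + s then 2 * max m n + 3 * l + 6 * s + 7 else 5 * l + 4 * s + 7)
      else if s = 1 then
        (if l \<le> max m n + 1 then 2 * max m n + 3 * l + 15 else 5 * l + 13)
      else
        (if l \<le> max m n + 2 then 2 * max m n + 3 * l + 11 else max m n + 4 * l + 9))"

end

theory Submission
  imports Defs "HOL-Complex_Analysis.Complex_Analysis" "HOL-Computational_Algebra.Fundamental_Theorem_Algebra"
begin

text \<open>
  Put \<open>Z = (1 - \<mu>) (\<mu> - k\<^sup>2)\<close>. After multiplication by a polynomial, the derivative of
  \<open>I \<surd>\<bar>Z / \<mu>\<bar> / r\<close> no longer involves the integral of the third kind: up to the weight it is
  \<open>P K + Q E\<close> with polynomials \<open>P\<close> and \<open>Q\<close>. By Rolle's theorem, \<open>I\<close> has at most as many zeros as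
  \<open>P K + Q E\<close>, plus one, plus corrections at the zeros of \<open>r\<close> and \<open>\<mu>\<close>. A zero of \<open>\<mu>\<close> inside
  \<open>(-1, 1)\<close> is double because \<open>\<mu> \<ge> 0\<close>, so it divides \<open>P\<close> and \<open>Q\<close> and costs nothing; this gives the
  bound \<open>deg P + deg Q + deg r + 3\<close> as soon as \<open>P K + Q E\<close> has at most \<open>deg P + deg Q + 2\<close> zeros.

  For the latter, \<open>E / K\<close> is the locally uniform limit on the unit disc of Pade quotients
  \<open>C\<^sub>j / B\<^sub>j\<close> in \<open>k\<^sup>2\<close>, the convergents of the continued fraction coming from contiguous hypergeometric
  functions. The zeros of \<open>B\<^sub>j\<close> and \<open>C\<^sub>j\<close> lie in \<open>(1, \<infinity>)\<close> and interlace, so the polynomial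
  \<open>P B\<^sub>j + Q C\<^sub>j\<close> changes sign so often for \<open>\<bar>k\<bar> > 1\<close> that at most \<open>deg P + deg Q + 2\<close> of its zeros
  remain elsewhere, and Hurwitz' theorem passes to the limit. That \<open>P\<close> and \<open>Q\<close> do not both vanish is
  a comparison of orders at all complex points and at infinity.

  For the lower bound, the \<open>m + n + l + 3\<close> functions \<open>k\<^sup>i K\<close>, \<open>k\<^sup>i E\<close>, \<open>k\<^sup>i \<Pi>\<close> are linearly independent
  by the upper bound, so some combination takes alternating signs at \<open>m + n + l + 3\<close> points.
\<close>

section \<open>The reduced coefficients\<close>

text \<open>\<open>K\<close> and \<open>E\<close> have their cuts along the half-lines
  \<open>\<bar>k\<bar> > 1\<close>, and the Pade zeros discretise these: sign changes of a
  polynomial between consecutive zeros take the place of an argument count along the cuts. At a zero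
  of \<open>B\<^sub>j\<close> the polynomial \<open>P B\<^sub>j + Q C\<^sub>j\<close> equals
  \<open>Q C\<^sub>j\<close>, where the sign of \<open>Q\<close> is unknown; its product with
  \<open>Q\<close> is counted instead, at the cost of \<open>deg Q\<close> further roots. The
  constant 2 arises because \<open>b\<close> zeros on each of two half-lines enclose only
  \<open>b - 1\<close> gaps. If \<open>deg Q > deg P\<close>, the two exchange roles.

  If \<open>P\<close> and \<open>Q\<close> both vanished, the weighted combination would be locally
  constant, and no single point refutes this. Each complex point only yields an inequality between
  the orders of \<open>r\<close>, \<open>\<mu>\<close>, \<open>Y\<close> and \<open>q\<close>.
  Summed over all points it becomes a degree inequality, strong enough to fix the signs of leading
  coefficients and to force \<open>q = 0\<close>. What is left is a condition on
  \<open>\<mu>\<close> alone, whose admissible solutions are \<open>0\<close> and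
  \<open>k\<^sup>2\<close>.\<close>

text \<open>
  With \<open>Y = \<mu> Z\<close> (\<open>sing_poly\<close>) and \<open>T = \<mu> Z' - \<mu>' Z\<close> (\<open>weight_poly\<close>), the weight \<open>\<surd>\<bar>Z / \<mu>\<bar> / r\<close> has the
  logarithmic derivative \<open>T / (2 Y) - r' / r\<close>. The polynomials \<open>reduced_K\<close> and \<open>reduced_E\<close> are the
  coefficients of \<open>K\<close> and \<open>E\<close> in \<open>k (1 - k\<^sup>2) (2 Y (r I' - r' I) + r T I)\<close>.
\<close>

definition sing_poly :: "'a::comm_ring_1 poly \<Rightarrow> 'a poly" where
  "sing_poly \<mu> = \<mu> * ((1 - \<mu>) * (\<mu> - [:0, 1:]^2))"

definition weight_poly :: "'a::idom poly \<Rightarrow> 'a poly" where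
  "weight_poly \<mu> = \<mu> * pderiv ((1 - \<mu>) * (\<mu> - [:0, 1:]^2)) - pderiv \<mu> * ((1 - \<mu>) * (\<mu> - [:0, 1:]^2))"

text \<open>\<open>\<mu> * forcing_poly \<mu>\<close> is the coefficient of \<open>E\<close> in
  \<open>2 (1 - k\<^sup>2) Y\<close> times the derivative of
  \<open>\<Pi>(\<mu>(k), k)\<close>.\<close>

definition forcing_poly :: "'a::idom poly \<Rightarrow> 'a poly" where
  "forcing_poly \<mu> = (1 - [:0, 1:]^2) * pderiv \<mu> - 2 * [:0, 1:] * (1 - \<mu>)"

definition reduced_K :: "'a::idom poly \<Rightarrow> 'a poly \<Rightarrow> 'a poly \<Rightarrow> 'a poly \<Rightarrow> 'a poly" where
  "reduced_K p q r \<mu> = (1 - [:0, 1:]^2) *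
     ([:0, 1:] * (2 * sing_poly \<mu> * (r * pderiv p - pderiv r * p) + r * weight_poly \<mu> * p)
      - 2 * r * sing_poly \<mu> * (p + q) + [:0, 1:] * r^2 * pderiv \<mu> * ([:0, 1:]^2 - \<mu>))"

definition reduced_E :: "'a::idom poly \<Rightarrow> 'a poly \<Rightarrow> 'a poly \<Rightarrow> 'a poly \<Rightarrow> 'a poly" where
  "reduced_E p q r \<mu> = (1 - [:0, 1:]^2) *
     ([:0, 1:] * (2 * sing_poly \<mu> * (r * pderiv q - pderiv r * q) + r * weight_poly \<mu> * q) + 2 * r * sing_poly \<mu> * q)
      + 2 * r * sing_poly \<mu> * p + r^2 * \<mu> * [:0, 1:] * forcing_poly \<mu>"

lemma pderiv_1_minus: "pderiv (1 - \<mu>) = - pderiv (\<mu> :: 'a::idom poly)"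
  by (simp add: pderiv_diff pderiv_1)

lemma pderiv_minus_sq: "pderiv (\<mu> - [:0, 1:]^2) = pderiv (\<mu> :: 'a::idom poly) - 2 * [:0, 1:]"
  by (simp add: pderiv_diff pderiv_power pderiv_pCons power2_eq_square numeral_poly one_pCons)

text \<open>In \<open>2 Y\<close> times the derivative of \<open>\<Pi>(\<mu>(k), k)\<close>, the
  integral \<open>\<Pi>\<close> itself has the coefficient
  \<open>\<mu>' (\<mu>\<^sup>2 - k\<^sup>2) + 2 k \<mu> (1 - \<mu>)\<close>. This is
  \<open>- T\<close>, which is why the weight eliminates it.\<close>

lemma weight_poly_alt: "weight_poly \<mu> = - (pderiv \<mu> * (\<mu>^2 - [:0, 1:]^2) + 2 * [:0, 1:] * \<mu> * (1 - \<mu>))"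
proof -
  have *: "m * ((1 - m) * (d - 2 * x) + v * (- d)) - d * ((1 - m) * v) =
      - (d * (m^2 - x^2) + 2 * x * m * (1 - m))" if "v = m - x^2" for m d x v :: "'a poly"
    unfolding that by (simp add: algebra_simps power2_eq_square)
  show ?thesis
    unfolding weight_poly_def pderiv_mult pderiv_1_minus pderiv_minus_sq by (rule *) simp
qed

section \<open>Divisibility by powers of a linear factor\<close>

definition lin_factor :: "'a::comm_ring_1 \<Rightarrow> 'a poly" where "lin_factor z = [:- z, 1:]"

lemma poly_lin_factor [simp]: "poly (lin_factor z) x = x - z" by (simp add: lin_factor_def)
lemma lin_factor_neq_0 [simp]: "lin_factor z \<noteq> 0" by (simp add: lin_factor_def)
lemma pderiv_lin_factor [simp]: "pderiv (lin_factor z) = (1 :: 'a::idom poly)" by (simp add: lin_factor_def pderiv_pCons)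
lemma lin_factor_power_dvd_iff: "lin_factor z ^ n dvd p \<longleftrightarrow> p = 0 \<or> n \<le> order z (p :: 'a::idom poly)"
  by (simp add: lin_factor_def order_divides)

lemma lin_factor_times_pderiv_power:
  "lin_factor z * pderiv (lin_factor z ^ i * a) = lin_factor z ^ i * (of_nat i * a + lin_factor z * pderiv (a :: 'a::idom poly))"
proof (cases i)
  case (Suc j)
  have "pderiv (lin_factor z ^ Suc j) = of_nat (Suc j) * lin_factor z ^ j"
    unfolding pderiv_power_Suc by (simp add: of_nat_poly)
  then show ?thesis unfolding Suc pderiv_mult power_Suc
    by (simp only: algebra_simps)
qed simp

lemma lin_factor_power_dvd_pderiv:
  assumes "lin_factor z ^ Suc n dvd (f :: 'a::idom poly)"
  shows "lin_factor z ^ n dvd pderiv f"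
proof -
  obtain g where g: "f = lin_factor z ^ Suc n * g" using assms by (elim dvdE)
  have "lin_factor z * pderiv f = lin_factor z ^ Suc n * (of_nat (Suc n) * g + lin_factor z * pderiv g)"
    unfolding g by (rule lin_factor_times_pderiv_power)
  then have "lin_factor z * pderiv f = lin_factor z * (lin_factor z ^ n * (of_nat (Suc n) * g + lin_factor z * pderiv g))"
    by (simp only: power_Suc mult.assoc)
  then have "pderiv f = lin_factor z ^ n * (of_nat (Suc n) * g + lin_factor z * pderiv g)"
    using mult_left_cancel[of "lin_factor z"] by (metis lin_factor_neq_0)
  then show ?thesis by simp
qed

lemma lin_factor_power_dvd_pderiv':
  assumes "lin_factor z ^ n dvd (f :: 'a::idom poly)"
  shows "lin_factor z ^ (n - 1) dvd pderiv f"
proof (cases n)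
  case (Suc m)
  then show ?thesis using lin_factor_power_dvd_pderiv[of z m f] assms by simp
qed simp

text \<open>Differentiation loses one factor; \<open>c\<close>, which vanishes at \<open>z\<close>,
  restores it.\<close>

lemma lin_factor_power_dvd_lin_factor_pderiv:
  assumes "lin_factor z ^ n dvd (f :: 'a::idom poly)" "lin_factor z dvd c"
  shows "lin_factor z ^ n dvd c * pderiv f"
proof (cases n)
  case (Suc m)
  show ?thesis unfolding Suc power_Suc
    by (intro mult_dvd_mono assms lin_factor_power_dvd_pderiv) (use assms Suc in auto)
qed auto

text \<open>The inhomogeneous terms, up to the factor \<open>\<mu> r\<^sup>2\<close>, that remain
  when the equations \<open>reduced_K = 0\<close> (divided by \<open>1 - k\<^sup>2\<close>) and
  \<open>reduced_E = 0\<close> are written for \<open>p + r\<close> instead of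
  \<open>p\<close>.\<close>

definition source_1 :: "'a::idom poly \<Rightarrow> 'a poly" where
  "source_1 \<mu> = (1 - \<mu>) * (2 * \<mu> - [:0, 1:] * pderiv \<mu>)"
definition source_2 :: "'a::idom poly \<Rightarrow> 'a poly" where
  "source_2 \<mu> = [:0, 1:] * (1 - [:0, 1:]^2) * pderiv \<mu> - 2 * \<mu> * (1 - \<mu>)"

text \<open>A source term written through \<open>\<mu> - k\<^sup>2\<close> or
  \<open>1 - \<mu>\<close> and the derivative of the same polynomial displays the order that it
  inherits from that factor of \<open>Y\<close>.\<close>

lemma source_1_alt: "source_1 \<mu> = (1 - \<mu>) * (2 * (\<mu> - [:0, 1:]^2) - [:0, 1:] * pderiv (\<mu> - [:0, 1:]^2))"
  unfolding source_1_def pderiv_minus_sq by (simp add: algebra_simps power2_eq_square)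

lemma source_2_alt1: "source_2 \<mu> = [:0, 1:] * (1 - [:0, 1:]^2) * pderiv (\<mu> - [:0, 1:]^2)
     - 2 * (\<mu> - [:0, 1:]^2) * (1 - 2 * [:0, 1:]^2 - (\<mu> - [:0, 1:]^2))"
proof -
  have *: "x * (1 - x^2) * d - 2 * m * (1 - m) =
     x * (1 - x^2) * (d - 2 * x) - 2 * (m - x^2) * (1 - 2 * x^2 - (m - x^2))" for m d x :: "'a poly"
    by (simp add: algebra_simps power2_eq_square)
  show ?thesis unfolding source_2_def pderiv_minus_sq by (rule *)
qed

lemma source_2_alt2: "source_2 \<mu> = - [:0, 1:] * (1 - [:0, 1:]^2) * pderiv (1 - \<mu>) - 2 * \<mu> * (1 - \<mu>)"
  unfolding source_2_def pderiv_1_minus by (simp only: mult_minus_left mult_minus_right minus_minus)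

lemma lin_factor_dvd_iff: "lin_factor z dvd f \<longleftrightarrow> poly f z = (0::'a::field)"
  by (simp add: poly_eq_0_iff_dvd lin_factor_def)

text \<open>Away from 0, a zero of \<open>\<mu>\<close> is no zero of the other two factors of
  \<open>Y\<close>, and the single differentiation loses one order. At 0 both \<open>\<mu>\<close>
  and \<open>\<mu> - k\<^sup>2\<close> may vanish; the factor \<open>k\<close> before the derivative
  then preserves the larger order, which is at least half of the sum.\<close>

lemma source_1_dvd:
  fixes \<mu> :: "'a::field poly"
  assumes d: "lin_factor z ^ \<delta> dvd \<mu>" and a: "lin_factor z ^ \<alpha> dvd 1 - \<mu>" and h: "lin_factor z ^ \<eta> dvd \<mu> - [:0, 1:]^2"
  shows "z \<noteq> 0 \<Longrightarrow> lin_factor z ^ (\<delta> + \<alpha> + \<eta> - 1) dvd source_1 \<mu>"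
    and "z = 0 \<Longrightarrow> \<exists>\<nu>. 2 * \<nu> \<ge> \<delta> + \<alpha> + \<eta> \<and> lin_factor z ^ \<nu> dvd source_1 \<mu>"
proof -
  have pd: "poly \<mu> z = 0" if "\<delta> > 0" using d that dvd_trans[OF dvd_power[of \<delta> "lin_factor z"] d] by (auto simp: lin_factor_dvd_iff)
  have pa: "poly \<mu> z = 1" if "\<alpha> > 0" using that dvd_trans[OF dvd_power[of \<alpha> "lin_factor z"] a] by (auto simp: lin_factor_dvd_iff)
  have ph: "poly \<mu> z = z^2" if "\<eta> > 0" using that dvd_trans[OF dvd_power[of \<eta> "lin_factor z"] h] by (auto simp: lin_factor_dvd_iff)
  have D1: "lin_factor z ^ (\<alpha> + (\<eta> - 1)) dvd source_1 \<mu>"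
    unfolding source_1_alt power_add
    by (intro mult_dvd_mono a dvd_diff dvd_mult lin_factor_power_dvd_pderiv' h dvd_trans[OF le_imp_power_dvd h]) simp
  have D2: "lin_factor z ^ (\<alpha> + (\<delta> - 1)) dvd source_1 \<mu>"
    unfolding source_1_def power_add
    by (intro mult_dvd_mono a dvd_diff dvd_mult lin_factor_power_dvd_pderiv' d dvd_trans[OF le_imp_power_dvd d]) simp
  have D0: "lin_factor z ^ \<alpha> dvd source_1 \<mu>" unfolding source_1_def using a by simp
  show "lin_factor z ^ (\<delta> + \<alpha> + \<eta> - 1) dvd source_1 \<mu>" if "z \<noteq> 0"
  proof (cases "\<delta> > 0")
    case True
    then have "\<alpha> = 0" "\<eta> = 0" using pd pa ph that by auto
    then show ?thesis using D2 by simp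
  next
    case False
    show ?thesis
    proof (cases "\<eta> > 0")
      case True
      then show ?thesis using D1 False by simp
    next
      case f: False
      have "lin_factor z ^ (\<alpha> - 1) dvd lin_factor z ^ \<alpha>" by (rule le_imp_power_dvd) simp
      then show ?thesis using D0 False f dvd_trans by auto
    qed
  qed
  show "\<exists>\<nu>. 2 * \<nu> \<ge> \<delta> + \<alpha> + \<eta> \<and> lin_factor z ^ \<nu> dvd source_1 \<mu>" if z: "z = 0"
  proof -
    have "lin_factor z ^ (\<alpha> + \<delta>) dvd source_1 \<mu>" unfolding source_1_def power_add
      by (intro mult_dvd_mono a dvd_diff lin_factor_power_dvd_lin_factor_pderiv d dvd_mult) (use z in \<open>auto simp: lin_factor_dvd_iff\<close>)
    moreover have "lin_factor z ^ (\<alpha> + \<eta>) dvd source_1 \<mu>" unfolding source_1_alt power_add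
      by (intro mult_dvd_mono a dvd_diff lin_factor_power_dvd_lin_factor_pderiv h dvd_mult) (use z in \<open>auto simp: lin_factor_dvd_iff\<close>)
    ultimately have "lin_factor z ^ (\<alpha> + max \<delta> \<eta>) dvd source_1 \<mu>" by (auto simp: max_def)
    then show ?thesis by (intro exI[of _ "\<alpha> + max \<delta> \<eta>"]) auto
  qed
qed

text \<open>The factor \<open>k (1 - k\<^sup>2)\<close> before each derivative vanishes at 0, 1 and
  -1. These are the only points where two of the three orders can be positive at once.\<close>

lemma source_2_dvd:
  fixes \<mu> :: "'a::field poly"
  assumes d: "lin_factor z ^ \<delta> dvd \<mu>" and a: "lin_factor z ^ \<alpha> dvd 1 - \<mu>" and h: "lin_factor z ^ \<eta> dvd \<mu> - [:0, 1:]^2"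
  shows "z \<noteq> 0 \<Longrightarrow> z^2 \<noteq> 1 \<Longrightarrow> lin_factor z ^ (\<delta> + \<alpha> + \<eta> - 1) dvd source_2 \<mu>"
    and "z = 0 \<or> z^2 = 1 \<Longrightarrow> \<exists>\<nu>. 2 * \<nu> \<ge> \<delta> + \<alpha> + \<eta> \<and> lin_factor z ^ \<nu> dvd source_2 \<mu>"
proof -
  have pd: "poly \<mu> z = 0" if "\<delta> > 0" using d that dvd_trans[OF dvd_power[of \<delta> "lin_factor z"] d] by (auto simp: lin_factor_dvd_iff)
  have pa: "poly \<mu> z = 1" if "\<alpha> > 0" using that dvd_trans[OF dvd_power[of \<alpha> "lin_factor z"] a] by (auto simp: lin_factor_dvd_iff)
  have ph: "poly \<mu> z = z^2" if "\<eta> > 0" using that dvd_trans[OF dvd_power[of \<eta> "lin_factor z"] h] by (auto simp: lin_factor_dvd_iff)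
  have D1: "lin_factor z ^ (\<eta> - 1) dvd source_2 \<mu>"
    unfolding source_2_alt1
    by (intro dvd_diff dvd_mult dvd_mult2 lin_factor_power_dvd_pderiv' h dvd_trans[OF le_imp_power_dvd h]) simp
  have D2: "lin_factor z ^ (\<delta> - 1) dvd source_2 \<mu>"
    unfolding source_2_def
    by (intro dvd_diff dvd_mult2 dvd_mult[OF lin_factor_power_dvd_pderiv'] d dvd_mult dvd_trans[OF le_imp_power_dvd d]) simp
  have D3: "lin_factor z ^ (\<alpha> - 1) dvd source_2 \<mu>"
    unfolding source_2_alt2
    by (intro dvd_diff dvd_mult lin_factor_power_dvd_pderiv' a dvd_trans[OF le_imp_power_dvd a]) simp
  show "lin_factor z ^ (\<delta> + \<alpha> + \<eta> - 1) dvd source_2 \<mu>" if z: "z \<noteq> 0" "z^2 \<noteq> 1"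
  proof -
    consider "\<alpha> = 0" "\<eta> = 0" | "\<delta> = 0" "\<eta> = 0" | "\<delta> = 0" "\<alpha> = 0"
      using pd pa ph z by (cases "\<delta> > 0"; cases "\<alpha> > 0"; cases "\<eta> > 0"; auto)
    then show ?thesis using D1 D2 D3 by cases auto
  qed
  show "\<exists>\<nu>. 2 * \<nu> \<ge> \<delta> + \<alpha> + \<eta> \<and> lin_factor z ^ \<nu> dvd source_2 \<mu>" if z: "z = 0 \<or> z^2 = 1"
  proof -
    have c: "lin_factor z dvd [:0, 1:] * (1 - [:0, 1:]^2)" using z by (auto simp: lin_factor_dvd_iff)
    then have c': "lin_factor z dvd - [:0, 1:] * (1 - [:0, 1:]^2)" by (metis dvd_minus_iff mult_minus_left)
    have E1: "lin_factor z ^ \<eta> dvd source_2 \<mu>" unfolding source_2_alt1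
      by (intro dvd_diff lin_factor_power_dvd_lin_factor_pderiv[OF h c] dvd_mult2 dvd_mult h)
    have E2: "lin_factor z ^ \<delta> dvd source_2 \<mu>" unfolding source_2_def
      by (intro dvd_diff lin_factor_power_dvd_lin_factor_pderiv[OF d c] dvd_mult2 dvd_mult d)
    have E3: "lin_factor z ^ \<alpha> dvd source_2 \<mu>" unfolding source_2_alt2
      by (intro dvd_diff lin_factor_power_dvd_lin_factor_pderiv[OF a c'] dvd_mult a)
    have "\<delta> = 0 \<or> \<alpha> = 0" using pd pa by force
    moreover have "\<eta> = 0 \<or> \<delta> = 0 \<or> \<alpha> = 0" using pd pa by force
    ultimately consider "\<delta> = 0" | "\<alpha> = 0" by blast
    then have "2 * max \<delta> (max \<alpha> \<eta>) \<ge> \<delta> + \<alpha> + \<eta>" by cases auto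
    moreover have "lin_factor z ^ max \<delta> (max \<alpha> \<eta>) dvd source_2 \<mu>" using E1 E2 E3 by (auto simp: max_def)
    ultimately show ?thesis by blast
  qed
qed

text \<open>
  Compares the lowest-order terms of the two relations at a point, where \<open>x\<close> stands for \<open>p + r\<close>:
  this shift makes both inhomogeneous terms vanish to high order at the zeros of \<open>Y\<close>.
\<close>

lemma order_relation:
  fixes x q r \<mu> :: "'a::field_char_0 poly"
  defines "Z \<equiv> (1 - \<mu>) * (\<mu> - [:0, 1:]^2)"
  assumes eq1: "[:0, 1:] * (2 * sing_poly \<mu> * (r * pderiv x - pderiv r * x) + r * weight_poly \<mu> * x)
      = 2 * r * sing_poly \<mu> * (x + q) - \<mu> * source_1 \<mu> * r^2"
    and eq2: "[:0, 1:] * (1 - [:0, 1:]^2) * (2 * sing_poly \<mu> * (r * pderiv q - pderiv r * q) + r * weight_poly \<mu> * q)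
      = - 2 * r * sing_poly \<mu> * x - 2 * (1 - [:0, 1:]^2) * r * sing_poly \<mu> * q - \<mu> * source_2 \<mu> * r^2"
    and nz: "r \<noteq> 0" "sing_poly \<mu> \<noteq> 0" "q \<noteq> 0"
  shows "2 * (order z r + order z \<mu>) \<le> order z (sing_poly \<mu>) + 2 * order z q"
proof (rule ccontr)
  assume contr: "\<not> ?thesis"
  define t where "t = lin_factor z"
  have t0: "poly t z = 0" "t \<noteq> 0" by (auto simp: t_def)
  have tdvd: "t dvd f \<longleftrightarrow> poly f z = 0" for f by (simp add: t_def lin_factor_dvd_iff)
  define u where "u = 1 - \<mu>"
  define v where "v = \<mu> - [:0, 1:]^2"
  have nz': "\<mu> \<noteq> 0" "u \<noteq> 0" "v \<noteq> 0" using nz by (auto simp: sing_poly_def u_def v_def)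
  \<comment> \<open>\<open>order z 0\<close> carries no information, so \<open>x = 0\<close> is
    treated apart.\<close>
  define i where "i = (if x = 0 then order z q else min (order z x) (order z q))"
  define \<rho> where "\<rho> = order z r"
  define \<delta> where "\<delta> = order z \<mu>"
  define \<alpha> where "\<alpha> = order z u"
  define \<eta> where "\<eta> = order z v"
  define \<zeta> where "\<zeta> = \<alpha> + \<eta>"
  have dec: "\<exists>g. f = t ^ order z f * g \<and> poly g z \<noteq> 0" if "f \<noteq> 0" for f
    using order_decomp[OF that, of z] unfolding lin_factor_def[symmetric] t_def by (auto simp: lin_factor_dvd_iff)
  have ordY: "order z (sing_poly \<mu>) = \<delta> + \<zeta>"
    using nz nz' unfolding sing_poly_def \<delta>_def \<zeta>_def \<alpha>_def \<eta>_def u_def v_def by (simp add: order_mult)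
  have "t ^ i dvd x" "t ^ i dvd q" unfolding i_def t_def by (auto simp: lin_factor_power_dvd_iff)
  then obtain x1 q1 where x1: "x = t ^ i * x1" and q1: "q = t ^ i * q1" by (auto elim!: dvdE)
  have x1q1: "poly x1 z \<noteq> 0 \<or> poly q1 z \<noteq> 0"
  proof (rule ccontr)
    assume "\<not> ?thesis"
    then have "t dvd x1" "t dvd q1" by (auto simp: tdvd)
    then have "t ^ Suc i dvd x" "t ^ Suc i dvd q" unfolding x1 q1
      by (simp_all add: mult_dvd_mono mult.commute)
    then have "x = 0 \<or> Suc i \<le> order z x" "Suc i \<le> order z q" using nz unfolding t_def lin_factor_power_dvd_iff by auto
    then show False by (auto simp: i_def split: if_splits)
  qed
  obtain r1 where r1: "r = t ^ \<rho> * r1" "poly r1 z \<noteq> 0" using dec[OF nz(1)] \<rho>_def by auto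
  obtain m1 where m1: "\<mu> = t ^ \<delta> * m1" "poly m1 z \<noteq> 0" using dec[OF nz'(1)] \<delta>_def by auto
  obtain u1 where u1: "u = t ^ \<alpha> * u1" "poly u1 z \<noteq> 0" using dec[OF nz'(2)] \<alpha>_def by auto
  obtain v1 where v1: "v = t ^ \<eta> * v1" "poly v1 z \<noteq> 0" using dec[OF nz'(3)] \<eta>_def by auto
  define z1 where "z1 = u1 * v1"
  have Z: "Z = t ^ \<zeta> * z1" unfolding Z_def z1_def \<zeta>_def u_def[symmetric] v_def[symmetric]
    by (subst u1(1), subst v1(1)) (simp add: power_add)
  have z1: "poly z1 z \<noteq> 0" using u1 v1 by (simp add: z1_def)
  have Y: "sing_poly \<mu> = \<mu> * Z" and T: "weight_poly \<mu> = \<mu> * pderiv Z - pderiv \<mu> * Z"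
    by (simp_all add: sing_poly_def weight_poly_def Z_def)
  \<comment> \<open>\<open>t\<close> times a derivative keeps the power of \<open>t\<close>; at
    \<open>z\<close> the new cofactor is the exponent times the old cofactor.\<close>
  define ex where "ex = of_nat i * x1 + t * pderiv x1"
  define eq where "eq = of_nat i * q1 + t * pderiv q1"
  define er where "er = of_nat \<rho> * r1 + t * pderiv r1"
  define em where "em = of_nat \<delta> * m1 + t * pderiv m1"
  define ez where "ez = of_nat \<zeta> * z1 + t * pderiv z1"
  have D: "t * pderiv x = t ^ i * ex" "t * pderiv q = t ^ i * eq" "t * pderiv r = t ^ \<rho> * er"
     "t * pderiv \<mu> = t ^ \<delta> * em" "t * pderiv Z = t ^ \<zeta> * ez"
    unfolding ex_def eq_def er_def em_def ez_def unfolding t_def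
    by (subst (1) x1 q1 r1 m1 Z, (subst t_def)?, rule lin_factor_times_pderiv_power)+
  define S where "S = t ^ (\<delta> + \<zeta> + \<rho> + i)"
  have ring: "t * (2 * (m * Zz) * (r * dx - dr * x) + r * (m * dZ - dm * Zz) * x) =
      M * E * R * A * (2 * m1 * z1 * (r1 * ex - er * x1) + r1 * (m1 * ez - em * z1) * x1)"
    if "t * dx = A * ex" "t * dr = R * er" "t * dm = M * em" "t * dZ = E * ez"
       "m = M * m1" "Zz = E * z1" "r = R * r1" "x = A * x1"
    for m Zz r dx dr x dZ dm M E R A ex x1 :: "'a poly"
  proof -
    have "t * (2 * (m * Zz) * (r * dx - dr * x) + r * (m * dZ - dm * Zz) * x) =
        2 * (m * Zz) * (r * (t * dx) - (t * dr) * x) + r * (m * (t * dZ) - (t * dm) * Zz) * x"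
      by (simp add: algebra_simps)
    also have "\<dots> = M * E * R * A * (2 * m1 * z1 * (r1 * ex - er * x1) + r1 * (m1 * ez - em * z1) * x1)"
      unfolding that by (simp add: algebra_simps)
    finally show ?thesis .
  qed
  define B where "B f e = 2 * m1 * z1 * (r1 * e - er * f) + r1 * (m1 * ez - em * z1) * f" for e f
  have L1: "t * (2 * sing_poly \<mu> * (r * pderiv x - pderiv r * x) + r * weight_poly \<mu> * x) = S * B x1 ex"
    unfolding Y T S_def B_def power_add by (rule ring[OF D(1,3,4,5) m1(1) Z r1(1) x1])
  have L2: "t * (2 * sing_poly \<mu> * (r * pderiv q - pderiv r * q) + r * weight_poly \<mu> * q) = S * B q1 eq"
    unfolding Y T S_def B_def power_add by (rule ring[OF D(2,3,4,5) m1(1) Z r1(1) q1])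
  \<comment> \<open>The bracket multiplies the lowest terms of \<open>x\<close> and \<open>q\<close>
    by \<open>2 i - 2 \<rho> + \<zeta> - \<delta>\<close>, written here without cancelling
    \<open>\<delta>\<close>. The negated claim makes this a negative integer, hence nonzero in
    characteristic 0.\<close>
  define \<kappa> where "\<kappa> = (of_nat (\<delta> + \<zeta> + 2 * i) - of_nat (2 * \<rho> + 2 * \<delta>) :: 'a)"
  define w where "w = poly r1 z * poly m1 z * poly z1 z"
  have w: "w \<noteq> 0" using r1 m1 z1 by (simp add: w_def)
  have Bz: "poly (B x1 ex) z = \<kappa> * w * poly x1 z" "poly (B q1 eq) z = \<kappa> * w * poly q1 z"
    by (simp_all add: B_def ex_def eq_def er_def em_def ez_def t0 \<kappa>_def w_def algebra_simps)
  have i_le: "i \<le> order z q" by (auto simp: i_def)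
  have e: "2 * \<rho> + 2 * \<delta> > \<delta> + \<zeta> + 2 * i" using contr i_le unfolding ordY \<rho>_def[symmetric] \<delta>_def[symmetric] by simp
  define c where "c = 2 * \<rho> + 2 * \<delta> - (\<delta> + \<zeta> + 2 * i)"
  have kc: "\<kappa> = - of_nat c" and c0: "c > 0" unfolding \<kappa>_def c_def using e by (simp_all add: of_nat_diff)
  have k0: "\<kappa> \<noteq> 0" using c0 by (simp add: kc)
  have rY: "r * sing_poly \<mu> * x = S * (r1 * m1 * z1 * x1)" "r * sing_poly \<mu> * q = S * (r1 * m1 * z1 * q1)"
    unfolding Y S_def power_add by (subst r1(1), subst m1(1), subst Z, (subst x1 | subst q1), simp add: mult_ac)+
  have dv: "lin_factor z ^ \<delta> dvd \<mu>" "lin_factor z ^ \<alpha> dvd 1 - \<mu>" "lin_factor z ^ \<eta> dvd \<mu> - [:0, 1:]^2"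
    using m1(1) u1(1) v1(1) unfolding t_def u_def v_def by (metis dvd_triv_left)+
  have inhom: "\<exists>W. \<mu> * n * r^2 = S * (t ^ j * W)"
    if "t ^ \<nu> dvd n" "\<nu> + \<rho> + \<delta> \<ge> \<delta> + \<zeta> + i + j" for n \<nu> j
  proof -
    have "t ^ (\<delta> + \<nu> + 2 * \<rho>) dvd \<mu> * n * r^2"
      unfolding power_add power_mult power_commutes power2_eq_square
      by (metis dvd_triv_left m1(1) r1(1) mult_dvd_mono that(1) power_mult_distrib power2_eq_square power_mult mult.commute)
    moreover have "t ^ (\<delta> + \<zeta> + \<rho> + i + j) dvd t ^ (\<delta> + \<nu> + 2 * \<rho>)"
      by (rule le_imp_power_dvd) (use that in simp)
    ultimately have "t ^ (\<delta> + \<zeta> + \<rho> + i + j) dvd \<mu> * n * r^2" using dvd_trans by blast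
    then show ?thesis by (auto simp: S_def power_add mult_ac elim!: dvdE)
  qed
  have S0: "S \<noteq> 0" using t0 by (simp add: S_def)
  show False
  proof (cases "z = 0")
    case True
    then have tX: "t = [:0, 1:]" by (simp add: t_def lin_factor_def)
    obtain \<nu>1 where n1: "2 * \<nu>1 \<ge> \<delta> + \<zeta>" "t ^ \<nu>1 dvd source_1 \<mu>"
      using source_1_dvd(2)[OF dv True] by (auto simp: t_def \<zeta>_def add.assoc)
    obtain \<nu>2 where n2: "2 * \<nu>2 \<ge> \<delta> + \<zeta>" "t ^ \<nu>2 dvd source_2 \<mu>"
      using source_2_dvd(2)[OF dv] True by (auto simp: t_def \<zeta>_def add.assoc)
    \<comment> \<open>Half the order of \<open>Y\<close> is enough: the strict inequality
      \<open>e\<close> supplies the other half and one further power of \<open>t\<close>.\<close>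
    obtain W1 where W1: "\<mu> * source_1 \<mu> * r^2 = S * (t ^ 1 * W1)"
      using inhom[OF n1(2), of 1] n1(1) e by auto
    obtain W2 where W2: "\<mu> * source_2 \<mu> * r^2 = S * (t ^ 1 * W2)"
      using inhom[OF n2(2), of 1] n2(1) e by auto
    have "(t * S) * B x1 ex = (t * S) * (2 * (r1 * m1 * z1 * x1) + 2 * (r1 * m1 * z1 * q1) - t * W1)"
    proof -
      have "(t * S) * B x1 ex = t * (t * (2 * sing_poly \<mu> * (r * pderiv x - pderiv r * x) + r * weight_poly \<mu> * x))"
        unfolding L1 by (simp add: mult_ac)
      also have "\<dots> = t * (2 * (r * sing_poly \<mu> * x) + 2 * (r * sing_poly \<mu> * q) - \<mu> * source_1 \<mu> * r^2)"
        by (simp only: eq1[unfolded tX[symmetric]]) (simp add: algebra_simps)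
      finally show ?thesis unfolding rY W1 by (simp add: algebra_simps)
    qed
    then have "B x1 ex = 2 * (r1 * m1 * z1 * x1) + 2 * (r1 * m1 * z1 * q1) - t * W1"
      using t0 S0 by simp
    from arg_cong[OF this, of "\<lambda>f. poly f z"]
    have "\<kappa> * w * poly x1 z = 2 * w * (poly x1 z + poly q1 z)"
      unfolding Bz by (simp add: t0 w_def algebra_simps)
    then have E1: "\<kappa> * poly x1 z = 2 * (poly x1 z + poly q1 z)" using w by simp
    have "(t * S) * ((1 - t^2) * B q1 eq) =
        (t * S) * (- 2 * (r1 * m1 * z1 * x1) - 2 * (1 - t^2) * (r1 * m1 * z1 * q1) - t * W2)"
    proof -
      have "(t * S) * ((1 - t^2) * B q1 eq) =
          t * (1 - t^2) * (t * (2 * sing_poly \<mu> * (r * pderiv q - pderiv r * q) + r * weight_poly \<mu> * q))"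
        unfolding L2 by (simp add: mult_ac)
      also have "\<dots> = t * (t * (1 - t^2) * (2 * sing_poly \<mu> * (r * pderiv q - pderiv r * q) + r * weight_poly \<mu> * q))"
        by (simp only: mult_ac)
      also have "\<dots> = t * (- 2 * (r * sing_poly \<mu> * x) - 2 * (1 - t^2) * (r * sing_poly \<mu> * q) - \<mu> * source_2 \<mu> * r^2)"
        using eq2 unfolding tX[symmetric] by (simp add: mult_ac)
      finally show ?thesis unfolding rY W2 by (simp add: algebra_simps)
    qed
    then have "(1 - t^2) * B q1 eq = - 2 * (r1 * m1 * z1 * x1) - 2 * (1 - t^2) * (r1 * m1 * z1 * q1) - t * W2"
      using t0 S0 by simp
    from arg_cong[OF this, of "\<lambda>f. poly f z"]
    have "\<kappa> * w * poly q1 z = - 2 * w * (poly x1 z + poly q1 z)"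
      using Bz by (simp add: t0 w_def algebra_simps)
    then have "w * (\<kappa> * poly q1 z) = w * (- 2 * (poly x1 z + poly q1 z))" by (simp only: mult_ac mult_minus_right mult_minus_left)
    then have E2: "\<kappa> * poly q1 z = - 2 * (poly x1 z + poly q1 z)" using w by (metis mult_left_cancel)
    \<comment> \<open>The matrix with rows \<open>(2, 2)\<close> and \<open>(-2, -2)\<close> is
      nilpotent, so it has no eigenvector for a nonzero \<open>\<kappa>\<close>.\<close>
    have "\<kappa> * (poly x1 z + poly q1 z) = 0" unfolding distrib_left E1 E2 by simp
    then have "poly x1 z + poly q1 z = 0" using k0 by simp
    then show False using E1 E2 k0 x1q1 by simp
  next
    case False
    have cond: "\<delta> + \<zeta> + i + 0 \<le> \<delta> + \<alpha> + \<eta> - 1 + \<rho> + \<delta>" using e unfolding \<zeta>_def by linarith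
    obtain W1 where W1: "\<mu> * source_1 \<mu> * r^2 = S * (t ^ 0 * W1)"
      using inhom[OF source_1_dvd(1)[OF dv False, folded t_def] cond] by blast
    have "S * ([:0, 1:] * B x1 ex) = S * (t * (2 * (r1 * m1 * z1 * x1) + 2 * (r1 * m1 * z1 * q1) - W1))"
    proof -
      have "S * ([:0, 1:] * B x1 ex) = [:0, 1:] * (t * (2 * sing_poly \<mu> * (r * pderiv x - pderiv r * x) + r * weight_poly \<mu> * x))"
        unfolding L1 by (simp only: mult_ac)
      also have "\<dots> = t * ([:0, 1:] * (2 * sing_poly \<mu> * (r * pderiv x - pderiv r * x) + r * weight_poly \<mu> * x))"
        by (simp only: mult_ac)
      also have "\<dots> = t * (2 * (r * sing_poly \<mu> * x) + 2 * (r * sing_poly \<mu> * q) - \<mu> * source_1 \<mu> * r^2)"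
        unfolding eq1 by (simp add: algebra_simps)
      finally show ?thesis unfolding rY W1 by (simp add: algebra_simps)
    qed
    then have "[:0, 1:] * B x1 ex = t * (2 * (r1 * m1 * z1 * x1) + 2 * (r1 * m1 * z1 * q1) - W1)"
      using S0 mult_left_cancel by blast
    from arg_cong[OF this, of "\<lambda>f. poly f z"]
    have x10: "poly x1 z = 0" using w k0 False Bz by (simp add: t0)
    have L2': "S * ([:0, 1:] * (1 - [:0, 1:]^2) * B q1 eq) =
        t * (- 2 * (r * sing_poly \<mu> * x) - 2 * (1 - [:0, 1:]^2) * (r * sing_poly \<mu> * q) - \<mu> * source_2 \<mu> * r^2)"
    proof -
      have "S * ([:0, 1:] * (1 - [:0, 1:]^2) * B q1 eq) =
          [:0, 1:] * (1 - [:0, 1:]^2) * (t * (2 * sing_poly \<mu> * (r * pderiv q - pderiv r * q) + r * weight_poly \<mu> * q))"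
        unfolding L2 by (simp only: mult_ac)
      also have "\<dots> = t * ([:0, 1:] * (1 - [:0, 1:]^2) * (2 * sing_poly \<mu> * (r * pderiv q - pderiv r * q) + r * weight_poly \<mu> * q))"
        by (simp only: mult_ac)
      also have "\<dots> = t * (- 2 * (r * sing_poly \<mu> * x) - 2 * (1 - [:0, 1:]^2) * (r * sing_poly \<mu> * q) - \<mu> * source_2 \<mu> * r^2)"
        unfolding eq2 by (simp only: mult_ac)
      finally show ?thesis .
    qed
    show False
    proof (cases "z^2 = 1")
      case z1': True
      obtain \<nu>2 where n2: "2 * \<nu>2 \<ge> \<delta> + \<zeta>" "t ^ \<nu>2 dvd source_2 \<mu>"
        using source_2_dvd(2)[OF dv] z1' by (auto simp: t_def \<zeta>_def add.assoc)
      obtain W2 where W2: "\<mu> * source_2 \<mu> * r^2 = S * (t ^ 1 * W2)"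
        using inhom[OF n2(2), of 1] n2(1) e by auto
      \<comment> \<open>\<open>1 - k\<^sup>2\<close> has a simple zero here. Cancelling it leaves
        the \<open>x1\<close> term on the right, which is already known to vanish at
        \<open>z\<close>.\<close>
      define s' where "s' = [:- z, - 1:]"
      have s': "1 - [:0, 1:]^2 = t * s'" "poly s' z = - 2 * z"
        using z1' by (auto simp: s'_def t_def lin_factor_def power2_eq_square one_pCons)
      have "(t * S) * ([:0, 1:] * s' * B q1 eq) =
          (t * S) * (- 2 * (r1 * m1 * z1 * x1) - 2 * t * s' * (r1 * m1 * z1 * q1) - t * W2)"
        using L2' unfolding s'(1) rY W2 by (simp add: algebra_simps)
      then have "[:0, 1:] * s' * B q1 eq = - 2 * (r1 * m1 * z1 * x1) - 2 * t * s' * (r1 * m1 * z1 * q1) - t * W2"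
        using t0 S0 mult_left_cancel[of "t * S"] by (metis no_zero_divisors)
      from arg_cong[OF this, of "\<lambda>f. poly f z"]
      have "poly q1 z = 0" using w k0 False Bz by (simp add: t0 x10 s'(2))
      then show False using x1q1 x10 by simp
    next
      case z1': False
      obtain W2 where W2: "\<mu> * source_2 \<mu> * r^2 = S * (t ^ 0 * W2)"
        using inhom[OF source_2_dvd(1)[OF dv False z1', folded t_def] cond] by blast
      have "S * ([:0, 1:] * (1 - [:0, 1:]^2) * B q1 eq) =
          S * (t * (- 2 * (r1 * m1 * z1 * x1) - 2 * (1 - [:0, 1:]^2) * (r1 * m1 * z1 * q1) - W2))"
        unfolding L2' rY W2 by (simp add: algebra_simps)
      then have "[:0, 1:] * (1 - [:0, 1:]^2) * B q1 eq =
          t * (- 2 * (r1 * m1 * z1 * x1) - 2 * (1 - [:0, 1:]^2) * (r1 * m1 * z1 * q1) - W2)"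
        using S0 mult_left_cancel by blast
      from arg_cong[OF this, of "\<lambda>f. poly f z"]
      have "poly q1 z = 0" using w k0 False Bz z1' by (simp add: t0)
      then show False using x1q1 x10 by simp
    qed
  qed
qed

lemma weight_poly_eq:
  assumes "Z = (1 - \<mu>) * (\<mu> - [:0, 1:]^2)"
  shows "weight_poly \<mu> = \<mu> * pderiv Z - pderiv \<mu> * Z" "sing_poly \<mu> = \<mu> * Z"
  using assms by (simp_all add: weight_poly_def sing_poly_def)

text \<open>Passing from \<open>p\<close> to \<open>p + r\<close> amounts to using
  \<open>\<Pi> - K\<close>, which vanishes where \<open>\<mu>\<close> does, in place of
  \<open>\<Pi>\<close>.\<close>

lemma shifted_relations:
  fixes p q r \<mu> :: "'a::field_char_0 poly"
  assumes K: "reduced_K p q r \<mu> = 0" and E: "reduced_E p q r \<mu> = 0"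
  shows "[:0, 1:] * (2 * sing_poly \<mu> * (r * pderiv (p + r) - pderiv r * (p + r)) + r * weight_poly \<mu> * (p + r))
      = 2 * r * sing_poly \<mu> * ((p + r) + q) - \<mu> * source_1 \<mu> * r^2"
    and "[:0, 1:] * (1 - [:0, 1:]^2) * (2 * sing_poly \<mu> * (r * pderiv q - pderiv r * q) + r * weight_poly \<mu> * q)
      = - 2 * r * sing_poly \<mu> * (p + r) - 2 * (1 - [:0, 1:]^2) * r * sing_poly \<mu> * q - \<mu> * source_2 \<mu> * r^2"
proof -
  define X where "X = ([:0, 1:] :: 'a poly)"
  have X1: "1 - X^2 \<noteq> 0"
  proof
    assume "1 - X^2 = 0"
    then have "poly (1 - X^2) 0 = 0" by simp
    then show False by (simp add: X_def)
  qed
  have k: "X * (2 * sing_poly \<mu> * (r * pderiv p - pderiv r * p) + r * weight_poly \<mu> * p)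
      - 2 * r * sing_poly \<mu> * (p + q) + X * r^2 * pderiv \<mu> * (X^2 - \<mu>) = 0"
    using K X1 unfolding reduced_K_def X_def[symmetric] by simp
  have e: "(1 - X^2) * (X * (2 * sing_poly \<mu> * (r * pderiv q - pderiv r * q) + r * weight_poly \<mu> * q) + 2 * r * sing_poly \<mu> * q)
      + 2 * r * sing_poly \<mu> * p + r^2 * \<mu> * X * forcing_poly \<mu> = 0"
    using E unfolding reduced_E_def X_def[symmetric] .
  have Y: "sing_poly \<mu> = \<mu> * ((1 - \<mu>) * (\<mu> - X^2))" by (simp add: sing_poly_def X_def)
  have r1: "X * (2 * Y * (r * (dp + dr) - dr * (p + r)) + r * T * (p + r))
      - 2 * r * Y * ((p + r) + q) + m * ((1 - m) * (2 * m - X * dm)) * r^2 =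
      X * (2 * Y * (r * dp - dr * p) + r * T * p) - 2 * r * Y * (p + q) + X * r^2 * dm * (X^2 - m)"
    if "Y = m * ((1 - m) * (m - X^2))" "T = - (dm * (m^2 - X^2) + 2 * X * m * (1 - m))"
    for Y dp dr r T m dm p q :: "'a poly"
    unfolding that by (simp add: algebra_simps power2_eq_square)
  have "X * (2 * sing_poly \<mu> * (r * (pderiv p + pderiv r) - pderiv r * (p + r)) + r * weight_poly \<mu> * (p + r))
      - 2 * r * sing_poly \<mu> * ((p + r) + q) + \<mu> * source_1 \<mu> * r^2 = 0"
    unfolding source_1_def X_def[symmetric] r1[OF Y weight_poly_alt[of \<mu>, folded X_def]] by (rule k)
  then show "[:0, 1:] * (2 * sing_poly \<mu> * (r * pderiv (p + r) - pderiv r * (p + r)) + r * weight_poly \<mu> * (p + r))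
      = 2 * r * sing_poly \<mu> * ((p + r) + q) - \<mu> * source_1 \<mu> * r^2"
    unfolding pderiv_add X_def[symmetric] by (simp add: algebra_simps)
  have r2: "X * (1 - X^2) * A + 2 * r * Y * (p + r) + 2 * (1 - X^2) * r * Y * q
        + m * (X * (1 - X^2) * dm - 2 * m * (1 - m)) * r^2
      = (1 - X^2) * (X * A + 2 * r * Y * q) + 2 * r * Y * p + r^2 * m * X * ((1 - X^2) * dm - 2 * X * (1 - m))"
    if "Y = m * ((1 - m) * (m - X^2))" for A r Y p q m dm :: "'a poly"
    unfolding that by (simp add: algebra_simps power2_eq_square)
  have "X * (1 - X^2) * (2 * sing_poly \<mu> * (r * pderiv q - pderiv r * q) + r * weight_poly \<mu> * q)
      + 2 * r * sing_poly \<mu> * (p + r) + 2 * (1 - X^2) * r * sing_poly \<mu> * q + \<mu> * source_2 \<mu> * r^2 = 0"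
    unfolding source_2_def X_def[symmetric] r2[OF Y] using e unfolding forcing_poly_def X_def[symmetric] .
  then show "[:0, 1:] * (1 - [:0, 1:]^2) * (2 * sing_poly \<mu> * (r * pderiv q - pderiv r * q) + r * weight_poly \<mu> * q)
      = - 2 * r * sing_poly \<mu> * (p + r) - 2 * (1 - [:0, 1:]^2) * r * sing_poly \<mu> * q - \<mu> * source_2 \<mu> * r^2"
    unfolding X_def[symmetric] by (simp add: algebra_simps)
qed

section \<open>From local orders to degrees\<close>

lemma degree_eq_sum_order:
  fixes f :: "complex poly"
  assumes "f \<noteq> 0" "finite A" "{z. poly f z = 0} \<subseteq> A"
  shows "degree f = (\<Sum>z\<in>A. order z f)"
proof -
  have "degree f = size (proots f)" by (rule size_proots_complex[symmetric])
  also have "\<dots> = (\<Sum>z\<in>set_mset (proots f). order z f)"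
    using assms(1) by (simp add: size_multiset_overloaded_eq)
  also have "\<dots> = (\<Sum>z\<in>A. order z f)"
    using assms by (intro sum.mono_neutral_left) (auto simp: order_root)
  finally show ?thesis .
qed

text \<open>Over the complex numbers the orders of a polynomial add up to its degree, so the local
  inequalities can be summed over all zeros involved.\<close>

lemma degree_relation_complex:
  fixes p q r \<mu> :: "complex poly"
  assumes "reduced_K p q r \<mu> = 0" "reduced_E p q r \<mu> = 0" and nz: "r \<noteq> 0" "sing_poly \<mu> \<noteq> 0" "q \<noteq> 0"
  shows "2 * (degree r + degree \<mu>) \<le> degree (sing_poly \<mu>) + 2 * degree q"
proof -
  have mu: "\<mu> \<noteq> 0" using nz by (auto simp: sing_poly_def)
  define A where "A = {z. poly (r * \<mu> * sing_poly \<mu> * q) z = 0}"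
  have fin: "finite A" unfolding A_def using nz mu by (intro poly_roots_finite) auto
  have d: "degree f = (\<Sum>z\<in>A. order z f)" if "f \<in> {r, \<mu>, sing_poly \<mu>, q}" for f
    by (rule degree_eq_sum_order) (use that nz mu fin in \<open>auto simp: A_def\<close>)
  have "2 * (degree r + degree \<mu>) = (\<Sum>z\<in>A. 2 * (order z r + order z \<mu>))"
    by (simp add: d sum.distrib sum_distrib_left)
  also have "\<dots> \<le> (\<Sum>z\<in>A. order z (sing_poly \<mu>) + 2 * order z q)"
    by (intro sum_mono order_relation[OF shifted_relations[OF assms(1,2)] nz])
  also have "\<dots> = degree (sing_poly \<mu>) + 2 * degree q"
    by (simp add: d sum.distrib sum_distrib_left)
  finally show ?thesis .
qed

lemma map_poly_cr_simps:
  "map_poly complex_of_real (a * b) = map_poly complex_of_real a * map_poly complex_of_real b"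
  "map_poly complex_of_real (a + b) = map_poly complex_of_real a + map_poly complex_of_real b"
  "map_poly complex_of_real (a - b) = map_poly complex_of_real a - map_poly complex_of_real b"
  "map_poly complex_of_real (a ^ n) = map_poly complex_of_real a ^ n"
  "map_poly complex_of_real 1 = 1"
  "map_poly complex_of_real 2 = 2"
  "map_poly complex_of_real [:0, 1:] = [:0, 1:]"
  "map_poly complex_of_real (pderiv a) = pderiv (map_poly complex_of_real a)"
proof -
  show m: "map_poly complex_of_real (a * b) = map_poly complex_of_real a * map_poly complex_of_real b" for a b
    by (rule poly_eqI) (simp add: coeff_map_poly coeff_mult)
  show a: "map_poly complex_of_real (a + b) = map_poly complex_of_real a + map_poly complex_of_real b" for a b
    by (rule poly_eqI) (simp add: coeff_map_poly)
  show "map_poly complex_of_real (a - b) = map_poly complex_of_real a - map_poly complex_of_real b"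
    by (rule poly_eqI) (simp add: coeff_map_poly)
  show o: "map_poly complex_of_real 1 = 1" by simp
  show "map_poly complex_of_real (a ^ n) = map_poly complex_of_real a ^ n"
    by (induction n) (simp_all add: m)
  show "map_poly complex_of_real 2 = 2" by (metis m o one_add_one a)
  show "map_poly complex_of_real [:0, 1:] = [:0, 1:]" by (rule poly_eqI) (simp add: coeff_map_poly coeff_pCons split: nat.splits)
  show "map_poly complex_of_real (pderiv a) = pderiv (map_poly complex_of_real a)"
    by (rule poly_eqI) (simp add: coeff_map_poly coeff_pderiv)
qed

lemma map_poly_cr_reduced:
  "sing_poly (map_poly complex_of_real \<mu>) = map_poly complex_of_real (sing_poly \<mu>)"
  "reduced_K (map_poly complex_of_real p) (map_poly complex_of_real q) (map_poly complex_of_real r) (map_poly complex_of_real \<mu>)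
    = map_poly complex_of_real (reduced_K p q r \<mu>)"
  "reduced_E (map_poly complex_of_real p) (map_poly complex_of_real q) (map_poly complex_of_real r) (map_poly complex_of_real \<mu>)
    = map_poly complex_of_real (reduced_E p q r \<mu>)"
  by (simp_all only: sing_poly_def weight_poly_def forcing_poly_def reduced_K_def reduced_E_def map_poly_cr_simps)

lemma map_poly_cr_0_iff: "map_poly complex_of_real f = 0 \<longleftrightarrow> f = 0"
  by (simp add: map_poly_eq_0_iff)

lemma degree_relation:
  fixes p q r \<mu> :: "real poly"
  assumes "reduced_K p q r \<mu> = 0" "reduced_E p q r \<mu> = 0" and nz: "r \<noteq> 0" "sing_poly \<mu> \<noteq> 0" "q \<noteq> 0"
  shows "2 * (degree r + degree \<mu>) \<le> degree (sing_poly \<mu>) + 2 * degree q"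
  using degree_relation_complex[of "map_poly of_real p" "map_poly of_real q" "map_poly of_real r" "map_poly of_real \<mu>"] assms
  unfolding map_poly_cr_reduced by (simp add: map_poly_cr_0_iff degree_map_poly)

section \<open>Leading coefficients: the comparison at infinity\<close>

lemma coeff_mult_top:
  assumes "degree p \<le> m" "degree q \<le> n"
  shows "coeff (p * q) (m + n) = coeff p m * coeff (q :: 'a::comm_ring_1 poly) n"
proof -
  have "coeff (p * q) (m + n) = (\<Sum>i\<le>m + n. coeff p i * coeff q (m + n - i))" by (simp add: coeff_mult)
  also have "\<dots> = (\<Sum>i\<le>m + n. if i = m then coeff p m * coeff q n else 0)"
  proof (intro sum.cong refl)
    fix i assume "i \<in> {..m + n}"
    show "coeff p i * coeff q (m + n - i) = (if i = m then coeff p m * coeff q n else 0)"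
    proof (cases i m rule: linorder_cases)
      case less
      then have "coeff q (m + n - i) = 0" using assms by (intro coeff_eq_0) auto
      then show ?thesis using less by simp
    next
      case greater
      then have "coeff p i = 0" using assms by (intro coeff_eq_0) auto
      then show ?thesis using greater by simp
    qed simp
  qed
  also have "\<dots> = coeff p m * coeff q n" by simp
  finally show ?thesis .
qed

lemma degree_mult_le': "degree p \<le> m \<Longrightarrow> degree q \<le> n \<Longrightarrow> degree (p * q :: 'a::comm_ring_1 poly) \<le> m + n"
  using degree_mult_le[of p q] by linarith

lemma degree_X_pderiv: "degree ([:0, 1:] * pderiv p :: 'a::idom poly) \<le> degree p"
  by (rule degree_le) (auto simp: coeff_pCons coeff_pderiv coeff_eq_0 split: nat.splits)

lemma coeff_X_pderiv: "coeff ([:0, 1:] * pderiv p :: 'a::idom poly) n = of_nat n * coeff p n"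
  by (auto simp: coeff_pCons coeff_pderiv split: nat.splits)

text \<open>The counterpart at infinity of the local exponent: \<open>k\<close> times a derivative
  does not raise the degree and multiplies the leading coefficient by the degree.\<close>

lemma bracket_top:
  fixes f r \<mu> :: "real poly"
  assumes "sing_poly \<mu> \<noteq> 0"
  defines "Z \<equiv> (1 - \<mu>) * (\<mu> - [:0, 1:]^2)"
  defines "B \<equiv> [:0, 1:] * (2 * sing_poly \<mu> * (r * pderiv f - pderiv r * f) + r * weight_poly \<mu> * f)"
  defines "d \<equiv> degree (sing_poly \<mu>) + degree r + degree f"
  shows "degree B \<le> d"
    and "coeff B d = lead_coeff (sing_poly \<mu>) * lead_coeff r * lead_coeff f *
      (2 * real (degree f) - 2 * real (degree r) + real (degree Z) - real (degree \<mu>))"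
    and "degree (sing_poly \<mu>) = degree \<mu> + degree Z"
proof -
  have nz: "\<mu> \<noteq> 0" "Z \<noteq> 0" using assms(1) unfolding sing_poly_def Z_def by auto
  define s where "s = degree \<mu>" define z where "z = degree Z" define l where "l = degree r"
  define n where "n = degree f"
  show dY: "degree (sing_poly \<mu>) = degree \<mu> + degree Z"
    unfolding weight_poly_eq[OF Z_def[THEN meta_eq_to_obj_eq]] using nz by (simp add: degree_mult_eq)
  let ?D = "\<lambda>f. [:0, 1:] * pderiv f :: real poly"
  have B: "B = 2 * (\<mu> * Z) * (r * ?D f - ?D r * f) + r * (\<mu> * ?D Z - ?D \<mu> * Z) * f"
    unfolding B_def weight_poly_eq[OF Z_def[THEN meta_eq_to_obj_eq]] by (simp only: algebra_simps)
  have dd: "d = (s + z) + (l + n)" "d = (l + (s + z)) + n"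
    by (simp_all add: d_def dY s_def z_def l_def n_def)
  have DD: "degree (?D f) \<le> degree f" for f :: "real poly" by (rule degree_X_pderiv)
  have b: "degree \<mu> \<le> s" "degree Z \<le> z" "degree r \<le> l" "degree f \<le> n"
      "degree (?D \<mu>) \<le> s" "degree (?D Z) \<le> z" "degree (?D r) \<le> l" "degree (?D f) \<le> n"
    using DD by (auto simp: s_def z_def l_def n_def)
  have two: "degree (2 * f) \<le> degree f" "coeff (2 * f) k = 2 * coeff f k" for f :: "real poly" and k
    unfolding mult_2 coeff_add by (rule degree_add_le) simp_all
  have b2: "degree (2 * (\<mu> * Z)) \<le> s + z"
    using degree_mult_le'[OF b(1,2)] two(1) le_trans by blast
  have b3: "degree (r * ?D f - ?D r * f) \<le> l + n"
    by (intro degree_diff_le degree_mult_le' b)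
  have b4: "degree (\<mu> * ?D Z - ?D \<mu> * Z) \<le> s + z"
    by (intro degree_diff_le degree_mult_le' b)
  show "degree B \<le> d"
    unfolding B by (intro degree_add_le; (unfold dd(1), rule degree_mult_le'[OF b2 b3])?)
       (unfold dd(2), intro degree_mult_le' b4 b)
  have c1: "coeff (2 * (\<mu> * Z) * (r * ?D f - ?D r * f)) d =
      2 * (coeff \<mu> s * coeff Z z) * (coeff r l * (real n * coeff f n) - (real l * coeff r l) * coeff f n)"
    unfolding dd(1) coeff_mult_top[OF b2 b3] two coeff_diff coeff_mult_top[OF b(1,2)]
      coeff_mult_top[OF b(3,8)] coeff_mult_top[OF b(7,4)] coeff_X_pderiv by simp
  have c2: "coeff (r * (\<mu> * ?D Z - ?D \<mu> * Z) * f) d =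
      coeff r l * (coeff \<mu> s * (real z * coeff Z z) - (real s * coeff \<mu> s) * coeff Z z) * coeff f n"
    unfolding dd(2) coeff_mult_top[OF degree_mult_le'[OF b(3) b4] b(4)] coeff_mult_top[OF b(3) b4] coeff_diff
      coeff_mult_top[OF b(1,6)] coeff_mult_top[OF b(5,2)] coeff_X_pderiv by simp
  have ly: "lead_coeff (sing_poly \<mu>) = coeff \<mu> s * coeff Z z"
    unfolding weight_poly_eq[OF Z_def[THEN meta_eq_to_obj_eq]] by (simp add: lead_coeff_mult s_def z_def)
  show "coeff B d = lead_coeff (sing_poly \<mu>) * lead_coeff r * lead_coeff f *
      (2 * real (degree f) - 2 * real (degree r) + real (degree Z) - real (degree \<mu>))"
    unfolding ly unfolding B coeff_add c1 c2 s_def[symmetric] z_def[symmetric] l_def[symmetric] n_def[symmetric]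
    by (simp add: algebra_simps)
qed

text \<open>The factor \<open>1 - j\<close> matters at \<open>j = 1\<close>, where it vanishes: the
  quadratic term of \<open>\<mu>\<close> leaves no trace in degree 3.\<close>

lemma coeff_forcing_poly:
  "coeff (forcing_poly \<mu>) (j + 2) = of_nat (j + 3) * coeff \<mu> (j + 3) + (1 - of_nat j) * coeff (\<mu> :: 'a::idom poly) (j + 1)"
proof -
  have e: "forcing_poly \<mu> = pderiv \<mu> - pCons 0 (pCons 0 (pderiv \<mu>)) - pCons 0 (1 - \<mu>) - pCons 0 (1 - \<mu>)"
    unfolding forcing_poly_def by (simp add: algebra_simps power2_eq_square)
  have e2: "forcing_poly \<mu> = pderiv \<mu> - pCons 0 (pCons 0 (pderiv \<mu>)) - (pCons 0 1 - pCons 0 \<mu>) - (pCons 0 1 - pCons 0 \<mu>)"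
    unfolding e by simp
  show ?thesis unfolding e2 by (simp only: coeff_diff) (simp add: coeff_pderiv numeral_3_eq_3 algebra_simps)
qed

lemma sing_poly_degree:
  fixes \<mu> :: "real poly"
  assumes "sing_poly \<mu> \<noteq> 0"
  shows "degree (sing_poly \<mu>) = 2 * degree \<mu> + degree (\<mu> - [:0, 1:]^2)"
    and "degree (1 - \<mu>) = degree \<mu>"
    and "degree (\<mu> - [:0, 1:]^2) \<le> max (degree \<mu>) 2"
    and "degree \<mu> \<ge> 3 \<Longrightarrow> degree (\<mu> - [:0, 1:]^2) = degree \<mu>"
    and "degree \<mu> \<le> 1 \<Longrightarrow> degree (\<mu> - [:0, 1:]^2) = 2"
proof -
  have X2: "degree ([:0, 1:]^2 :: real poly) = 2" by (simp add: degree_power_eq)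
  show u: "degree (1 - \<mu>) = degree \<mu>"
  proof (cases "degree \<mu> = 0")
    case True
    then show ?thesis using degree_diff_le[of 1 0 \<mu>] by simp
  next
    case False
    then show ?thesis using degree_add_eq_right[of 1 "- \<mu>"] by simp
  qed
  show "degree (sing_poly \<mu>) = 2 * degree \<mu> + degree (\<mu> - [:0, 1:]^2)"
    using assms u unfolding sing_poly_def by (auto simp: degree_mult_eq)
  show "degree (\<mu> - [:0, 1:]^2) \<le> max (degree \<mu>) 2"
    using degree_diff_le_max[of \<mu> "[:0, 1:]^2"] X2 by simp
  show "degree \<mu> \<ge> 3 \<Longrightarrow> degree (\<mu> - [:0, 1:]^2) = degree \<mu>"
    using degree_add_eq_left[of "- ([:0, 1:]^2)" \<mu>] X2 by simp
  show "degree \<mu> \<le> 1 \<Longrightarrow> degree (\<mu> - [:0, 1:]^2) = 2"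
    using degree_add_eq_right[of \<mu> "- ([:0, 1:]^2)"] X2 by simp
qed

lemma forcing_poly_degree:
  fixes \<mu> :: "real poly"
  assumes "sing_poly \<mu> \<noteq> 0"
  shows "2 * degree (forcing_poly \<mu>) < degree (sing_poly \<mu>) + 2"
proof -
  let ?s = "degree \<mu>"
  have *: "degree (forcing_poly \<mu>) \<le> k + 1" if "\<And>j. j \<ge> k \<Longrightarrow> coeff (forcing_poly \<mu>) (j + 2) = 0" for k
  proof (rule degree_le, intro allI impI)
    fix i assume "i > k + 1"
    then have "i - 2 \<ge> k" "i - 2 + 2 = i" by auto
    then show "coeff (forcing_poly \<mu>) i = 0" using that[of "i - 2"] by metis
  qed
  consider "?s \<ge> 3" | "?s = 2" | "?s = 1" | "?s = 0" by linarith
  then show ?thesis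
  proof cases
    case 1
    have "degree (forcing_poly \<mu>) \<le> ?s + 1" by (rule *) (simp only: coeff_forcing_poly, simp add: coeff_eq_0)
    then show ?thesis using 1 sing_poly_degree[OF assms] by auto
  next
    \<comment> \<open>Here \<open>\<mu> - k\<^sup>2\<close> may be constant, so that
      \<open>sing_poly \<mu>\<close> only has degree 4. A cubic term of
      \<open>forcing_poly \<mu>\<close> would break the strict inequality.\<close>
    case 2
    have "degree (forcing_poly \<mu>) \<le> 1 + 1"
    proof (rule *)
      fix j :: nat assume "j \<ge> 1"
      then show "coeff (forcing_poly \<mu>) (j + 2) = 0"
        using 2 by (cases "j = 1") (simp_all only: coeff_forcing_poly, auto simp: coeff_eq_0)
    qed
    then show ?thesis using 2 sing_poly_degree(1)[OF assms] by auto
  next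
    case 3
    have "degree (forcing_poly \<mu>) \<le> 1 + 1" by (rule *) (use 3 in \<open>simp only: coeff_forcing_poly, simp add: coeff_eq_0\<close>)
    then show ?thesis using 3 sing_poly_degree(1,5)[OF assms] by auto
  next
    case 4
    have "degree (forcing_poly \<mu>) \<le> 0 + 1" by (rule *) (use 4 in \<open>simp only: coeff_forcing_poly, simp add: coeff_eq_0\<close>)
    then show ?thesis using 4 sing_poly_degree(1,5)[OF assms] by auto
  qed
qed

lemma two_poly: "degree (2 * f) \<le> degree f" "coeff (2 * f) k = 2 * coeff f k" for f :: "real poly" and k
  unfolding mult_2 coeff_add by (rule degree_add_le) simp_all

lemma degree_1_minus_X2: "degree (1 - [:0, 1:]^2 :: real poly) = 2"
  using degree_add_eq_right[of 1 "- ([:0, 1:]^2) :: real poly"] by (simp add: degree_power_eq)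

text \<open>The degree inequality keeps the leading coefficient of the \<open>q\<close> side from
  cancelling, so the second equation forces \<open>deg q + 2 \<le> deg p\<close>. Then the
  \<open>p\<close> side of the first equation cannot cancel either and has to be balanced by the
  source term. This requires \<open>deg r \<ge> deg p + deg \<mu>\<close>, against the same degree
  inequality.\<close>

lemma reduced_coefs_eq_0_imp_q_eq_0:
  fixes p q r \<mu> :: "real poly"
  assumes K: "reduced_K p q r \<mu> = 0" and E: "reduced_E p q r \<mu> = 0" and nz: "r \<noteq> 0" "sing_poly \<mu> \<noteq> 0"
  shows "q = 0"
proof (rule ccontr)
  assume q: "q \<noteq> 0"
  define s where "s = degree \<mu>"
  define l where "l = degree r"
  define n where "n = degree q"
  define m where "m = degree p"
  define \<sigma> where "\<sigma> = degree (sing_poly \<mu>)"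
  define z where "z = degree ((1 - \<mu>) * (\<mu> - [:0, 1:]^2))"
  define B where "B f = [:0, 1:] * (2 * sing_poly \<mu> * (r * pderiv f - pderiv r * f) + r * weight_poly \<mu> * f)" for f
  note bt = bracket_top(3)[OF nz(2), folded z_def s_def \<sigma>_def]
    bracket_top(2)[OF nz(2), of r, folded B_def z_def s_def l_def \<sigma>_def]
  have rel: "2 * (l + s) \<le> \<sigma> + 2 * n" using degree_relation[OF K E nz q] by (simp add: l_def s_def \<sigma>_def n_def)
  have sz: "\<sigma> = s + z" using bt(1) .
  have "real (2 * (l + s)) \<le> real (s + z + 2 * n)" using rel unfolding sz by (rule of_nat_mono)
  then have relr: "2 * real l + 2 * real s \<le> real s + real z + 2 * real n" by simp
  let ?X = "[:0, 1:] :: real poly"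
  define W where "W = B q + 2 * (r * sing_poly \<mu> * q)"
  have E': "(1 - ?X^2) * W = - (2 * (r * sing_poly \<mu> * p) + r^2 * \<mu> * ?X * forcing_poly \<mu>)"
    using E unfolding reduced_E_def W_def B_def eq_neg_iff_add_eq_0 by (simp only: ac_simps)
  have dprod: "degree (r * sing_poly \<mu> * f) \<le> \<sigma> + l + degree f" for f
    using degree_mult_le[of "r * sing_poly \<mu>" f] degree_mult_le[of r "sing_poly \<mu>"] by (simp add: l_def \<sigma>_def)
  have cprod: "coeff (r * sing_poly \<mu> * f) (\<sigma> + l + degree f) = lead_coeff (sing_poly \<mu>) * lead_coeff r * lead_coeff f" for f
    using coeff_mult_top[of "r * sing_poly \<mu>" "\<sigma> + l" f "degree f"] coeff_mult_top[of "sing_poly \<mu>" \<sigma> r l] degree_mult_le[of r "sing_poly \<mu>"]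
    by (simp add: l_def \<sigma>_def mult.commute add.commute)
  have "coeff W (\<sigma> + l + n) = lead_coeff (sing_poly \<mu>) * lead_coeff r * lead_coeff q * (2 * real n - 2 * real l + real z - real s + 2)"
    using bt(2)[of q] cprod[of q] unfolding W_def coeff_add two_poly n_def l_def \<sigma>_def by (simp add: algebra_simps)
  moreover have "2 * real n - 2 * real l + real z - real s + 2 > 0" using relr by linarith
  ultimately have cW: "coeff W (\<sigma> + l + n) \<noteq> 0" using nz q by simp
  then have W0: "W \<noteq> 0" and "\<sigma> + l + n \<le> degree W" by (auto intro: le_degree)
  then have "\<sigma> + l + n + 2 \<le> degree ((1 - ?X^2) * W)"
    by (subst degree_mult_eq) (use degree_1_minus_X2 in auto)
  also have "\<dots> \<le> max (degree (2 * (r * sing_poly \<mu> * p))) (degree (r^2 * \<mu> * ?X * forcing_poly \<mu>))"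
    unfolding E' degree_minus by (rule degree_add_le_max)
  also have "\<dots> \<le> max (\<sigma> + l + m) (2 * l + s + 1 + degree (forcing_poly \<mu>))"
  proof (rule max.mono)
    show "degree (2 * (r * sing_poly \<mu> * p)) \<le> \<sigma> + l + m" using two_poly(1) dprod[of p] unfolding m_def by (rule order_trans)
    have "degree (r^2 * \<mu> * ?X * forcing_poly \<mu>) \<le> ((2 * l + s) + 1) + degree (forcing_poly \<mu>)"
      by (intro degree_mult_le') (auto simp: l_def s_def degree_power_eq nz)
    then show "degree (r^2 * \<mu> * ?X * forcing_poly \<mu>) \<le> 2 * l + s + 1 + degree (forcing_poly \<mu>)" by simp
  qed
  \<comment> \<open>The second member of the maximum lies below the left-hand side, by the degree
    inequality and the bound on \<open>forcing_poly\<close>.\<close>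
  finally have "\<sigma> + l + n + 2 \<le> \<sigma> + l + m"
    using forcing_poly_degree[OF nz(2)] rel unfolding \<sigma>_def[symmetric] le_max_iff_disj by presburger
  then have mn: "n + 2 \<le> m" by simp
  then have p: "p \<noteq> 0" by (auto simp: m_def)
  have X1: "1 - ?X^2 \<noteq> 0" using degree_1_minus_X2 by (metis degree_0 zero_neq_numeral)
  have K': "B p = 2 * (r * sing_poly \<mu> * (p + q)) - r^2 * (?X * pderiv \<mu>) * (?X^2 - \<mu>)"
  proof -
    have g: "x = a' - b'" if "x - a + b = 0" "a = a'" "b = b'" for x a b a' b' :: "real poly"
      using that by (simp add: algebra_simps)
    show ?thesis
    proof (rule g)
      show "B p - 2 * r * sing_poly \<mu> * (p + q) + ?X * r^2 * pderiv \<mu> * (?X^2 - \<mu>) = 0"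
        using K X1 unfolding reduced_K_def B_def mult_eq_0_iff by blast
    qed (simp_all only: ac_simps)
  qed
  have dpq: "degree (p + q) = m" "lead_coeff (p + q) = lead_coeff p"
    using mn degree_add_eq_left[of q p] lead_coeff_add_le[of q p] by (simp_all add: m_def n_def add.commute)
  have cB: "coeff (B p) (\<sigma> + l + m) = lead_coeff (sing_poly \<mu>) * lead_coeff r * lead_coeff p * (2 * real m - 2 * real l + real z - real s)"
    using bt(2)[of p] unfolding m_def l_def \<sigma>_def .
  have "coeff (r^2 * (?X * pderiv \<mu>) * (?X^2 - \<mu>)) (\<sigma> + l + m) = 0" if "m + s > l"
  proof (rule coeff_eq_0)
    have "degree (r^2 * (?X * pderiv \<mu>) * (?X^2 - \<mu>)) \<le> (2 * l + s) + degree (\<mu> - ?X^2)"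
    proof (intro degree_mult_le')
      show "degree (r^2) \<le> 2 * l" by (simp add: degree_power_eq nz l_def)
      show "degree (?X * pderiv \<mu>) \<le> s" unfolding s_def by (rule degree_X_pderiv)
      show "degree (?X^2 - \<mu>) \<le> degree (\<mu> - ?X^2)" by (metis degree_minus minus_diff_eq order_refl)
    qed
    then show "degree (r^2 * (?X * pderiv \<mu>) * (?X^2 - \<mu>)) < \<sigma> + l + m"
      using that sing_poly_degree(1)[OF nz(2)] by (simp add: \<sigma>_def s_def)
  qed
  moreover have "coeff (r^2 * (?X * pderiv \<mu>) * (?X^2 - \<mu>)) (\<sigma> + l + m) \<noteq> 0"
  proof
    assume "coeff (r^2 * (?X * pderiv \<mu>) * (?X^2 - \<mu>)) (\<sigma> + l + m) = 0"
    then have "coeff (B p) (\<sigma> + l + m) = 2 * (lead_coeff (sing_poly \<mu>) * lead_coeff r * lead_coeff p)"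
      unfolding K' coeff_diff two_poly using cprod[of "p + q"] dpq by simp
    then have "lead_coeff (sing_poly \<mu>) * lead_coeff r * lead_coeff p * (2 * real m - 2 * real l + real z - real s - 2) = 0"
      unfolding cB by (simp add: algebra_simps)
    then have "2 * real m - 2 * real l + real z - real s - 2 = 0" using nz p by simp
    then show False using of_nat_mono[OF mn, where 'a = real] relr by simp
  qed
  ultimately have "m + s \<le> l" by force
  moreover have "\<sigma> \<le> 2 * s + max s 2" using sing_poly_degree(1,3)[OF nz(2)] by (simp add: s_def \<sigma>_def)
  ultimately show False using mn rel by (cases "s \<le> 2") (simp_all add: max_def)
qed

text \<open>With \<open>q = 0\<close> the second equation determines \<open>p / r\<close>. When the
  first one is multiplied by \<open>2 Z\<close> and this quotient and its derivative are inserted,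
  \<open>p\<close> and \<open>r\<close> disappear and a condition on \<open>\<mu>\<close> alone
  remains.\<close>

lemma forcing_poly_relation:
  fixes p r \<mu> :: "real poly"
  assumes K: "reduced_K p 0 r \<mu> = 0" and E: "reduced_E p 0 r \<mu> = 0" and nz: "r \<noteq> 0" "sing_poly \<mu> \<noteq> 0"
  shows "2 * ([:0, 1:] * pderiv (forcing_poly \<mu>)) * sing_poly \<mu> - ([:0, 1:] * pderiv (sing_poly \<mu>)) * forcing_poly \<mu>
      + 2 * pderiv \<mu> * (\<mu> - [:0, 1:]^2) * ((1 - \<mu>) * (\<mu> - [:0, 1:]^2)) = 0"
proof -
  define X where "X = ([:0, 1:] :: real poly)"
  define Z where "Z = (1 - \<mu>) * (\<mu> - X^2)"
  have mu: "\<mu> \<noteq> 0" using nz by (auto simp: sing_poly_def)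
  have X0: "X \<noteq> 0" by (simp add: X_def)
  have X1: "1 - X^2 \<noteq> 0" using degree_1_minus_X2 unfolding X_def by (metis degree_0 zero_neq_numeral)
  have Y: "sing_poly \<mu> = \<mu> * Z" and T: "weight_poly \<mu> = \<mu> * pderiv Z - pderiv \<mu> * Z"
    using weight_poly_eq[of Z \<mu>] by (simp_all add: Z_def X_def)
  have "(r * \<mu>) * (2 * Z * p) = (r * \<mu>) * (- (r * X * forcing_poly \<mu>))"
    using E unfolding reduced_E_def Y X_def[symmetric] by (simp add: algebra_simps power2_eq_square add_eq_0_iff)
  then have e: "2 * Z * p = - (r * X * forcing_poly \<mu>)" using nz mu by (metis mult_left_cancel no_zero_divisors)
  have dX: "pderiv X = 1" by (simp add: X_def pderiv_pCons)
  have de: "2 * (pderiv Z * p + Z * pderiv p) = - (pderiv r * X * forcing_poly \<mu> + r * forcing_poly \<mu> + r * X * pderiv (forcing_poly \<mu>))"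
    using arg_cong[OF e, of pderiv] by (simp add: pderiv_mult pderiv_minus dX algebra_simps)
  have k: "X * (2 * (\<mu> * Z) * (r * pderiv p - pderiv r * p) + r * (\<mu> * pderiv Z - pderiv \<mu> * Z) * p)
      - 2 * r * (\<mu> * Z) * p + X * r^2 * pderiv \<mu> * (X^2 - \<mu>) = 0"
    using K X1 unfolding reduced_K_def Y T X_def[symmetric] by simp
  have key: "2 * Z * (X * (2 * (m * Z) * (r * dp - dr * p) + r * (m * dZ - dm * Z) * p)
      - 2 * r * (m * Z) * p + X * r^2 * dm * v)
      = - (r^2 * X * (2 * (X * dN) * (m * Z) - (X * (dm * Z + m * dZ)) * N - 2 * dm * v * Z))"
    if e: "2 * Z * p = - (r * X * N)" and de: "2 * (dZ * p + Z * dp) = - (dr * X * N + r * N + r * X * dN)"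
    for m Z r dp dr p dZ dm v N dN :: "real poly"
  proof -
    have "2 * Z * (X * (2 * (m * Z) * (r * dp - dr * p) + r * (m * dZ - dm * Z) * p)
        - 2 * r * (m * Z) * p + X * r^2 * dm * v) =
        2 * X * m * Z * r * (2 * (dZ * p + Z * dp)) - (2 * Z * p) * (2 * X * m * Z * dr + X * r * (m * dZ + dm * Z) + 2 * r * m * Z)
        + 2 * X * r^2 * dm * v * Z"
      by (simp add: algebra_simps power2_eq_square)
    also have "\<dots> = - (r^2 * X * (2 * (X * dN) * (m * Z) - (X * (dm * Z + m * dZ)) * N - 2 * dm * v * Z))"
      unfolding e de by (simp add: algebra_simps power2_eq_square)
    finally show ?thesis .
  qed
  have "r^2 * X * (2 * (X * pderiv (forcing_poly \<mu>)) * (\<mu> * Z) - (X * (pderiv \<mu> * Z + \<mu> * pderiv Z)) * forcing_poly \<mu> - 2 * pderiv \<mu> * (X^2 - \<mu>) * Z) = 0"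
    using key[OF e de, of \<mu> "pderiv \<mu>" "X^2 - \<mu>"] k by simp
  then have "2 * (X * pderiv (forcing_poly \<mu>)) * (\<mu> * Z) - (X * (pderiv \<mu> * Z + \<mu> * pderiv Z)) * forcing_poly \<mu> - 2 * pderiv \<mu> * (X^2 - \<mu>) * Z = 0"
    using nz X0 by simp
  then show ?thesis unfolding X_def[symmetric] Z_def[symmetric] Y pderiv_mult[of \<mu> Z]
    by (simp add: algebra_simps)
qed

text \<open>For \<open>s = deg \<mu> \<ge> 3\<close> the coefficient of degree
  \<open>4 s + 1\<close> is \<open>- (s - 2)\<^sup>2\<close> times the fourth power of the leading
  coefficient of \<open>\<mu>\<close>, hence nonzero.\<close>

lemma forcing_poly_relation_imp:
  fixes \<mu> :: "real poly"
  assumes rel: "2 * ([:0, 1:] * pderiv (forcing_poly \<mu>)) * sing_poly \<mu> - ([:0, 1:] * pderiv (sing_poly \<mu>)) * forcing_poly \<mu>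
      + 2 * pderiv \<mu> * (\<mu> - [:0, 1:]^2) * ((1 - \<mu>) * (\<mu> - [:0, 1:]^2)) = 0"
    and nz: "sing_poly \<mu> \<noteq> 0"
  shows "degree \<mu> \<le> 2"
proof (rule ccontr)
  assume contr: "\<not> ?thesis"
  define s where "s = degree \<mu>"
  have s3: "s \<ge> 3" using contr by (simp add: s_def)
  let ?X = "[:0, 1:] :: real poly"
  have mu: "\<mu> \<noteq> 0" using nz by (auto simp: sing_poly_def)
  define c where "c = lead_coeff \<mu>"
  have c: "c \<noteq> 0" using mu by (simp add: c_def)
  have ds: "degree \<mu> \<le> s" "degree (1 - \<mu>) \<le> s" "degree (\<mu> - ?X^2) \<le> s"
    using sing_poly_degree[OF nz] s3 by (auto simp: s_def)
  have cs: "coeff \<mu> s = c" "coeff (1 - \<mu>) s = - c" "coeff (\<mu> - ?X^2) s = c"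
    using s3 by (auto simp: c_def s_def coeff_eq_0 power2_eq_square degree_mult_eq)
  have dY: "degree (sing_poly \<mu>) \<le> s + (s + s)" unfolding sing_poly_def by (intro degree_mult_le' ds)
  have cY: "coeff (sing_poly \<mu>) (s + (s + s)) = - (c^3)"
    unfolding sing_poly_def coeff_mult_top[OF ds(1) degree_mult_le'[OF ds(2,3)]] coeff_mult_top[OF ds(2,3)] cs
    by (simp add: power3_eq_cube)
  have dN: "degree (forcing_poly \<mu>) \<le> s + 1"
  proof (rule degree_le, intro allI impI)
    fix i assume "i > s + 1"
    then have i: "i = (i - 2) + 2" by simp
    show "coeff (forcing_poly \<mu>) i = 0" by (subst i, subst coeff_forcing_poly) (use \<open>i > s + 1\<close> in \<open>auto simp: coeff_eq_0 s_def\<close>)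
  qed
  have s1: "s + 1 = (s - 1) + 2" using s3 by simp
  have cN: "coeff (forcing_poly \<mu>) (s + 1) = (2 - real s) * c"
    by (subst s1, subst coeff_forcing_poly) (use s3 in \<open>auto simp: coeff_eq_0 c_def s_def of_nat_diff\<close>)
  let ?k = "(s + 1) + (s + (s + s))"
  have t1: "coeff (2 * (?X * pderiv (forcing_poly \<mu>)) * sing_poly \<mu>) ?k = 2 * (real (s + 1) * ((2 - real s) * c)) * (- (c^3))"
    unfolding mult.assoc[of 2] two_poly
    by (subst coeff_mult_top[OF order_trans[OF degree_X_pderiv dN] dY]) (simp only: coeff_X_pderiv cN cY)
  have t2: "coeff (?X * pderiv (sing_poly \<mu>) * forcing_poly \<mu>) ?k = real (s + (s + s)) * (- (c^3)) * ((2 - real s) * c)"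
    unfolding add.commute[of "s + 1"]
    by (subst coeff_mult_top[OF order_trans[OF degree_X_pderiv dY] dN]) (simp only: coeff_X_pderiv cN cY)
  have t3: "coeff (2 * pderiv \<mu> * (\<mu> - ?X^2) * ((1 - \<mu>) * (\<mu> - ?X^2))) ?k = 0"
  proof (rule coeff_eq_0)
    have "degree (2 * pderiv \<mu> * (\<mu> - ?X^2) * ((1 - \<mu>) * (\<mu> - ?X^2))) \<le> ((s - 1) + s) + (s + s)"
      by (intro degree_mult_le' ds order_trans[OF two_poly(1)]) (simp add: degree_pderiv s_def)
    then show "degree (2 * pderiv \<mu> * (\<mu> - ?X^2) * ((1 - \<mu>) * (\<mu> - ?X^2))) < ?k" using s3 by simp
  qed
  have "2 * (real (s + 1) * ((2 - real s) * c)) * (- (c^3)) - real (s + (s + s)) * (- (c^3)) * ((2 - real s) * c) = 0"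
    using arg_cong[OF rel, of "\<lambda>f. coeff f ?k"] unfolding coeff_add coeff_diff t1 t2 t3 by simp
  then have "c^3 * c * ((2 - real s) * (real s - 2)) = 0" by (simp add: algebra_simps)
  then show False using c s3 by auto
qed

lemma forcing_poly_relation_quadratic:
  fixes c e :: real
  defines "\<mu> \<equiv> [:e, 0, c:]"
  assumes rel: "2 * ([:0, 1:] * pderiv (forcing_poly \<mu>)) * sing_poly \<mu> - ([:0, 1:] * pderiv (sing_poly \<mu>)) * forcing_poly \<mu>
      + 2 * pderiv \<mu> * (\<mu> - [:0, 1:]^2) * ((1 - \<mu>) * (\<mu> - [:0, 1:]^2)) = 0"
    and e: "e \<ge> 0" "e \<noteq> 1"
  shows "e = 0 \<and> (c = 0 \<or> c = 1)"
proof -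
  have N: "forcing_poly \<mu> = [:0, 2 * (c + e - 1):]"
    by (simp add: forcing_poly_def \<mu>_def pderiv_pCons power2_eq_square one_pCons numeral_poly algebra_simps)
  have v: "\<mu> - [:0, 1:]^2 = [:e, 0, c - 1:]" and u: "1 - \<mu> = [:1 - e, 0, - c:]"
    by (simp_all add: \<mu>_def power2_eq_square one_pCons)
  have uv: "[:1 - e, 0, - c:] * [:e, 0, c - 1:] = [:(1 - e) * e, 0, (1 - e) * (c - 1) - c * e, 0, - c * (c - 1):]"
    by (simp add: algebra_simps)
  have Y: "sing_poly \<mu> = [:e * ((1 - e) * e), 0, e * ((1 - e) * (c - 1) - c * e) + c * ((1 - e) * e), 0,
       - e * c * (c - 1) + c * ((1 - e) * (c - 1) - c * e), 0, - c * c * (c - 1):]"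
    unfolding sing_poly_def u v uv by (simp add: \<mu>_def algebra_simps)
  define f where "f = 2 * ([:0, 1:] * pderiv (forcing_poly \<mu>)) * sing_poly \<mu> - ([:0, 1:] * pderiv (sing_poly \<mu>)) * forcing_poly \<mu>
      + 2 * pderiv \<mu> * (\<mu> - [:0, 1:]^2) * ((1 - \<mu>) * (\<mu> - [:0, 1:]^2))"
  have f0: "f = 0" using rel by (simp add: f_def)
  have dmu: "pderiv \<mu> = [:0, 2 * c:]" by (simp add: \<mu>_def pderiv_pCons)
  have tw: "2 * [:a, b:] = [:2 * a, 2 * b:]" for a b :: real by (simp add: numeral_poly)
  have F: "f = [:0, 4 * (e^2 * (1 - e) * (2 * c + e - 1)), 0, 4 * (c * e * (2 * (c - 1) * (1 - e) - c * e)), 0,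
      4 * (c * (c - 1)^2 * (1 - e) - 2 * c^2 * e * (c - 1) + (c + e - 1) * (e * c * (c - 1) - c * ((1 - e) * (c - 1) - c * e))), 0,
      4 * (2 * (c + e - 1) * (c * c * (c - 1)) - c^2 * (c - 1)^2):]"
    unfolding f_def Y N u v uv dmu
    by (simp add: pderiv_pCons tw numeral_poly power2_eq_square algebra_simps)
  \<comment> \<open>These three coefficients suffice. For \<open>e \<noteq> 0\<close> the first and
    second leave only \<open>c = 5/6\<close> and \<open>e = -2/3\<close>, against
    \<open>e \<ge> 0\<close>.\<close>
  have "coeff f 1 = 0" "coeff f 3 = 0" "coeff f 7 = 0" by (simp_all add: f0)
  then have a1: "e^2 * (1 - e) * (2 * c + e - 1) = 0"
    and a3: "c * e * (2 * (c - 1) * (1 - e) - c * e) = 0"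
    and a7: "2 * (c + e - 1) * (c * c * (c - 1)) - c^2 * (c - 1)^2 = 0"
    unfolding F by (simp_all add: numeral_eq_Suc)
  show ?thesis
  proof (cases "e = 0")
    case True
    then have "c^2 * (c - 1)^2 = 0" using a7 by (simp add: power2_eq_square algebra_simps)
    then show ?thesis using True by simp
  next
    case False
    then have e': "e = 1 - 2 * c" using a1 e by simp
    then have "c \<noteq> 0" using e by auto
    then have "2 * (c - 1) * (1 - e) - c * e = 0" using a3 False by simp
    then have "c * (6 * c - 5) = 0" unfolding e' by (simp add: algebra_simps)
    then have "c = 5 / 6" using \<open>c \<noteq> 0\<close> by simp
    then show ?thesis using e e' by simp
  qed
qed

theorem reduced_coefs_eq_0_imp:
  fixes p q r \<mu> :: "real poly"
  assumes K: "reduced_K p q r \<mu> = 0" and E: "reduced_E p q r \<mu> = 0"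
    and \<mu>: "\<mu> \<noteq> 0" "\<mu> \<noteq> [:0, 1:]^2" "poly \<mu> 0 \<ge> 0" "poly \<mu> 0 \<noteq> 1"
    and d0: "poly \<mu> 0 = 0 \<Longrightarrow> poly (pderiv \<mu>) 0 = 0"
  shows "r = 0"
proof (rule ccontr)
  assume r: "r \<noteq> 0"
  have nz: "sing_poly \<mu> \<noteq> 0" using \<mu> by (auto simp: sing_poly_def)
  have q: "q = 0" by (rule reduced_coefs_eq_0_imp_q_eq_0[OF K E r nz])
  note rel = forcing_poly_relation[OF K[unfolded q] E[unfolded q] r nz]
  have "degree \<mu> \<le> 2" by (rule forcing_poly_relation_imp[OF rel nz])
  \<comment> \<open>At 0 the relation reads
    \<open>2 \<mu>'(0) \<mu>(0)\<^sup>2 (1 - \<mu>(0)) = 0\<close>. Together with \<open>d0\<close>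
    it removes the linear term of \<open>\<mu>\<close>.\<close>
  have "poly (pderiv \<mu>) 0 = 0"
    using arg_cong[OF rel, of "\<lambda>f. poly f 0"] d0 \<mu> by (cases "poly \<mu> 0 = 0") auto
  then have "coeff \<mu> 1 = 0" by (simp add: poly_0_coeff_0 coeff_pderiv)
  then have m: "\<mu> = [:poly \<mu> 0, 0, coeff \<mu> 2:]"
    using \<open>degree \<mu> \<le> 2\<close> by (intro poly_eqI) (auto simp: coeff_pCons poly_0_coeff_0 coeff_eq_0 numeral_2_eq_2 split: nat.splits)
  have "poly \<mu> 0 = 0 \<and> (coeff \<mu> 2 = 0 \<or> coeff \<mu> 2 = 1)"
    by (rule forcing_poly_relation_quadratic) (use rel m \<mu> in auto)
  then show False using m \<mu>(1,2) by (auto simp: power2_eq_square)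
qed

section \<open>Sturm sequences\<close>

text \<open>The recurrence of the convergents of a Stieltjes continued fraction with partial
  numerators \<open>- \<kappa> i x\<close>. Denominators and numerators of the Pade quotients are
  both of this form, for different \<open>\<kappa>\<close>.\<close>

fun sturm :: "(nat \<Rightarrow> real) \<Rightarrow> nat \<Rightarrow> real poly" where
  "sturm \<kappa> 0 = 1"
| "sturm \<kappa> (Suc 0) = 1"
| "sturm \<kappa> (Suc (Suc n)) = sturm \<kappa> (Suc n) - smult (\<kappa> (Suc n)) (pCons 0 (sturm \<kappa> n))"

lemma poly_sturm_0 [simp]: "poly (sturm \<kappa> n) 0 = 1"
  by (induction \<kappa> n rule: sturm.induct) auto

lemma degree_sturm: "degree (sturm \<kappa> n) \<le> n div 2"
proof (induction \<kappa> n rule: sturm.induct)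
  case (3 \<kappa> n)
  have "degree (smult (\<kappa> (Suc n)) (pCons 0 (sturm \<kappa> n))) \<le> Suc (n div 2)"
    using 3(2) degree_pCons_le[of 0 "sturm \<kappa> n"] degree_smult_le[of "\<kappa> (Suc n)" "pCons 0 (sturm \<kappa> n)"] by linarith
  moreover have "degree (sturm \<kappa> (Suc n)) \<le> Suc (n div 2)" using 3(1) by linarith
  ultimately show ?case by (simp add: degree_diff_le)
qed auto

lemma coeff_sturm_top:
  assumes "\<And>i. \<kappa> (Suc i) > 0"
  shows "(-1) ^ (n div 2) * coeff (sturm \<kappa> n) (n div 2) > 0"
  using assms
proof (induction \<kappa> n rule: sturm.induct)
  case (3 \<kappa> n)
  have a: "(-1) ^ (n div 2) * coeff (sturm \<kappa> n) (n div 2) > 0" using 3 by auto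
  have b: "(-1) ^ (Suc n div 2) * coeff (sturm \<kappa> (Suc n)) (Suc n div 2) > 0" using 3 by auto
  have a': "\<kappa> (Suc n) * ((-1) ^ (n div 2) * coeff (sturm \<kappa> n) (n div 2)) > 0" using a 3(3)[of n] by simp
  \<comment> \<open>For even \<open>n\<close> the preceding polynomial does not reach the new
    degree; for odd \<open>n\<close> its top coefficient has the same sign as the new term.\<close>
  have b': "(-1) ^ Suc (n div 2) * coeff (sturm \<kappa> (Suc n)) (Suc (n div 2)) \<ge> 0"
  proof (cases "even n")
    case True
    then have "degree (sturm \<kappa> (Suc n)) < Suc (n div 2)" using degree_sturm[of \<kappa> "Suc n"] by simp
    then show ?thesis by (simp add: coeff_eq_0)
  next
    case False
    then have "Suc n div 2 = Suc (n div 2)" by (auto elim: oddE)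
    then show ?thesis using b by simp
  qed
  show ?case using a' b' by (simp add: algebra_simps)
qed auto

text \<open>The form \<open>(1 - g i) * g (Suc i)\<close> of the coefficients, a chain sequence in
  the sense of Wall, makes the lower bound on the quotient of consecutive members reproduce
  itself.\<close>

lemma sturm_pos:
  assumes g: "\<And>i. 0 \<le> g i" "\<And>i. g i < 1" and \<kappa>: "\<And>i. \<kappa> (Suc i) = (1 - g i) * g (Suc i)"
    and x: "0 \<le> x" "x \<le> 1"
  shows "poly (sturm \<kappa> n) x > 0 \<and> poly (sturm \<kappa> (Suc n)) x \<ge> (1 - g n) * poly (sturm \<kappa> n) x"
proof (induction n)
  case 0
  then show ?case using g(1)[of 0] by simp
next
  case (Suc n)
  have p: "poly (sturm \<kappa> (Suc n)) x > 0"
    using Suc g(2)[of n] by (smt (verit) mult_pos_pos)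
  have "g (Suc n) * x * ((1 - g n) * poly (sturm \<kappa> n) x) \<le> g (Suc n) * 1 * poly (sturm \<kappa> (Suc n)) x"
    using Suc g x by (intro mult_mono) (auto simp: mult_nonneg_nonneg less_imp_le)
  then have "poly (sturm \<kappa> (Suc (Suc n))) x \<ge> poly (sturm \<kappa> (Suc n)) x - g (Suc n) * poly (sturm \<kappa> (Suc n)) x"
    by (simp add: \<kappa> algebra_simps)
  then show ?case using p by (simp add: algebra_simps)
qed

text \<open>The value at 0 is the extra interpolation node beside the \<open>J\<close>
  roots.\<close>

lemma poly_eq_prod_roots:
  fixes p :: "real poly"
  assumes "degree p \<le> J" "inj_on x {..<J}" "\<And>j. j < J \<Longrightarrow> x j \<noteq> 0 \<and> poly p (x j) = 0" "poly p 0 = 1"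
  shows "poly p y = (\<Prod>j<J. 1 - y / x j)"
proof -
  define q where "q = (\<Prod>j<J. [:1, - (1 / x j):])"
  have q: "poly q y = (\<Prod>j<J. 1 - y / x j)" for y by (simp add: q_def poly_prod)
  have dq: "degree q \<le> J"
    unfolding q_def using degree_prod_sum_le[of "{..<J}" "\<lambda>j. [:1, - (1 / x j):]"]
    by (rule order_trans[OF _ order_trans[OF sum_mono[of "{..<J}" _ "\<lambda>_. 1"]]]) auto
  have "p = q"
  proof (rule poly_eqI_degree)
    show "poly p z = poly q z" if "z \<in> insert 0 (x ` {..<J})" for z
      using that assms unfolding q by (auto simp: prod_zero_iff)
    have "card (insert 0 (x ` {..<J})) = Suc J" using assms(2,3) by (subst card_insert_disjoint) (auto simp: card_image)
    then show "card (insert 0 (x ` {..<J})) > degree p" "card (insert 0 (x ` {..<J})) > degree q"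
      using assms(1) dq by auto
  qed
  then show ?thesis using q by simp
qed

lemma sgn_prod_roots:
  fixes x :: "nat \<Rightarrow> real"
  assumes "\<And>j. j < J \<Longrightarrow> x j > 0" "i \<le> J" "\<And>j. j < i \<Longrightarrow> x j < y" "\<And>j. i \<le> j \<Longrightarrow> j < J \<Longrightarrow> y < x j"
  shows "(-1) ^ i * (\<Prod>j<J. 1 - y / x j) > 0"
proof -
  have "{..<J} = {..<i} \<union> {i..<J}" using assms(2) by auto
  then have "(\<Prod>j<J. 1 - y / x j) = (\<Prod>j<i. 1 - y / x j) * (\<Prod>j\<in>{i..<J}. 1 - y / x j)"
    by (simp add: prod.union_disjoint ivl_disj_int)
  then have "(-1) ^ i * (\<Prod>j<J. 1 - y / x j) = (\<Prod>j<i. (-1) * (1 - y / x j)) * (\<Prod>j\<in>{i..<J}. 1 - y / x j)"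
    by (simp only: prod.distrib prod_constant card_lessThan mult.assoc)
  also have "\<dots> > 0"
  proof (rule mult_pos_pos; rule prod_pos)
    fix j assume "j \<in> {..<i}"
    then have "0 < x j" "x j < y" using assms(1)[of j] assms(2,3) by auto
    then show "0 < - 1 * (1 - y / x j)" by (simp add: field_simps)
  next
    fix j assume "j \<in> {i..<J}"
    then show "0 < 1 - y / x j" using assms(1)[of j] assms(4)[of j] by (simp add: field_simps)
  qed
  finally show ?thesis .
qed

text \<open>At a root of one member the recurrence makes the next member a negative multiple of the
  previous one. The recorded signs, with positivity at 1 to start from, thus place the new roots
  between the old ones; the signs at the new roots follow from the factorisation into linear
  factors. The invariant concerns two consecutive members for this reason.\<close>

lemma sturm_roots:
  assumes \<kappa>: "\<And>i. \<kappa> (Suc i) > 0" and pos: "\<And>n. poly (sturm \<kappa> n) 1 > 0"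
  shows "\<exists>x. strict_mono_on {..<Suc n div 2} x \<and>
     (\<forall>j<Suc n div 2. x j > 1 \<and> poly (sturm \<kappa> (Suc n)) (x j) = 0 \<and> (-1) ^ j * poly (sturm \<kappa> n) (x j) > 0)"
proof (induction n)
  case 0
  then show ?case by (auto simp: strict_mono_on_def)
next
  case (Suc n)
  define J where "J = Suc n div 2"
  obtain x where x: "strict_mono_on {..<J} x"
     "\<And>j. j < J \<Longrightarrow> x j > 1" "\<And>j. j < J \<Longrightarrow> poly (sturm \<kappa> (Suc n)) (x j) = 0"
     "\<And>j. j < J \<Longrightarrow> (-1) ^ j * poly (sturm \<kappa> n) (x j) > 0"
    using Suc unfolding J_def by blast
  have mono: "x i < x j" if "i < j" "j < J" for i j
    using x(1) that by (auto simp: strict_mono_on_def)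
  let ?p = "sturm \<kappa> (Suc (Suc n))"
  have val: "(-1) ^ j * poly ?p (x j) < 0" if "j < J" for j
  proof -
    have "(-1) ^ j * poly ?p (x j) = - (\<kappa> (Suc n) * x j * ((-1) ^ j * poly (sturm \<kappa> n) (x j)))"
      using x(3)[OF that] by simp
    also have "\<dots> < 0" using x(2,4)[OF that] \<kappa>[of n] by (simp add: zero_less_mult_iff)
    finally show ?thesis .
  qed
  \<comment> \<open>The left ends of the intervals in which the new roots are found: 1, then the old
    roots.\<close>
  define lo where "lo j = (if j = 0 then 1 else x (j - 1))" for j
  have lo: "(-1) ^ j * poly ?p (lo j) > 0" if "j \<le> J" for j
    using val[of "j - 1"] pos[of "Suc (Suc n)"] that by (cases j) (auto simp: lo_def simp del: sturm.simps)
  have lo1: "lo j \<ge> 1" if "j \<le> J" for j using x(2)[of "j - 1"] that by (cases j) (auto simp: lo_def intro: less_imp_le)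
  have ivt: "\<exists>y. a < y \<and> y < b \<and> poly p y = 0" if "a < b" "c * poly p a > 0" "c * poly p b < 0" for a b c :: real and p
  proof (cases "c > 0")
    case True
    then show ?thesis using poly_IVT_neg[OF that(1), of p] that by (auto simp: zero_less_mult_iff mult_less_0_iff)
  next
    case False
    then show ?thesis using poly_IVT_pos[OF that(1), of p] that by (auto simp: zero_less_mult_iff mult_less_0_iff)
  qed
  define J' where "J' = Suc (Suc n) div 2"
  have J': "J' = J \<or> J' = Suc J \<and> odd (Suc n)" unfolding J_def J'_def by (cases "even n") auto
  have ex: "\<exists>y. lo j < y \<and> (j < J \<longrightarrow> y < x j) \<and> poly ?p y = 0" if "j < J'" for j
  proof (cases "j < J")
    case True
    have "lo j < x j" using True mono[of "j - 1" j] x(2)[of 0] by (cases j) (auto simp: lo_def)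
    from ivt[OF this lo[of j] val[OF True]] True show ?thesis by auto
  next
    case False
    then have j: "j = J" "J' = Suc J" using that J' by auto
    \<comment> \<open>The degree has grown, so one new root lies beyond all old ones: the sign of
      the new leading coefficient is \<open>(-1) ^ Suc J\<close>, opposite to the sign at
      \<open>lo J\<close>.\<close>
    define q where "q = smult ((-1) ^ J') ?p"
    have dq: "degree q \<le> J'" unfolding q_def J'_def using degree_sturm[of \<kappa> "Suc (Suc n)"] by (simp del: sturm.simps)
    have cq: "coeff q J' > 0" unfolding q_def J'_def using coeff_sturm_top[where \<kappa> = \<kappa>, OF \<kappa>, of "Suc (Suc n)"] by (simp del: sturm.simps)
    have "degree q = J'" using dq cq le_degree[of q J'] by force
    then have "lead_coeff q > 0" using cq by simp
    then obtain m where m: "\<And>y. y \<ge> m \<Longrightarrow> poly q y \<ge> lead_coeff q" using poly_pinfty_gt_lc by blast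
    define b where "b = max m (lo j + 1)"
    have "poly q b > 0" using m[of b] \<open>lead_coeff q > 0\<close> by (simp add: b_def)
    then have "(-1) ^ j * poly ?p b < 0" unfolding q_def using j by (simp del: sturm.simps)
    moreover have "lo j < b" by (simp add: b_def)
    ultimately show ?thesis using ivt[OF _ lo[of j], of b] j False by auto
  qed
  define y where "y j = (SOME y. lo j < y \<and> (j < J \<longrightarrow> y < x j) \<and> poly ?p y = 0)" for j
  have y: "lo j < y j" "j < J \<Longrightarrow> y j < x j" "poly ?p (y j) = 0" if "j < J'" for j
    using someI_ex[OF ex[OF that]] unfolding y_def by blast+
  have "(-1) ^ j * poly (sturm \<kappa> (Suc n)) (y j) > 0" if "j < J'" for j
  proof -
    have "poly (sturm \<kappa> (Suc n)) (y j) = (\<Prod>i<J. 1 - y j / x i)"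
      by (rule poly_eq_prod_roots)
         (use degree_sturm[of \<kappa> "Suc n"] x strict_mono_on_imp_inj_on[OF x(1)] in \<open>force simp: J_def\<close>)+
    moreover have "(-1) ^ j * (\<Prod>i<J. 1 - y j / x i) > 0"
    proof (rule sgn_prod_roots)
      show "j \<le> J" using that J' by auto
      show "0 < x i" if "i < J" for i using x(2)[OF that] by simp
      show "x i < y j" if "i < j" for i
      proof -
        have "x i \<le> x (j - 1)" using mono[of i "j - 1"] \<open>j \<le> J\<close> \<open>i < j\<close> by (cases "i = j - 1") (auto intro: less_imp_le)
        then show ?thesis using y(1)[OF \<open>j < J'\<close>] \<open>i < j\<close> by (simp add: lo_def)
      qed
      show "y j < x i" if "j \<le> i" "i < J" for i
        using y(2)[OF \<open>j < J'\<close>] mono[of j i] that by (cases "i = j") auto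
    qed
    ultimately show ?thesis by simp
  qed
  moreover have "y j > 1" if "j < J'" for j using y(1)[OF that] lo1[of j] J' that by auto
  moreover have "strict_mono_on {..<J'} y"
  proof (rule strict_mono_onI)
    fix i j assume "i \<in> {..<J'}" "j \<in> {..<J'}" "i < j"
    then have "i < J" "j - 1 < J" using J' by auto
    then have "y i < x i" using y(2) \<open>i \<in> {..<J'}\<close> by auto
    also have "x i \<le> x (j - 1)" using mono[of i "j - 1"] \<open>i < j\<close> \<open>j - 1 < J\<close> by (cases "i = j - 1") (auto intro: less_imp_le)
    also have "x (j - 1) < y j" using y(1)[of j] \<open>j \<in> {..<J'}\<close> \<open>i < j\<close> by (simp add: lo_def)
    finally show "y i < y j" .
  qed
  ultimately show ?case using y(3) unfolding J'_def[symmetric] by blast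
qed

section \<open>Counting roots away from the cuts\<close>

abbreviation sqX :: "real poly" where "sqX \<equiv> [:0, 0, 1:]"

lemma poly_pcompose_sqX [simp]: "poly (pcompose B sqX) y = poly B (y^2)"
  by (simp add: poly_pcompose power2_eq_square)

lemma poly_cr: "poly (map_poly complex_of_real p) (of_real x) = of_real (poly p x)"
  by (induction p) (auto simp: map_poly_pCons)

lemma order_map_poly_mult_le:
  "T * V \<noteq> 0 \<Longrightarrow> order z T \<le> order z (T * V :: complex poly)"
  by (simp add: order_mult)

text \<open>Where \<open>k\<^sup>2\<close> is one of the \<open>x j\<close>, only \<open>V C\<close>
  survives of \<open>T\<close>, so \<open>T V\<close> has the sign of \<open>C\<close> there,
  whatever the sign of \<open>V\<close>. This yields \<open>2 (b - 1)\<close> real roots of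
  \<open>T V\<close> outside the unit disc, and the degree limits the others. The sign
  \<open>s\<close> allows numerators and denominators to stand in either place.\<close>

lemma roots_off_cuts:
  fixes U V B C :: "real poly" and x :: "nat \<Rightarrow> real"
  defines "T \<equiv> U * pcompose B sqX + V * pcompose C sqX"
  assumes deg: "degree B \<le> b" "degree C \<le> b"
    and mono: "strict_mono_on {..<b} x"
    and x: "\<And>j. j < b \<Longrightarrow> x j > 1" "\<And>j. j < b \<Longrightarrow> poly B (x j) = 0"
    and s: "\<And>j. j < b \<Longrightarrow> (-1) ^ j * poly C (x j) * s > 0"
    and V: "\<And>j. j < b \<Longrightarrow> poly V (sqrt (x j)) \<noteq> 0 \<and> poly V (- sqrt (x j)) \<noteq> 0" "V \<noteq> 0"
    and T0: "T \<noteq> 0"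
    and Z: "finite Z" "\<And>z. z \<in> Z \<Longrightarrow> cmod z < 1"
  shows "(\<Sum>z\<in>Z. order z (map_poly complex_of_real T)) \<le> max (degree U) (degree V) + degree V + 2"
proof -
  define W where "W = T * V"
  have W0: "W \<noteq> 0" using T0 V by (simp add: W_def)
  have dp: "degree (pcompose f sqX) \<le> 2 * k" if "degree f \<le> k" for f :: "real poly" and k
    using that by (simp add: degree_pcompose)
  have "degree T \<le> max (degree U) (degree V) + 2 * b"
    unfolding T_def using degree_mult_le'[OF order_refl dp[OF deg(1)], of U] degree_mult_le'[OF order_refl dp[OF deg(2)], of V]
    by (intro degree_add_le) (auto intro: order_trans)
  then have dW: "degree W \<le> max (degree U) (degree V) + 2 * b + degree V"
    unfolding W_def using degree_mult_le[of T V] by linarith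
  have val: "(-1) ^ j * poly W (\<epsilon> * sqrt (x j)) * s > 0" if "j < b" "\<epsilon> = 1 \<or> \<epsilon> = -1" for j \<epsilon>
  proof -
    have sq: "(\<epsilon> * sqrt (x j))^2 = x j" using x(1)[OF that(1)] that(2) by (auto simp: power_mult_distrib)
    have "(-1) ^ j * poly W (\<epsilon> * sqrt (x j)) * s = ((-1) ^ j * poly C (x j) * s) * (poly V (\<epsilon> * sqrt (x j)))^2"
      unfolding W_def T_def using x(2)[OF that(1)] sq by (simp add: power2_eq_square)
    also have "\<dots> > 0" using s[OF that(1)] V(1)[OF that(1)] that(2) by (auto intro!: mult_pos_pos)
    finally show ?thesis .
  qed
  have ivt: "\<exists>y. a < y \<and> y < b \<and> poly p y = 0" if "a < b" "poly p a * poly p b < 0" for a b :: real and p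
    using poly_IVT[OF that] .
  have m: "x j < x (Suc j)" "0 < x j" if "Suc j < b" for j
    using mono that x(1)[of j] by (auto simp: strict_mono_on_def)
  have neg: "poly W (\<epsilon> * sqrt (x j)) * poly W (\<epsilon> * sqrt (x (Suc j))) < 0" if "Suc j < b" "\<epsilon> = 1 \<or> \<epsilon> = -1" for j \<epsilon>
  proof -
    have aux: "a * b < 0" if "e * a * s > 0" "- e * b * s > 0" for a b e :: real
    proof -
      have "(e * a * s) * (- e * b * s) > 0" using that by (rule mult_pos_pos)
      also have "(e * a * s) * (- e * b * s) = - ((e * s)^2 * (a * b))" by (simp add: power2_eq_square algebra_simps)
      finally have "(e * s)^2 * (a * b) < 0" by simp
      then show ?thesis by (metis mult_less_0_iff not_less zero_le_power2)
    qed
    show ?thesis by (rule aux[of "(-1) ^ j"]) (use val[of j \<epsilon>] val[of "Suc j" \<epsilon>] that in auto)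
  qed
  have "\<exists>y. sqrt (x j) < y \<and> y < sqrt (x (Suc j)) \<and> poly W y = 0" if "Suc j < b" for j
    using ivt[of "sqrt (x j)" "sqrt (x (Suc j))" W] neg[OF that, of 1] m[OF that] by auto
  then obtain w where w: "\<And>j. Suc j < b \<Longrightarrow> sqrt (x j) < w j \<and> w j < sqrt (x (Suc j)) \<and> poly W (w j) = 0" by metis
  have "\<exists>y. sqrt (x j) < y \<and> y < sqrt (x (Suc j)) \<and> poly W (- y) = 0" if j: "Suc j < b" for j
  proof -
    have "- sqrt (x (Suc j)) < - sqrt (x j)" using m[OF j] by auto
    then obtain y where "- sqrt (x (Suc j)) < y" "y < - sqrt (x j)" "poly W y = 0"
      using ivt[of "- sqrt (x (Suc j))" "- sqrt (x j)" W] neg[OF j, of "-1"] by (auto simp: mult.commute)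
    then show ?thesis by (intro exI[of _ "- y"]) auto
  qed
  then obtain v where v: "\<And>j. Suc j < b \<Longrightarrow> sqrt (x j) < v j \<and> v j < sqrt (x (Suc j)) \<and> poly W (- v j) = 0" by metis
  have inj: "inj_on u {..<b - 1}" if u: "\<And>j. Suc j < b \<Longrightarrow> sqrt (x j) < u j \<and> u j < sqrt (x (Suc j))" for u
  proof -
    have "u i < u j" if "i < j" "Suc j < b" for i j
    proof -
      have "x (Suc i) \<le> x j" using mono that by (cases "Suc i = j") (auto simp: strict_mono_on_def intro: less_imp_le)
      then have "sqrt (x (Suc i)) \<le> sqrt (x j)" by simp
      moreover have "u i < sqrt (x (Suc i))" "sqrt (x j) < u j" using u[of i] u[of j] that by auto
      ultimately show ?thesis by linarith
    qed
    then have "u i \<noteq> u j" if "i < j" "j \<in> {..<b - 1}" for i j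
      using that by (metis lessThan_iff less_diff_conv less_irrefl Suc_eq_plus1)
    then show ?thesis unfolding inj_on_def by (metis linorder_neqE_nat)
  qed
  have gt1: "sqrt (x j) > 1" if "Suc j < b" for j using x(1)[of j] that by auto
  define R where "R = complex_of_real ` (w ` {..<b - 1} \<union> (\<lambda>j. - v j) ` {..<b - 1})"
  have wgt: "w j > 1" "v j > 1" if "Suc j < b" for j using gt1[OF that] w[OF that] v[OF that] by linarith+
  have "card (w ` {..<b - 1} \<union> (\<lambda>j. - v j) ` {..<b - 1}) = (b - 1) + (b - 1)"
  proof (subst card_Un_disjoint)
    show "w ` {..<b - 1} \<inter> (\<lambda>j. - v j) ` {..<b - 1} = {}"
      using wgt by (fastforce simp: less_diff_conv)
    have "inj_on (\<lambda>j. - v j) {..<b - 1}" using inj[of v] v by (auto simp: inj_on_def)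
    then show "card (w ` {..<b - 1}) + card ((\<lambda>j. - v j) ` {..<b - 1}) = b - 1 + (b - 1)"
      using inj[of w] w by (simp add: card_image)
  qed auto
  then have cR: "card R = 2 * (b - 1)" unfolding R_def by (subst card_image) (auto simp: inj_on_def)
  have fR: "finite R" by (simp add: R_def)
  let ?W = "map_poly complex_of_real W"
  have W0': "?W \<noteq> 0" using W0 by (simp add: map_poly_cr_0_iff)
  have RW: "poly ?W z = 0" if zR: "z \<in> R" for z
  proof -
    obtain y where y: "z = of_real y" "y \<in> w ` {..<b - 1} \<union> (\<lambda>j. - v j) ` {..<b - 1}"
      using zR unfolding R_def by blast
    have "poly W y = 0" using y(2) w v by (auto simp: less_diff_conv)
    then show ?thesis by (simp add: y(1) poly_cr)
  qed
  have RZ: "R \<inter> Z = {}"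
    using Z(2) wgt by (force simp: R_def less_diff_conv)
  have "(\<Sum>z\<in>Z. order z (map_poly complex_of_real T)) + card R \<le> (\<Sum>z\<in>Z. order z ?W) + (\<Sum>z\<in>R. order z ?W)"
  proof (intro add_mono sum_mono)
    show "order z (map_poly complex_of_real T) \<le> order z ?W" for z
      using W0' unfolding W_def map_poly_cr_simps by (rule order_map_poly_mult_le)
    have "card R = (\<Sum>z\<in>R. 1)" by simp
    also have "\<dots> \<le> (\<Sum>z\<in>R. order z ?W)"
      by (intro sum_mono) (use RW W0' in \<open>auto simp: order_root Suc_le_eq\<close>)
    finally show "card R \<le> (\<Sum>z\<in>R. order z ?W)" .
  qed
  also have "\<dots> = (\<Sum>z\<in>Z \<union> R. order z ?W)"
    using Z(1) fR RZ by (subst sum.union_disjoint) auto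
  also have "\<dots> \<le> (\<Sum>z\<in>Z \<union> R \<union> {z. poly ?W z = 0}. order z ?W)"
    using Z(1) fR poly_roots_finite[OF W0'] by (intro sum_mono2) auto
  also have "\<dots> = degree ?W"
    using Z(1) fR poly_roots_finite[OF W0'] W0' by (intro degree_eq_sum_order[symmetric]) auto
  also have "\<dots> \<le> max (degree U) (degree V) + 2 * b + degree V" using dW by (simp add: degree_map_poly)
  finally show ?thesis unfolding cR by linarith
qed

section \<open>Pade approximants of E / K\<close>

text \<open>
  The functions \<open>F(a\<^sub>i, b\<^sub>i; c\<^sub>i)\<close> form a chain of contiguous functions: each step raises one of the
  upper parameters and the lower one. It starts with \<open>F(1/2, 1/2; 1) = 2 K / \<pi>\<close>.
\<close>

definition hyp_a :: "nat \<Rightarrow> real" where "hyp_a i = 1/2 + of_nat ((i + 1) div 2)"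
definition hyp_b :: "nat \<Rightarrow> real" where "hyp_b i = 1/2 + of_nat (i div 2)"
definition hyp_c :: "nat \<Rightarrow> real" where "hyp_c i = of_nat (i + 1)"

definition hyp_coeff :: "nat \<Rightarrow> nat \<Rightarrow> real" where
  "hyp_coeff i n = pochhammer (hyp_a i) n * pochhammer (hyp_b i) n / (pochhammer (hyp_c i) n * fact n)"

text \<open>Equal to \<open>hyp_b i / hyp_c i\<close>, because the two upper parameters add up to
  the lower one. These numbers exhibit the coefficients of the continued fraction as a chain
  sequence.\<close>

definition chain_g :: "nat \<Rightarrow> real" where "chain_g i = 1 - hyp_a i / hyp_c i"

fun chain_k :: "nat \<Rightarrow> real" where
  "chain_k 0 = 0"
| "chain_k (Suc i) = (1 - chain_g i) * chain_g (Suc i)"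

lemma hyp_params_Suc: "hyp_a (Suc i) = hyp_b i + 1" "hyp_b (Suc i) = hyp_a i" "hyp_c (Suc i) = hyp_c i + 1"
  by (simp_all add: hyp_a_def hyp_b_def hyp_c_def)

lemma hyp_params_sum: "hyp_a i + hyp_b i = hyp_c i"
proof -
  have "(i + 1) div 2 + i div 2 = i" by (cases "even i") (auto elim!: evenE oddE)
  then have "real ((i + 1) div 2) + real (i div 2) = real i" by (metis of_nat_add)
  then show ?thesis by (simp add: hyp_a_def hyp_b_def hyp_c_def)
qed

lemma hyp_params_pos: "hyp_a i > 0" "hyp_b i > 0" "hyp_c i > 0"
  by (simp_all add: hyp_a_def hyp_b_def hyp_c_def add_pos_nonneg)

lemma chain_g_bounds: "0 < chain_g i" "chain_g i < 1"
  using hyp_params_pos[of i] hyp_params_sum[of i] by (simp_all add: chain_g_def field_simps)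

lemma chain_k_pos: "chain_k (Suc i) > 0"
  using chain_g_bounds[of i] chain_g_bounds[of "Suc i"] by simp

declare chain_k.simps(2) [simp del]

lemma chain_k_eq: "chain_k (Suc i) = hyp_a i * (hyp_c i - hyp_b i) / (hyp_c i * (hyp_c i + 1))"
  using hyp_params_pos(3)[of i] by (simp add: chain_k.simps chain_g_def hyp_params_Suc field_simps)

lemma hyp_coeff_0 [simp]: "hyp_coeff i 0 = 1" by (simp add: hyp_coeff_def)

lemma hyp_coeff_pos: "hyp_coeff i n > 0"
  unfolding hyp_coeff_def using hyp_params_pos[of i] by (intro divide_pos_pos mult_pos_pos pochhammer_pos) auto

text \<open>Gauss' relation between contiguous hypergeometric functions, read off coefficient by
  coefficient.\<close>

lemma hyp_coeff_contiguous: "hyp_coeff (Suc i) (Suc n) - hyp_coeff i (Suc n) = chain_k (Suc i) * hyp_coeff (Suc (Suc i)) n"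
proof -
  define a b c where "a = hyp_a i" and "b = hyp_b i" and "c = hyp_c i"
  have c: "c > 0" using hyp_params_pos by (simp add: c_def)
  define A B C F where "A = pochhammer (a + 1) n" and "B = pochhammer (b + 1) n"
    and "C = pochhammer (c + 2) n" and "F = (fact n :: real)"
  have C: "C > 0" and F: "F > 0" using c by (auto simp: C_def F_def intro!: pochhammer_pos)
  have a1: "pochhammer a (Suc n) = a * A" and b1: "pochhammer b (Suc n) = b * B"
    by (simp_all add: A_def B_def pochhammer_rec)
  have b2: "pochhammer (b + 1) (Suc n) = B * (b + 1 + of_nat n)"
    by (simp add: B_def pochhammer_rec')
  have c1: "pochhammer (c + 1) (Suc n) = (c + 1) * C" by (simp add: C_def pochhammer_rec add.assoc)
  have "pochhammer c (Suc n) * (c + of_nat (Suc n)) = c * pochhammer (c + 1) (Suc n)"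
    by (metis pochhammer_rec pochhammer_rec' mult.commute)
  then have "pochhammer c (Suc n) * (c + 1 + of_nat n) = c * ((c + 1) * C)" by (simp only: c1 of_nat_Suc add.assoc)
  then have c2: "pochhammer c (Suc n) = c * (c + 1) * C / (c + 1 + of_nat n)"
    using c by (simp add: eq_divide_eq mult.assoc)
  have i1: "hyp_coeff (Suc i) (Suc n) = B * (b + 1 + n) * (a * A) / ((c + 1) * C * ((n + 1) * F))"
    unfolding hyp_coeff_def hyp_params_Suc a_def[symmetric] b_def[symmetric] c_def[symmetric] a1 b2 c1
    by (simp add: F_def)
  have i0: "hyp_coeff i (Suc n) = a * A * (b * B) / (c * (c + 1) * C / (c + 1 + n) * ((n + 1) * F))"
    unfolding hyp_coeff_def a_def[symmetric] b_def[symmetric] c_def[symmetric] a1 b1 c2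
    by (simp add: F_def)
  have i2: "hyp_coeff (Suc (Suc i)) n = A * B / (C * F)"
    unfolding hyp_coeff_def hyp_params_Suc a_def[symmetric] b_def[symmetric] c_def[symmetric]
    by (simp add: A_def B_def C_def F_def add.assoc)
  have np: "real n + 1 > 0" "c + 1 + real n > 0" using c by auto
  show ?thesis
    unfolding i1 i0 i2 chain_k_eq a_def[symmetric] b_def[symmetric] c_def[symmetric]
    using c C F np by (simp add: divide_simps) (simp add: algebra_simps)
qed

text \<open>As \<open>a + b = c\<close>, the quotient of consecutive coefficients is at most 1 once
  \<open>a b \<le> c\<close>. This holds at the start of the chain but not for large
  \<open>i\<close>.\<close>

lemma hyp_coeff_le_1:
  assumes "i \<le> 1"
  shows "hyp_coeff i n \<le> 1"
proof (induction n)
  case (Suc n)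
  have "hyp_coeff i (Suc n) = hyp_coeff i n * ((hyp_a i + n) * (hyp_b i + n) / ((hyp_c i + n) * (1 + n)))"
    unfolding hyp_coeff_def pochhammer_Suc fact_Suc by (simp add: field_simps)
  also have "\<dots> \<le> hyp_coeff i n * 1"
  proof (intro mult_left_mono)
    have "hyp_a i * hyp_b i \<le> hyp_c i" using assms by (cases i) (auto simp: hyp_a_def hyp_b_def hyp_c_def)
    then have "(hyp_a i + n) * (hyp_b i + n) \<le> (hyp_c i + n) * (1 + n)"
    proof -
      have "(hyp_a i + n) * (hyp_b i + n) = hyp_a i * hyp_b i + n * (hyp_a i + hyp_b i) + real n * n" by (simp add: algebra_simps)
      also have "\<dots> \<le> (hyp_c i + n) * (1 + n)" unfolding hyp_params_sum using \<open>hyp_a i * hyp_b i \<le> hyp_c i\<close> by (simp add: algebra_simps)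
      finally show ?thesis .
    qed
    then show "(hyp_a i + n) * (hyp_b i + n) / ((hyp_c i + n) * (1 + n)) \<le> 1"
      using hyp_params_pos[of i] by (simp add: divide_le_eq_1 add_pos_nonneg)
  qed (use hyp_coeff_pos[of i n] in auto)
  finally show ?case using Suc by simp
qed simp

lemma summable_hyp_coeff:
  assumes "0 \<le> r" "r < 1"
  shows "summable (\<lambda>n. hyp_coeff i n * r ^ n)"
proof (induction i rule: less_induct)
  case (less i)
  show ?case
  proof (cases "i \<le> 1")
    case True
    show ?thesis
      by (rule summable_comparison_test'[of "\<lambda>n. r ^ n" 0])
         (use assms hyp_coeff_le_1[OF True] hyp_coeff_pos[of i] in \<open>auto simp: mult_left_le_one_le less_imp_le summable_geometric\<close>)
  next
    case False
    then obtain j where i: "i = Suc (Suc j)" by (metis One_nat_def Suc_le_eq less_eq_nat.simps(1) not_less_eq_eq old.nat.exhaust)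
    show ?thesis
    proof (cases "r = 0")
      case True
      then show ?thesis by (simp add: summable_0_powser)
    next
      \<comment> \<open>Later members inherit convergence from the two before them: the contiguous
        relation is solved for its last term, on division by
        \<open>chain_k (Suc j) * r\<close>.\<close>
      case r0: False
      have "summable (\<lambda>n. hyp_coeff (Suc j) n * r ^ n)" "summable (\<lambda>n. hyp_coeff j n * r ^ n)"
        using less i by auto
      then have "summable (\<lambda>n. hyp_coeff (Suc j) (Suc n) * r ^ Suc n - hyp_coeff j (Suc n) * r ^ Suc n)"
        by (intro summable_diff) (simp_all only: summable_Suc_iff[of "\<lambda>n. hyp_coeff (Suc j) n * r ^ n"] summable_Suc_iff[of "\<lambda>n. hyp_coeff j n * r ^ n"])
      then have "summable (\<lambda>n. inverse (chain_k (Suc j) * r) * ((hyp_coeff (Suc j) (Suc n) - hyp_coeff j (Suc n)) * r ^ Suc n))"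
        by (intro summable_mult) (simp add: algebra_simps)
      also have "(\<lambda>n. inverse (chain_k (Suc j) * r) * ((hyp_coeff (Suc j) (Suc n) - hyp_coeff j (Suc n)) * r ^ Suc n)) = (\<lambda>n. hyp_coeff i n * r ^ n)"
        unfolding hyp_coeff_contiguous i using chain_k_pos[of j] r0 by (auto simp: field_simps)
      finally show ?thesis .
    qed
  qed
qed

section \<open>The contiguous functions in the unit disc\<close>

definition hyp_F :: "nat \<Rightarrow> complex \<Rightarrow> complex" where "hyp_F i z = (\<Sum>n. of_real (hyp_coeff i n) * z ^ n)"

lemma summable_norm_hyp_F: "norm z < 1 \<Longrightarrow> summable (\<lambda>n. norm (of_real (hyp_coeff i n) * z ^ n :: complex))"
  using summable_hyp_coeff[of "norm z" i] hyp_coeff_pos[of i] by (simp add: norm_mult norm_power less_imp_le)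

lemma hyp_F_sums: "norm z < 1 \<Longrightarrow> (\<lambda>n. of_real (hyp_coeff i n) * z ^ n) sums hyp_F i z"
  unfolding hyp_F_def using summable_norm_cancel[OF summable_norm_hyp_F] by (rule summable_sums)

lemma hyp_F_of_real:
  assumes "0 \<le> r" "r < 1"
  shows "hyp_F i (of_real r) = of_real (\<Sum>n. hyp_coeff i n * r ^ n)"
  using summable_hyp_coeff[OF assms, of i] unfolding hyp_F_def by (subst suminf_of_real) auto

definition real_hyp_F :: "nat \<Rightarrow> real \<Rightarrow> real" where "real_hyp_F i r = (\<Sum>n. hyp_coeff i n * r ^ n)"

lemma real_hyp_F_pos: assumes "0 \<le> r" "r < 1" shows "real_hyp_F i r \<ge> 1"
proof -
  have "(\<Sum>n\<in>{0}. hyp_coeff i n * r ^ n) \<le> real_hyp_F i r"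
    unfolding real_hyp_F_def using hyp_coeff_pos[of i] assms
    by (intro sum_le_suminf summable_hyp_coeff) (auto simp: less_imp_le)
  then show ?thesis by simp
qed

lemma real_hyp_F_mono: assumes "0 \<le> r" "r \<le> s" "s < 1" shows "real_hyp_F i r \<le> real_hyp_F i s"
  unfolding real_hyp_F_def using assms hyp_coeff_pos[of i]
  by (intro suminf_le summable_hyp_coeff mult_left_mono power_mono) (auto simp: less_imp_le)

lemma norm_hyp_F_le: assumes "norm z \<le> r" "r < 1" shows "norm (hyp_F i z) \<le> real_hyp_F i r"
proof -
  have z: "norm z < 1" using assms by simp
  have "norm (hyp_F i z) \<le> (\<Sum>n. norm (of_real (hyp_coeff i n) * z ^ n :: complex))"
    unfolding hyp_F_def by (rule summable_norm[OF summable_norm_hyp_F[OF z]])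
  also have "\<dots> = real_hyp_F i (norm z)" unfolding real_hyp_F_def using hyp_coeff_pos[of i] by (simp add: norm_mult norm_power less_imp_le)
  also have "\<dots> \<le> real_hyp_F i r" using assms by (intro real_hyp_F_mono) auto
  finally show ?thesis .
qed

lemma hyp_F_holomorphic: "hyp_F i holomorphic_on ball 0 1"
  by (rule power_series_holomorphic) (use hyp_F_sums in auto)

lemma hyp_F_contiguous:
  assumes "norm z < 1"
  shows "hyp_F (Suc i) z - hyp_F i z = of_real (chain_k (Suc i)) * z * hyp_F (Suc (Suc i)) z"
proof -
  have s: "(\<lambda>n. of_real (hyp_coeff (Suc i) (Suc n) - hyp_coeff i (Suc n)) * z ^ Suc n) sums
      (hyp_F (Suc i) z - hyp_F i z - (of_real (hyp_coeff (Suc i) 0 - hyp_coeff i 0) * z ^ 0))"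
    using sums_split_initial_segment[OF sums_diff[OF hyp_F_sums[OF assms, of "Suc i"] hyp_F_sums[OF assms, of i]], of 1]
    by (simp add: algebra_simps)
  have "(\<lambda>n. (of_real (chain_k (Suc i)) * z) * (of_real (hyp_coeff (Suc (Suc i)) n) * z ^ n)) sums
      ((of_real (chain_k (Suc i)) * z) * hyp_F (Suc (Suc i)) z)"
    by (intro sums_mult hyp_F_sums assms)
  moreover have "(\<lambda>n. (of_real (chain_k (Suc i)) * z) * (of_real (hyp_coeff (Suc (Suc i)) n) * z ^ n)) =
     (\<lambda>n. of_real (hyp_coeff (Suc i) (Suc n) - hyp_coeff i (Suc n)) * z ^ Suc n)"
    unfolding hyp_coeff_contiguous by (simp add: mult_ac)
  ultimately show ?thesis using sums_unique2[OF s] by simp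
qed

abbreviation cpoly :: "real poly \<Rightarrow> complex \<Rightarrow> complex" where
  "cpoly p z \<equiv> poly (map_poly complex_of_real p) z"

lemma cpoly_simps [simp]:
  "cpoly (p + q) z = cpoly p z + cpoly q z" "cpoly (p - q) z = cpoly p z - cpoly q z" "cpoly (p * q) z = cpoly p z * cpoly q z"
  "cpoly 1 z = 1" "cpoly (pCons a p) z = of_real a + z * cpoly p z" "cpoly 0 z = 0" "cpoly (smult c p) z = of_real c * cpoly p z"
  "cpoly (- p) z = - cpoly p z"
proof -
  show a: "cpoly (p + q) z = cpoly p z + cpoly q z" "cpoly (p - q) z = cpoly p z - cpoly q z" "cpoly (p * q) z = cpoly p z * cpoly q z" "cpoly 1 z = 1" "cpoly 0 z = 0" for p q
    by (simp_all only: map_poly_cr_simps poly_add poly_diff poly_mult poly_1 map_poly_0 poly_0)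
  show p: "cpoly (pCons a p) z = of_real a + z * cpoly p z" for a p by (simp add: map_poly_pCons)
  have "smult c p = [:c:] * p" by simp
  then show "cpoly (smult c p) z = of_real c * cpoly p z" by (simp only: a p) simp
  show "cpoly (- p) z = - cpoly p z" using a(2)[of 0 p] a(5) by simp
qed

lemma cpoly_prod: "cpoly (\<Prod>i\<in>A. f i) z = (\<Prod>i\<in>A. cpoly (f i) z)"
  by (induction A rule: infinite_finite_induct) simp_all

lemma cpoly_power: "cpoly (p ^ n) z = cpoly p z ^ n" by (induction n) simp_all

lemma cpoly_pcompose: "cpoly (pcompose p q) z = cpoly p (cpoly q z)"
  by (induction p) (simp_all add: pcompose_pCons)

text \<open>The chain for the numerators. The step \<open>E = F\<^sub>0 - z/2 F\<^sub>1\<close>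
  precedes the chain of contiguous relations; since \<open>chain_g 0 = 1/2\<close>, a 0 put before
  the parameters produces the coefficient \<open>1/2\<close> first and the old coefficients
  afterwards.\<close>

fun chain_g' :: "nat \<Rightarrow> real" where "chain_g' 0 = 0" | "chain_g' (Suc i) = chain_g i"
fun chain_k' :: "nat \<Rightarrow> real" where "chain_k' 0 = 0" | "chain_k' (Suc i) = (1 - chain_g' i) * chain_g' (Suc i)"

declare chain_k'.simps(2) [simp del]

lemma chain_k'_1: "chain_k' (Suc 0) = 1/2" by (simp add: chain_k'.simps chain_g_def hyp_a_def hyp_c_def)
lemma chain_k'_Suc: "chain_k' (Suc (Suc i)) = chain_k (Suc i)" by (simp add: chain_k'.simps chain_k.simps)
lemma chain_k'_pos: "chain_k' (Suc i) > 0" using chain_k_pos[of "i - 1"] by (cases i) (auto simp: chain_k'_1 chain_k'_Suc)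

definition pade_denom :: "nat \<Rightarrow> real poly" where "pade_denom n = sturm chain_k n"
definition pade_numer :: "nat \<Rightarrow> real poly" where "pade_numer n = sturm chain_k' (Suc n)"

lemma pade_denom_rec: "pade_denom 0 = 1" "pade_denom (Suc 0) = 1" "pade_denom (Suc (Suc n)) = pade_denom (Suc n) - [:0, chain_k (Suc n):] * pade_denom n"
  by (simp_all add: pade_denom_def)

lemma pade_numer_rec: "pade_numer 0 = 1" "pade_numer (Suc 0) = [:1, - 1/2:]" "pade_numer (Suc (Suc n)) = pade_numer (Suc n) - [:0, chain_k (Suc n):] * pade_numer n"
  by (simp_all add: pade_numer_def one_pCons chain_k'_1 chain_k'_Suc)

text \<open>The Casorati determinant of two solutions of the same three-term recurrence gains one
  coefficient as a factor at each step. It provides both the interlacing of the zeros and the Pade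
  remainder.\<close>

lemma casorati: "pade_denom (Suc n) * pade_numer n - pade_denom n * pade_numer (Suc n) = [:0, 1/2:] * (\<Prod>i<n. [:0, chain_k (Suc i):])"
proof (induction n)
  case 0
  then show ?case by (simp add: pade_denom_rec pade_numer_rec one_pCons)
next
  case (Suc n)
  have "pade_denom (Suc (Suc n)) * pade_numer (Suc n) - pade_denom (Suc n) * pade_numer (Suc (Suc n)) =
      [:0, chain_k (Suc n):] * (pade_denom (Suc n) * pade_numer n - pade_denom n * pade_numer (Suc n))"
    unfolding pade_denom_rec pade_numer_rec by (simp only: algebra_simps)
  then show ?case unfolding Suc prod.lessThan_Suc by (simp only: mult_ac)
qed

lemma casorati_pos:
  assumes "x > 0"
  shows "poly (pade_denom (Suc n)) x * poly (pade_numer n) x - poly (pade_denom n) x * poly (pade_numer (Suc n)) x > 0"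
proof -
  have "poly (pade_denom (Suc n)) x * poly (pade_numer n) x - poly (pade_denom n) x * poly (pade_numer (Suc n)) x =
     poly ([:0, 1/2:] * (\<Prod>i<n. [:0, chain_k (Suc i):])) x"
    unfolding casorati[symmetric] by simp
  also have "\<dots> = x / 2 * (\<Prod>i<n. x * chain_k (Suc i))" by (simp add: poly_prod)
  also have "\<dots> > 0" using assms chain_k_pos by (intro mult_pos_pos prod_pos) auto
  finally show ?thesis .
qed

section \<open>Positivity and interlacing\<close>

lemma pade_denom_pos: "0 \<le> x \<Longrightarrow> x \<le> 1 \<Longrightarrow> poly (pade_denom n) x > 0"
  unfolding pade_denom_def using sturm_pos[of chain_g chain_k x n, OF _ _ chain_k.simps(2)] chain_g_bounds by (auto simp: less_imp_le)

lemma pade_numer_pos: "0 \<le> x \<Longrightarrow> x \<le> 1 \<Longrightarrow> poly (pade_numer n) x > 0"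
proof -
  have "0 \<le> chain_g' i \<and> chain_g' i < 1" for i using chain_g_bounds[of "i - 1"] by (cases i) auto
  then show "0 \<le> x \<Longrightarrow> x \<le> 1 \<Longrightarrow> poly (pade_numer n) x > 0"
    unfolding pade_numer_def using sturm_pos[of chain_g' chain_k' x "Suc n", OF _ _ chain_k'.simps(2)] by auto
qed

text \<open>By the positive determinant the quotients numerator / denominator decrease with
  \<open>n\<close>; they start at 1.\<close>

lemma pade_numer_le_pade_denom:
  assumes "0 < x" "x \<le> 1"
  shows "poly (pade_numer n) x \<le> poly (pade_denom n) x"
proof (induction n)
  case (Suc n)
  have p: "poly (pade_denom n) x > 0" "poly (pade_denom (Suc n)) x > 0" "poly (pade_numer n) x > 0" using pade_denom_pos pade_numer_pos assms by auto
  have "poly (pade_denom n) x * poly (pade_numer (Suc n)) x \<le> poly (pade_denom (Suc n)) x * poly (pade_numer n) x"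
    using casorati_pos[OF assms(1), of n] by simp
  also have "\<dots> \<le> poly (pade_denom (Suc n)) x * poly (pade_denom n) x" using p Suc by (intro mult_left_mono) auto
  finally show ?case using p by (simp add: mult.commute)
qed (simp add: pade_denom_rec pade_numer_rec)

lemma neg_factor: "u * v < 0 \<Longrightarrow> 0 < u \<Longrightarrow> v < (0::real)" by (simp add: mult_less_0_iff)

text \<open>At a root of the denominator one product of the determinant drops out, so the signs of
  the numerator follow from those of the preceding denominator. The even index is chosen because
  there both polynomials have the same degree bound \<open>j + 1\<close>, which is also the number
  of roots.\<close>

lemma pade_denom_roots:
  obtains x where "strict_mono_on {..<Suc j} x" "\<And>i. i < Suc j \<Longrightarrow> x i > 1"
    "\<And>i. i < Suc j \<Longrightarrow> poly (pade_denom (2 * j + 2)) (x i) = 0"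
    "\<And>i. i < Suc j \<Longrightarrow> (-1) ^ i * poly (pade_numer (2 * j + 2)) (x i) * (-1) > 0"
proof -
  have "poly (sturm chain_k n) 1 > 0" for n using pade_denom_pos[of 1 n] by (simp add: pade_denom_def)
  then obtain x where x: "strict_mono_on {..<Suc j} x" "\<And>i. i < Suc j \<Longrightarrow> x i > 1"
    "\<And>i. i < Suc j \<Longrightarrow> poly (pade_denom (2 * j + 2)) (x i) = 0"
    "\<And>i. i < Suc j \<Longrightarrow> (-1) ^ i * poly (pade_denom (2 * j + 1)) (x i) > 0"
    using sturm_roots[of chain_k "2 * j + 1", OF chain_k_pos] by (auto simp: pade_denom_def simp del: sturm.simps)
  show thesis
  proof (rule that[OF x(1-3)])
    fix i assume i: "i < Suc j"
    have "poly (pade_denom (2 * j + 1)) (x i) * poly (pade_numer (2 * j + 2)) (x i) < 0"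
      using casorati_pos[of "x i" "2 * j + 1"] x(2,3)[OF i] by simp
    then have "((-1) ^ i * poly (pade_denom (2 * j + 1)) (x i)) * ((-1) ^ i * poly (pade_numer (2 * j + 2)) (x i)) < 0"
      by (cases "even i") simp_all
    then have "(-1) ^ i * poly (pade_numer (2 * j + 2)) (x i) < 0"
      using x(4)[OF i] by (rule neg_factor)
    then show "(-1) ^ i * poly (pade_numer (2 * j + 2)) (x i) * (-1) > 0" by simp
  qed
qed

lemma pade_numer_roots:
  obtains x where "strict_mono_on {..<Suc j} x" "\<And>i. i < Suc j \<Longrightarrow> x i > 1"
    "\<And>i. i < Suc j \<Longrightarrow> poly (pade_numer (2 * j + 2)) (x i) = 0"
    "\<And>i. i < Suc j \<Longrightarrow> (-1) ^ i * poly (pade_denom (2 * j + 2)) (x i) * 1 > 0"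
proof -
  have pos: "poly (sturm chain_k' n) 1 > 0" for n using pade_numer_pos[of 1 "n - 1"] by (cases n) (simp_all add: pade_numer_def)
  obtain x where x: "strict_mono_on {..<Suc j} x" "\<And>i. i < Suc j \<Longrightarrow> x i > 1"
    "\<And>i. i < Suc j \<Longrightarrow> poly (pade_numer (2 * j + 2)) (x i) = 0"
    "\<And>i. i < Suc j \<Longrightarrow> (-1) ^ i * poly (pade_numer (2 * j + 1)) (x i) > 0"
    using sturm_roots[of chain_k' "2 * j + 2", OF chain_k'_pos pos] by (auto simp: pade_numer_def simp del: sturm.simps)
  show thesis
  proof (rule that[OF x(1-3)])
    fix i assume i: "i < Suc j"
    have "poly (pade_denom (2 * j + 2)) (x i) * poly (pade_numer (2 * j + 1)) (x i) > 0"
      using casorati_pos[of "x i" "2 * j + 1"] x(2,3)[OF i] by simp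
    then have "((-1) ^ i * poly (pade_denom (2 * j + 2)) (x i)) * ((-1) ^ i * poly (pade_numer (2 * j + 1)) (x i)) > 0"
      by (cases "even i") simp_all
    then have "(-1) ^ i * poly (pade_denom (2 * j + 2)) (x i) > 0"
      using x(4)[OF i] by (rule zero_less_mult_pos2)
    then show "(-1) ^ i * poly (pade_denom (2 * j + 2)) (x i) * 1 > 0" by simp
  qed
qed

lemma degree_pade: "degree (pade_denom (2 * j + 2)) \<le> Suc j" "degree (pade_numer (2 * j + 2)) \<le> Suc j"
  unfolding pade_denom_def pade_numer_def using degree_sturm[of chain_k "2 * j + 2"] degree_sturm[of chain_k' "Suc (2 * j + 2)"]
  by (simp_all del: sturm.simps)

text \<open>All roots \<open>x\<close> are real and exceed 1, so in the product over the roots each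
  factor satisfies \<open>\<bar>1 - z / x\<bar> \<ge> 1 - r / x > 0\<close>.\<close>

lemma norm_pade_denom_ge:
  assumes "norm z \<le> r" "r < 1"
  shows "norm (cpoly (pade_denom (2 * j + 2)) z) \<ge> poly (pade_denom (2 * j + 2)) r"
proof -
  obtain x where x: "strict_mono_on {..<Suc j} x" "\<And>i. i < Suc j \<Longrightarrow> x i > 1"
    "\<And>i. i < Suc j \<Longrightarrow> poly (pade_denom (2 * j + 2)) (x i) = 0"
    "\<And>i. i < Suc j \<Longrightarrow> (-1) ^ i * poly (pade_numer (2 * j + 2)) (x i) * (-1) > 0"
    by (rule pade_denom_roots[of j]) blast
  have e: "poly (pade_denom (2 * j + 2)) y = (\<Prod>i<Suc j. 1 - y / x i)" for y
  proof (rule poly_eq_prod_roots[OF degree_pade(1) strict_mono_on_imp_inj_on[OF x(1)]])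
    show "x i \<noteq> 0 \<and> poly (pade_denom (2 * j + 2)) (x i) = 0" if "i < Suc j" for i
      using x(2,3)[OF that] by simp
    show "poly (pade_denom (2 * j + 2)) 0 = 1" unfolding pade_denom_def by (rule poly_sturm_0)
  qed
  have "pade_denom (2 * j + 2) = (\<Prod>i<Suc j. [:1, - (1 / x i):])"
    by (rule poly_eq_poly_eq_iff[THEN iffD1], rule ext, unfold e poly_prod) simp
  then have c: "cpoly (pade_denom (2 * j + 2)) z = (\<Prod>i<Suc j. 1 - z / of_real (x i))"
    by (simp only: cpoly_prod cpoly_simps) simp
  have "(\<Prod>i<Suc j. 1 - r / x i) \<le> (\<Prod>i<Suc j. norm (1 - z / of_real (x i)))"
  proof (intro prod_mono conjI)
    fix i assume "i \<in> {..<Suc j}"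
    then have xi: "x i > 1" using x by auto
    have r0: "r \<ge> 0" using assms norm_ge_zero order_trans by blast
    show "0 \<le> 1 - r / x i" using xi assms r0 by (simp add: field_simps)
    have "norm (z / of_real (x i)) \<le> r / x i" using xi assms by (simp add: norm_divide divide_right_mono)
    then show "1 - r / x i \<le> norm (1 - z / of_real (x i))"
      using norm_triangle_ineq2[of 1 "z / of_real (x i)"] by simp
  qed
  then show ?thesis unfolding e c by (simp add: prod_norm)
qed

text \<open>\<open>hyp_E (k\<^sup>2)\<close> is \<open>2 E / \<pi>\<close>, that is
  \<open>F(-1/2, 1/2; 1)\<close> expressed through the first two functions of the chain.\<close>

definition hyp_E :: "complex \<Rightarrow> complex" where "hyp_E z = hyp_F 0 z - z / 2 * hyp_F 1 z"

text \<open>The contiguous relation is applied again and again to the earlier of the last two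
  functions; their coefficients obey the recurrence of the denominators.\<close>

lemma hyp_F_0_pade:
  assumes "norm z < 1"
  shows "hyp_F 0 z = cpoly (pade_denom (Suc n)) z * hyp_F (Suc n) z - of_real (chain_k (Suc n)) * z * cpoly (pade_denom n) z * hyp_F (Suc (Suc n)) z"
proof (induction n)
  case 0
  then show ?case using hyp_F_contiguous[OF assms, of 0] by (simp add: pade_denom_rec algebra_simps)
next
  case (Suc n)
  have h: "hyp_F (Suc n) z = hyp_F (Suc (Suc n)) z - of_real (chain_k (Suc (Suc n))) * z * hyp_F (Suc (Suc (Suc n))) z"
    using hyp_F_contiguous[OF assms, of "Suc n"] by (simp add: algebra_simps)
  show ?case unfolding Suc h pade_denom_rec by (simp add: algebra_simps)
qed

lemma hyp_E_pade:
  assumes "norm z < 1"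
  shows "hyp_E z = cpoly (pade_numer (Suc n)) z * hyp_F (Suc n) z - of_real (chain_k (Suc n)) * z * cpoly (pade_numer n) z * hyp_F (Suc (Suc n)) z"
proof (induction n)
  case 0
  then show ?case using hyp_F_contiguous[OF assms, of 0] by (simp add: hyp_E_def pade_numer_rec algebra_simps)
next
  case (Suc n)
  have h: "hyp_F (Suc n) z = hyp_F (Suc (Suc n)) z - of_real (chain_k (Suc (Suc n))) * z * hyp_F (Suc (Suc (Suc n))) z"
    using hyp_F_contiguous[OF assms, of "Suc n"] by (simp add: algebra_simps)
  show ?case unfolding Suc h pade_numer_rec by (simp add: algebra_simps)
qed

text \<open>The terms with \<open>hyp_F (Suc n)\<close> cancel, and those with the next function
  leave the determinant as their coefficient. The order of contact at the origin is
  \<open>n + 2\<close>.\<close>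

lemma pade_remainder:
  assumes "norm z < 1"
  shows "hyp_F 0 z * cpoly (pade_numer (Suc n)) z - hyp_E z * cpoly (pade_denom (Suc n)) z =
    hyp_F (Suc (Suc n)) z * (z / 2) * (\<Prod>i<Suc n. z * of_real (chain_k (Suc i)))"
proof -
  have "hyp_F 0 z * cpoly (pade_numer (Suc n)) z - hyp_E z * cpoly (pade_denom (Suc n)) z =
     of_real (chain_k (Suc n)) * z * hyp_F (Suc (Suc n)) z * cpoly (pade_denom (Suc n) * pade_numer n - pade_denom n * pade_numer (Suc n)) z"
    unfolding hyp_F_0_pade[OF assms, of n] hyp_E_pade[OF assms, of n] by (simp add: algebra_simps)
  also have "cpoly (pade_denom (Suc n) * pade_numer n - pade_denom n * pade_numer (Suc n)) z = z / 2 * (\<Prod>i<n. z * of_real (chain_k (Suc i)))"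
    unfolding casorati by (simp only: cpoly_simps cpoly_prod) simp
  finally show ?thesis by (simp add: mult_ac)
qed

lemma hyp_F_real: "0 \<le> r \<Longrightarrow> r < 1 \<Longrightarrow> hyp_F i (of_real r) = of_real (real_hyp_F i r)"
  unfolding real_hyp_F_def by (rule hyp_F_of_real)

definition real_hyp_E :: "real \<Rightarrow> real" where "real_hyp_E r = real_hyp_F 0 r - r / 2 * real_hyp_F 1 r"

lemma hyp_E_real: "0 \<le> r \<Longrightarrow> r < 1 \<Longrightarrow> hyp_E (of_real r) = of_real (real_hyp_E r)"
  by (simp add: hyp_E_def real_hyp_E_def hyp_F_real)

lemma pade_remainder_real:
  assumes "0 \<le> r" "r < 1"
  shows "real_hyp_F 0 r * poly (pade_numer (Suc n)) r - real_hyp_E r * poly (pade_denom (Suc n)) r =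
    real_hyp_F (Suc (Suc n)) r * (r / 2) * (\<Prod>i<Suc n. r * chain_k (Suc i))"
proof -
  have "complex_of_real (real_hyp_F 0 r * poly (pade_numer (Suc n)) r - real_hyp_E r * poly (pade_denom (Suc n)) r) =
    of_real (real_hyp_F (Suc (Suc n)) r * (r / 2) * (\<Prod>i<Suc n. r * chain_k (Suc i)))"
    using pade_remainder[of "of_real r" n] assms
    by (simp only: hyp_F_real[OF assms] hyp_E_real[OF assms] poly_cr norm_of_real) simp
  then show ?thesis by (simp only: of_real_eq_iff)
qed

text \<open>The remainder at \<open>z\<close> is at most \<open>(r / s) ^ (2 j + 3)\<close> times
  the same expression at the real point \<open>s\<close>. There its factors need no separate
  estimates: the remainder is \<open>F\<^sub>0 C - E B\<close>, and after division by
  \<open>B\<close> the inequality \<open>C \<le> B\<close> bounds it independently of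
  \<open>j\<close>.\<close>

lemma pade_error:
  assumes "norm z \<le> r" "0 < r" "r < s" "s < 1"
  shows "norm (hyp_F 0 z * cpoly (pade_numer (2 * j + 2)) z / cpoly (pade_denom (2 * j + 2)) z - hyp_E z) \<le> (r / s) ^ (2 * j + 3) * (real_hyp_F 0 s + \<bar>real_hyp_E s\<bar>)"
proof -
  define N where "N = 2 * j + 1"
  have N: "2 * j + 2 = Suc N" by (simp add: N_def)
  define K where "K = (\<Prod>i<Suc N. chain_k (Suc i))"
  have K: "K > 0" unfolding K_def by (intro prod_pos) (simp add: chain_k_pos)
  have PK: "(\<Prod>i<Suc N. x * of_real (chain_k (Suc i))) = x ^ Suc N * of_real K" for x :: "'a::{real_algebra_1,comm_ring_1}"
    unfolding K_def prod.distrib by (simp only: prod_constant card_lessThan of_real_prod)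
  have z1: "norm z < 1" using assms by simp
  have B0: "poly (pade_denom (Suc N)) s > 0" using pade_denom_pos assms by simp
  have Bz: "norm (cpoly (pade_denom (Suc N)) z) \<ge> poly (pade_denom (Suc N)) s" using norm_pade_denom_ge[of z s j, unfolded N] assms by simp
  then have Bz0: "cpoly (pade_denom (Suc N)) z \<noteq> 0" using B0 by auto
  have "hyp_F 0 z * cpoly (pade_numer (Suc N)) z / cpoly (pade_denom (Suc N)) z - hyp_E z =
     (hyp_F 0 z * cpoly (pade_numer (Suc N)) z - hyp_E z * cpoly (pade_denom (Suc N)) z) / cpoly (pade_denom (Suc N)) z"
    using Bz0 by (simp add: diff_divide_distrib)
  also have "\<dots> = hyp_F (Suc (Suc N)) z * (z / 2) * (z ^ Suc N * of_real K) / cpoly (pade_denom (Suc N)) z"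
    unfolding pade_remainder[OF z1] PK ..
  finally have "norm (hyp_F 0 z * cpoly (pade_numer (Suc N)) z / cpoly (pade_denom (Suc N)) z - hyp_E z) =
      norm (hyp_F (Suc (Suc N)) z) * (norm z / 2) * (norm z ^ Suc N * K) / norm (cpoly (pade_denom (Suc N)) z)"
    using K by (simp only: norm_mult norm_divide norm_power norm_of_real abs_of_pos norm_numeral)
  also have "\<dots> \<le> real_hyp_F (Suc (Suc N)) s * (r / 2) * (r ^ Suc N * K) / poly (pade_denom (Suc N)) s"
    using assms B0 K Bz real_hyp_F_pos[of s "Suc (Suc N)"]
    by (intro frac_le mult_mono norm_hyp_F_le power_mono divide_right_mono mult_nonneg_nonneg) auto
  also have "\<dots> = (r / s) ^ (N + 2) * (real_hyp_F (Suc (Suc N)) s * (s / 2) * (s ^ Suc N * K) / poly (pade_denom (Suc N)) s)"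
    using assms B0 by (simp add: power_divide power_add power2_eq_square)
  also have "real_hyp_F (Suc (Suc N)) s * (s / 2) * (s ^ Suc N * K) =
      real_hyp_F 0 s * poly (pade_numer (Suc N)) s - real_hyp_E s * poly (pade_denom (Suc N)) s"
    using pade_remainder_real[of s N] PK[of s] assms by simp
  also have "(r / s) ^ (N + 2) * ((real_hyp_F 0 s * poly (pade_numer (Suc N)) s - real_hyp_E s * poly (pade_denom (Suc N)) s) / poly (pade_denom (Suc N)) s)
     \<le> (r / s) ^ (N + 2) * (real_hyp_F 0 s + \<bar>real_hyp_E s\<bar>)"
  proof (rule mult_left_mono)
    have "real_hyp_F 0 s * poly (pade_numer (Suc N)) s \<le> real_hyp_F 0 s * poly (pade_denom (Suc N)) s"
      using pade_numer_le_pade_denom[of s "Suc N"] real_hyp_F_pos[of s 0] assms by (intro mult_left_mono) auto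
    moreover have "- real_hyp_E s * poly (pade_denom (Suc N)) s \<le> \<bar>real_hyp_E s\<bar> * poly (pade_denom (Suc N)) s"
      using B0 by (intro mult_right_mono) auto
    ultimately show "(real_hyp_F 0 s * poly (pade_numer (Suc N)) s - real_hyp_E s * poly (pade_denom (Suc N)) s) / poly (pade_denom (Suc N)) s \<le> real_hyp_F 0 s + \<bar>real_hyp_E s\<bar>"
      using B0 by (simp add: divide_le_eq algebra_simps)
  qed (use assms in auto)
  finally show ?thesis unfolding N by (simp add: N_def eval_nat_numeral)
qed

lemma pade_uniform_limit:
  assumes "0 < r" "r < 1"
  shows "uniform_limit (cball 0 r) (\<lambda>j z. hyp_F 0 z * cpoly (pade_numer (2 * j + 2)) z / cpoly (pade_denom (2 * j + 2)) z) hyp_E sequentially"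
proof -
  define s where "s = (r + 1) / 2"
  have s: "r < s" "s < 1" using assms by (auto simp: s_def)
  define M where "M = real_hyp_F 0 s + \<bar>real_hyp_E s\<bar>"
  have "(\<lambda>j. ((r / s)^2) ^ j * ((r / s)^3 * M)) \<longlonglongrightarrow> 0 * ((r / s)^3 * M)"
    using power_strict_mono[of "r / s" 1 2] assms s
    by (intro tendsto_mult tendsto_const LIMSEQ_power_zero) (auto simp del: power_divide)
  then have lim: "(\<lambda>j. (r / s) ^ (2 * j + 3) * M) \<longlonglongrightarrow> 0"
    by (simp add: power_add power_mult mult.assoc)
  show ?thesis
  proof (rule uniform_limitI)
    fix e :: real assume "e > 0"
    from order_tendstoD(2)[OF lim this]
    have "\<forall>\<^sub>F j in sequentially. (r / s) ^ (2 * j + 3) * M < e" .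
    then show "\<forall>\<^sub>F j in sequentially. \<forall>z\<in>cball 0 r. dist (hyp_F 0 z * cpoly (pade_numer (2 * j + 2)) z / cpoly (pade_denom (2 * j + 2)) z) (hyp_E z) < e"
    proof eventually_elim
      case (elim j)
      then show ?case using pade_error[of _ r s j] assms s by (fastforce simp: dist_norm M_def)
    qed
  qed
qed

section \<open>Zeros of P K + Q E\<close>

text \<open>Rouche's theorem on a small circle, with \<open>F n - f\<close> as the perturbation:
  uniform convergence brings it below the minimum of \<open>\<bar>f\<bar>\<close> on the
  circle.\<close>

lemma hurwitz_multiplicity:
  fixes f :: "complex \<Rightarrow> complex" and F :: "nat \<Rightarrow> complex \<Rightarrow> complex"
  assumes f: "f holomorphic_on ball c R" and R: "R > 0"
    and F: "\<And>n. F n holomorphic_on ball c R"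
    and lim: "\<And>r. 0 < r \<Longrightarrow> r < R \<Longrightarrow> uniform_limit (cball c r) F f sequentially"
    and z0: "z0 \<in> ball c R" "f z0 \<noteq> 0" and fc: "f c = 0"
  obtains e where "e > 0"
    "\<And>r. 0 < r \<Longrightarrow> r < e \<Longrightarrow>
       \<forall>\<^sub>F n in sequentially. finite {z\<in>ball c r. F n z = 0} \<and> (\<Sum>z\<in>{z\<in>ball c r. F n z = 0}. zorder (F n) z) = zorder f c"
proof -
  obtain e where e: "0 < e" "ball c e \<subseteq> ball c R" "\<And>z. z \<in> ball c e - {c} \<Longrightarrow> f z \<noteq> 0"
    using isolated_zeros[OF f open_ball connected_ball _ fc z0] R by auto
  have eR: "e \<le> R" using e(2) e(1) by (simp add: ball_subset_ball_iff)
  show ?thesis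
  proof (rule that[OF e(1)])
    fix r :: real assume r: "0 < r" "r < e"
    \<comment> \<open>The open disc of radius \<open>r'\<close> contains the circle, as Rouche's
      theorem requires. Zeros of \<open>F n\<close> between the two circles have winding number
      0.\<close>
    obtain r' where r': "r < r'" "r' < e" using dense[OF r(2)] by auto
    have sub: "sphere c r \<subseteq> ball c R" "cball c r \<subseteq> ball c R" "cball c r' \<subseteq> ball c R" "ball c r' \<subseteq> ball c R"
      using r r' eR by auto
    have contf: "continuous_on (sphere c r) f"
      using holomorphic_on_imp_continuous_on[OF f] sub(1) continuous_on_subset by blast
    have "compact (f ` sphere c r)" "f ` sphere c r \<noteq> {}" using contf r by (auto intro: compact_continuous_image)
    moreover have "0 \<notin> f ` sphere c r" using e(3) r by (force simp: dist_commute)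
    ultimately obtain m where m: "m > 0" "\<And>z. z \<in> sphere c r \<Longrightarrow> m \<le> norm (f z)"
      using separate_point_closed[of "f ` sphere c r" 0] compact_imp_closed by (force simp: dist_norm)
    have "\<forall>\<^sub>F n in sequentially. \<forall>z\<in>cball c r. dist (F n z) (f z) < m"
      using lim[of r] r eR m(1) by (auto simp: uniform_limit_iff)
    then show "\<forall>\<^sub>F n in sequentially. finite {z\<in>ball c r. F n z = 0} \<and> (\<Sum>z\<in>{z\<in>ball c r. F n z = 0}. zorder (F n) z) = zorder f c"
    proof eventually_elim
      case (elim n)
      have less: "norm (F n z - f z) < norm (f z)" if "z \<in> sphere c r" for z
      proof -
        have "z \<in> cball c r" using that by simp
        then show ?thesis using elim m(2)[OF that] by (auto simp: dist_norm intro: less_le_trans)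
      qed
      have nzs: "F n z \<noteq> 0" if "z \<in> sphere c r" for z using less[OF that] by auto
      define s where "s = ball c r'"
      have finF: "finite {z\<in>cball c r'. F n z = 0}"
      proof (cases "F n constant_on ball c R")
        \<comment> \<open>A constant \<open>F n\<close> is nonzero, since it does not vanish on the
          circle.\<close>
        case True
        then obtain k where k: "\<And>z. z \<in> ball c R \<Longrightarrow> F n z = k" by (auto simp: constant_on_def)
        have "c + of_real r \<in> sphere c r" using r by (simp add: dist_norm)
        then have "k \<noteq> 0" using nzs k sub(1) by blast
        then have "{z\<in>cball c r'. F n z = 0} = {}" using k sub(3) by blast
        then show ?thesis by (metis finite.emptyI)
      next
        case False
        then show ?thesis using F[of n] sub(3) by (intro holomorphic_compact_finite_zeros[of _ "ball c R"]) auto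
      qed
      have zf: "{p\<in>s. f p = 0} = {c}" using e(3) fc r r' by (force simp: s_def)
      have zF: "finite {p\<in>s. F n p = 0}" by (rule finite_subset[OF _ finF]) (auto simp: s_def)
      have h: "(\<Sum>p\<in>{p\<in>s. f p + (F n p - f p) = 0}. winding_number (circlepath c r) p * zorder (\<lambda>p. f p + (F n p - f p)) p)
          = (\<Sum>p\<in>{p\<in>s. f p = 0}. winding_number (circlepath c r) p * zorder f p)"
      proof (rule Rouche_theorem)
        show "finite {p \<in> s. f p + (F n p - f p) = 0}" using zF by simp
        show "f holomorphic_on s" "(\<lambda>p. F n p - f p) holomorphic_on s"
          using f F[of n] sub(4) unfolding s_def by (auto intro!: holomorphic_intros intro: holomorphic_on_subset)
        show "path_image (circlepath c r) \<subseteq> s" using r r' by (auto simp: s_def)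
        show "\<forall>z\<in>path_image (circlepath c r). cmod (F n z - f z) < cmod (f z)" using less r by auto
        show "\<forall>z. z \<notin> s \<longrightarrow> winding_number (circlepath c r) z = 0"
        proof (intro allI impI)
          fix z assume "z \<notin> s"
          then show "winding_number (circlepath c r) z = 0"
            by (intro winding_number_zero_outside[of _ "cball c r"]) (use r r' in \<open>auto simp: s_def\<close>)
        qed
      qed (use zf in \<open>auto simp: s_def\<close>)
      have "(\<Sum>p\<in>{p\<in>s. F n p = 0}. winding_number (circlepath c r) p * zorder (F n) p) = zorder f c"
        using h r unfolding zf by (simp add: winding_number_circlepath_centre)
      moreover have "(\<Sum>p\<in>{p\<in>s. F n p = 0}. winding_number (circlepath c r) p * zorder (F n) p) =
          (\<Sum>p\<in>{p\<in>ball c r. F n p = 0}. of_int (zorder (F n) p))"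
      proof (rule sum.mono_neutral_cong_right[OF zF])
        show "{p \<in> ball c r. F n p = 0} \<subseteq> {p \<in> s. F n p = 0}" using r r' by (auto simp: s_def)
        show "\<forall>p\<in>{p \<in> s. F n p = 0} - {p \<in> ball c r. F n p = 0}. winding_number (circlepath c r) p * of_int (zorder (F n) p) = 0"
        proof
          fix p assume p: "p \<in> {p \<in> s. F n p = 0} - {p \<in> ball c r. F n p = 0}"
          then have "p \<notin> cball c r" using nzs[of p] by auto
          then have "winding_number (circlepath c r) p = 0"
            by (intro winding_number_zero_outside[of _ "cball c r"]) (use r in auto)
          then show "winding_number (circlepath c r) p * of_int (zorder (F n) p) = 0" by simp
        qed
        show "winding_number (circlepath c r) p * of_int (zorder (F n) p) = of_int (zorder (F n) p)"
          if "p \<in> {p \<in> ball c r. F n p = 0}" for p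
          using that by (simp add: winding_number_circlepath dist_norm norm_minus_commute)
      qed
      ultimately have "(\<Sum>p\<in>{p\<in>ball c r. F n p = 0}. of_int (zorder (F n) p)) = (of_int (zorder f c) :: complex)" by simp
      then have "(\<Sum>p\<in>{p\<in>ball c r. F n p = 0}. zorder (F n) p) = zorder f c"
        unfolding of_int_sum[symmetric] of_int_eq_iff .
      moreover have "finite {p\<in>ball c r. F n p = 0}" by (rule finite_subset[OF _ finF]) (use r r' in auto)
      ultimately show ?case by simp
    qed
  qed
qed

lemma zorder_poly_mult:
  assumes p: "p \<noteq> 0" and h: "h holomorphic_on ball z e" "e > 0" "h z \<noteq> 0"
  shows "zorder (\<lambda>w. poly p w * h w) z = int (order z p)"
proof -
  obtain q where q: "p = [:- z, 1:] ^ order z p * q" "\<not> [:- z, 1:] dvd q" using order_decomp[OF p] by blast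
  have qz: "poly q z \<noteq> 0" using q(2) by (simp add: poly_eq_0_iff_dvd)
  show ?thesis
  proof (rule zorder_eqI[of "ball z e" z "\<lambda>w. poly q w * h w"])
    show "(\<lambda>w. poly q w * h w) holomorphic_on ball z e" using h by (intro holomorphic_intros)
    show "poly p w * h w = poly q w * h w * (w - z) powi int (order z p)" for w
      by (subst q(1)) (simp add: power_int_def)
  qed (use h qz in auto)
qed

text \<open>Near each point of \<open>C\<close> the factors \<open>h n\<close> have no zeros, in a
  disc independent of \<open>n\<close>, so the zeros of the approximants there are roots of the
  polynomials \<open>T n\<close> with the same orders. Disjoint discs then turn a bound on the roots
  into a bound on the sum of multiplicities.\<close>

lemma multiplicities_le_limit:
  fixes T :: "nat \<Rightarrow> real poly" and h :: "nat \<Rightarrow> complex \<Rightarrow> complex"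
  assumes G: "G holomorphic_on ball 0 1" "z0 \<in> ball 0 1" "G z0 \<noteq> 0"
    and h: "\<And>n. h n holomorphic_on ball 0 1"
    and h0: "\<And>x. x \<in> {-1<..<1} \<Longrightarrow> \<exists>e>0. \<forall>n. \<forall>z\<in>ball (of_real x) e. h n z \<noteq> 0"
    and lim: "\<And>r. 0 < r \<Longrightarrow> r < 1 \<Longrightarrow> uniform_limit (cball 0 r) (\<lambda>n z. cpoly (T n) z * h n z) G sequentially"
    and M: "\<And>n Z. T n \<noteq> 0 \<Longrightarrow> finite Z \<Longrightarrow> (\<And>z. z \<in> Z \<Longrightarrow> cmod z < 1) \<Longrightarrow>
        (\<Sum>z\<in>Z. order z (map_poly complex_of_real (T n))) \<le> M"
    and C: "finite C" "C \<subseteq> {-1<..<1::real}"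
    and a: "\<And>c k. c \<in> C \<Longrightarrow> k < a c \<Longrightarrow> (deriv ^^ k) G (of_real c) = 0"
  shows "(\<Sum>c\<in>C. a c) \<le> M"
proof -
  define D where "D = {c\<in>C. a c > 0}"
  have finD: "finite D" using C by (simp add: D_def)
  let ?F = "\<lambda>n z. cpoly (T n) z * h n z"
  have holF: "?F n holomorphic_on ball 0 1" for n by (intro holomorphic_intros h)
  have zo: "zorder G (of_real c) \<ge> int (a c)" if "c \<in> D" for c
  proof -
    have c: "c \<in> C" "of_real c \<in> ball (0::complex) 1" using that subsetD[OF C(2), of c] by (auto simp: D_def)
    have "G analytic_on {of_real c}" using c(2) G(1) by (intro holomorphic_on_imp_analytic_at[of _ "ball 0 1"]) auto
    then show ?thesis using zorder_geI[OF _ G(1) open_ball connected_ball c(2) G(2,3), of "a c"] a[OF c(1)] by auto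
  qed
  define good where "good c r \<longleftrightarrow> ball (complex_of_real c) r \<subseteq> ball 0 1 \<and>
      (\<forall>\<^sub>F n in sequentially. T n \<noteq> 0 \<longrightarrow> (\<exists>Z. finite Z \<and> Z \<subseteq> ball (of_real c) r \<and>
         a c \<le> (\<Sum>z\<in>Z. order z (map_poly complex_of_real (T n)))))" for c r
  have ex: "\<exists>e>0. \<forall>r. 0 < r \<longrightarrow> r < e \<longrightarrow> good c r"
    if c: "c \<in> D" for c
  proof -
    have cb: "c \<in> {-1<..<1}" "a c > 0" "c \<in> C" using c C by (auto simp: D_def)
    obtain d where d: "d > 0" "\<And>n z. z \<in> ball (of_real c) d \<Longrightarrow> h n z \<noteq> 0" using h0[OF cb(1)] by blast
    have Gc: "G (of_real c) = 0" using a[OF cb(3), of 0] cb(2) by simp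
    define R where "R = 1 - \<bar>c\<bar>"
    have R: "R > 0" using cb by (auto simp: R_def)
    have sub: "ball (of_real c) r \<subseteq> ball (0::complex) 1" if "r \<le> R" for r
      using that norm_triangle_ineq4 by (auto simp: R_def dist_norm) (smt (verit) norm_minus_commute norm_of_real norm_triangle_ineq2)
    have "\<exists>z\<in>ball (of_real c) R. G z \<noteq> 0"
    proof (rule ccontr)
      assume "\<not> ?thesis"
      then have "G z0 = 0"
        using analytic_continuation_open[of "ball (of_real c) R" "ball 0 1" G "\<lambda>_. 0" z0] G R sub[of R] by auto
      then show False using G by simp
    qed
    then obtain z1 where z1: "z1 \<in> ball (of_real c) R" "G z1 \<noteq> 0" by blast
    obtain e where e: "e > 0" "\<And>r. 0 < r \<Longrightarrow> r < e \<Longrightarrow> \<forall>\<^sub>F n in sequentially. finite {z\<in>ball (of_real c) r. ?F n z = 0} \<and>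
        (\<Sum>z\<in>{z\<in>ball (of_real c) r. ?F n z = 0}. zorder (?F n) z) = zorder G (of_real c)"
    proof (rule hurwitz_multiplicity[of G "of_real c" R ?F z1])
      show "G holomorphic_on ball (of_real c) R" using G(1) sub[of R] holomorphic_on_subset by blast
      show "?F n holomorphic_on ball (of_real c) R" for n using holF[of n] sub[of R] holomorphic_on_subset by blast
      show "uniform_limit (cball (of_real c) r) ?F G sequentially" if r: "0 < r" "r < R" for r
      proof (rule uniform_limit_on_subset[OF lim[of "r + \<bar>c\<bar>"]])
        show "cball (complex_of_real c) r \<subseteq> cball 0 (r + \<bar>c\<bar>)"
        proof
          fix z assume "z \<in> cball (complex_of_real c) r"
          then show "z \<in> cball 0 (r + \<bar>c\<bar>)" using dist_triangle[of 0 z "of_real c"] by simp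
        qed
      qed (use r in \<open>auto simp: R_def\<close>)
    qed (use R z1 Gc in auto)
    show ?thesis unfolding good_def
    proof (intro exI[of _ "min e (min d R)"] conjI allI impI)
      show "min e (min d R) > 0" using e d R by auto
      fix r assume r: "0 < r" "r < min e (min d R)"
      have re: "r < e" using r by simp
      show "ball (of_real c) r \<subseteq> ball (0::complex) 1" using sub r by simp
      show "\<forall>\<^sub>F n in sequentially. T n \<noteq> 0 \<longrightarrow> (\<exists>Z. finite Z \<and> Z \<subseteq> ball (of_real c) r \<and>
         a c \<le> (\<Sum>z\<in>Z. order z (map_poly complex_of_real (T n))))"
        using e(2)[OF r(1) re]
      proof (eventually_elim, intro impI)
        fix n assume n: "T n \<noteq> 0" and f: "finite {z\<in>ball (of_real c) r. ?F n z = 0} \<and>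
          (\<Sum>z\<in>{z\<in>ball (of_real c) r. ?F n z = 0}. zorder (?F n) z) = zorder G (of_real c)"
        define Z where "Z = {z\<in>ball (complex_of_real c) r. ?F n z = 0}"
        have "zorder (?F n) z = int (order z (map_poly complex_of_real (T n)))" if "z \<in> Z" for z
        proof -
          have zb: "z \<in> ball (of_real c) r" using that by (simp add: Z_def)
          then have "z \<in> ball 0 1" using sub[of r] r by auto
          then obtain \<epsilon> where \<epsilon>: "\<epsilon> > 0" "ball z \<epsilon> \<subseteq> ball 0 1" using open_contains_ball[of "ball 0 1"] open_ball by blast
          show ?thesis
            by (rule zorder_poly_mult[OF _ holomorphic_on_subset[OF h \<epsilon>(2)] \<epsilon>(1) d(2)])
               (use n zb r in \<open>auto simp: map_poly_cr_0_iff\<close>)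
        qed
        then have "zorder G (of_real c) = int (\<Sum>z\<in>Z. order z (map_poly complex_of_real (T n)))"
          using f by (simp add: Z_def)
        then have "a c \<le> (\<Sum>z\<in>Z. order z (map_poly complex_of_real (T n)))" using zo[OF c] by (metis of_nat_le_iff)
        then show "\<exists>Z. finite Z \<and> Z \<subseteq> ball (of_real c) r \<and> a c \<le> (\<Sum>z\<in>Z. order z (map_poly complex_of_real (T n)))"
          using f by (intro exI[of _ Z]) (auto simp: Z_def)
      qed
    qed
  qed
  then obtain e where e: "\<And>c. c \<in> D \<Longrightarrow> e c > 0" "\<And>c r. c \<in> D \<Longrightarrow> 0 < r \<Longrightarrow> r < e c \<Longrightarrow> good c r" by metis
  obtain \<delta> where \<delta>: "\<delta> > 0" "\<And>x y. x \<in> D \<Longrightarrow> y \<in> D \<Longrightarrow> x \<noteq> y \<Longrightarrow> \<delta> \<le> \<bar>x - y\<bar>"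
  proof -
    define S where "S = insert 1 ((\<lambda>(x, y). \<bar>x - y\<bar>) ` {(x, y). x \<in> D \<and> y \<in> D \<and> x \<noteq> y})"
    have "finite {(x, y). x \<in> D \<and> y \<in> D \<and> x \<noteq> y}"
      by (rule finite_subset[of _ "D \<times> D"]) (use finD in auto)
    then have "finite S" by (simp add: S_def)
    moreover have "S \<noteq> {}" by (simp add: S_def)
    ultimately have "Min S \<in> S" "\<And>t. t \<in> S \<Longrightarrow> Min S \<le> t" by auto
    moreover have "t > 0" if "t \<in> S" for t using that by (auto simp: S_def)
    moreover have "\<bar>x - y\<bar> \<in> S" if "x \<in> D" "y \<in> D" "x \<noteq> y" for x y using that by (force simp: S_def)
    ultimately show thesis using that[of "Min S"] by blast
  qed
  \<comment> \<open>At most half the least distance, so that the discs are disjoint, and small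
    enough for Hurwitz' theorem at every point.\<close>
  define r where "r = Min (insert (\<delta> / 2) ((\<lambda>c. e c / 2) ` D))"
  have r: "r > 0" "r \<le> \<delta> / 2" "\<And>c. c \<in> D \<Longrightarrow> r < e c"
  proof -
    show "r > 0" unfolding r_def using finD e(1) \<delta> by auto
    show "r \<le> \<delta> / 2" unfolding r_def using finD by (intro Min_le) auto
    show "r < e c" if "c \<in> D" for c
    proof -
      have "r \<le> e c / 2" unfolding r_def using finD that by (intro Min_le) auto
      then show ?thesis using e(1)[OF that] by simp
    qed
  qed
  have ev: "\<forall>\<^sub>F n in sequentially. \<forall>c\<in>D. T n \<noteq> 0 \<longrightarrow> (\<exists>Z. finite Z \<and> Z \<subseteq> ball (of_real c) r \<and>
         a c \<le> (\<Sum>z\<in>Z. order z (map_poly complex_of_real (T n))))"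
    using finD e(2)[OF _ r(1) r(3)] unfolding good_def by (intro eventually_ball_finite) auto
  \<comment> \<open>The approximants converge at \<open>z0\<close> to a nonzero value, so the
    polynomials are eventually nonzero and \<open>M\<close> applies to them.\<close>
  have "\<forall>\<^sub>F n in sequentially. T n \<noteq> 0"
  proof -
    define r0 where "r0 = (norm z0 + 1) / 2"
    have "0 < r0" "r0 < 1" "z0 \<in> cball 0 r0" using G(2) by (auto simp: r0_def field_simps intro: add_pos_nonneg add_nonneg_pos)
    then have "(\<lambda>n. ?F n z0) \<longlonglongrightarrow> G z0" using tendsto_uniform_limitI[OF lim] by blast
    then have "\<forall>\<^sub>F n in sequentially. ?F n z0 \<noteq> 0" using G(3) by (rule tendsto_imp_eventually_ne)
    then show ?thesis by eventually_elim auto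
  qed
  with ev have "\<forall>\<^sub>F n in sequentially. (\<Sum>c\<in>C. a c) \<le> M"
  proof eventually_elim
    case (elim n)
    then obtain Z where Z: "\<And>c. c \<in> D \<Longrightarrow> finite (Z c) \<and> Z c \<subseteq> ball (of_real c) r \<and>
         a c \<le> (\<Sum>z\<in>Z c. order z (map_poly complex_of_real (T n)))" by metis
    have "(\<Sum>c\<in>C. a c) = (\<Sum>c\<in>D. a c)" using C by (intro sum.mono_neutral_right) (auto simp: D_def)
    also have "\<dots> \<le> (\<Sum>c\<in>D. \<Sum>z\<in>Z c. order z (map_poly complex_of_real (T n)))" using Z by (intro sum_mono) auto
    also have "\<dots> = (\<Sum>z\<in>(\<Union>c\<in>D. Z c). order z (map_poly complex_of_real (T n)))"
    proof (rule sum.UNION_disjoint[symmetric])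
      show "\<forall>i\<in>D. \<forall>j\<in>D. i \<noteq> j \<longrightarrow> Z i \<inter> Z j = {}"
      proof (intro ballI impI equals0I)
        fix i j z assume ij: "i \<in> D" "j \<in> D" "i \<noteq> j" "z \<in> Z i \<inter> Z j"
        then have "dist (of_real i) z < r" "dist (of_real j) z < r" using Z by (auto simp: subset_iff)
        then have "dist (of_real i) (of_real j :: complex) < r + r" by (metis add_strict_mono dist_commute dist_triangle_lt dist_triangle_less_add)
        then have "\<bar>i - j\<bar> < \<delta>" using r(2) by (simp add: dist_of_real dist_real_def)
        then show False using \<delta>(2)[OF ij(1-3)] by simp
      qed
    qed (use finD Z in auto)
    also have "\<dots> \<le> M"
    proof (rule M)
      show "T n \<noteq> 0" using elim by simp
      show "finite (\<Union>c\<in>D. Z c)" using finD Z by auto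
      show "cmod z < 1" if z: "z \<in> (\<Union>c\<in>D. Z c)" for z
      proof -
        obtain c where "c \<in> D" "z \<in> ball (of_real c) r" using z Z by blast
        then have "z \<in> ball 0 1" using e(2)[OF _ r(1) r(3)] unfolding good_def by blast
        then show ?thesis by simp
      qed
    qed
    finally show ?case .
  qed
  then show ?thesis by simp
qed

text \<open>\<open>P K + Q E\<close> up to a constant factor, extended to the complex unit
  disc.\<close>

definition two_term :: "real poly \<Rightarrow> real poly \<Rightarrow> complex \<Rightarrow> complex" where
  "two_term P Q z = cpoly P z * hyp_F 0 (z^2) + cpoly Q z * hyp_E (z^2)"

lemma norm_sq_less_1: "norm (z::complex) < 1 \<Longrightarrow> norm (z^2) < 1"
  by (simp add: norm_power power_less_one_iff abs_square_less_1)

lemma holomorphic_sq: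
  assumes "f holomorphic_on ball 0 1"
  shows "(\<lambda>z. f (z^2)) holomorphic_on ball (0::complex) 1"
proof -
  have "(f \<circ> (\<lambda>z. z^2)) holomorphic_on ball 0 1"
    by (rule holomorphic_on_compose_gen[OF _ assms]) (auto intro!: holomorphic_intros norm_sq_less_1)
  then show ?thesis by (simp add: o_def)
qed

lemma hyp_E_holomorphic: "hyp_E holomorphic_on ball 0 1"
  unfolding hyp_E_def by (intro holomorphic_intros hyp_F_holomorphic) simp_all

lemma two_term_holomorphic: "two_term P Q holomorphic_on ball 0 1"
  unfolding two_term_def by (intro holomorphic_intros holomorphic_sq hyp_F_holomorphic hyp_E_holomorphic)

lemma cpoly_sqX: "cpoly (pcompose p sqX) z = cpoly p (z^2)"
  by (simp add: cpoly_pcompose power2_eq_square)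

text \<open>The denominators and numerators of the Pade approximants have too low a degree to match
  a vanishing combination to the order of contact at the origin.\<close>

lemma two_term_eq_0_imp:
  assumes 0: "\<And>x. 0 < x \<Longrightarrow> x < 1 \<Longrightarrow> two_term P Q (of_real x) = 0"
  shows "P = 0 \<and> Q = 0"
proof -
  \<comment> \<open>With this \<open>j\<close> the degree of \<open>T\<close> is at most
    \<open>3 j + 2\<close>, whereas the remainder vanishes to order
    \<open>2 (N + 2) = 4 j + 6\<close> in \<open>k\<close>.\<close>
  define j where "j = max (degree P) (degree Q)"
  define N where "N = 2 * j + 1"
  have N: "2 * j + 2 = Suc N" by (simp add: N_def)
  define T where "T = P * pcompose (pade_denom (Suc N)) sqX + Q * pcompose (pade_numer (Suc N)) sqX"
  define K where "K = (\<Prod>i<Suc N. chain_k (Suc i))"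
  have K: "K > 0" unfolding K_def by (intro prod_pos) (simp add: chain_k_pos)
  have PK: "(\<Prod>i<Suc N. x * of_real (chain_k (Suc i))) = x ^ Suc N * of_real K" for x :: complex
    unfolding K_def prod.distrib by (simp only: prod_constant card_lessThan of_real_prod)
  have dT: "degree T \<le> j + 2 * Suc j"
  proof -
    have "degree (pcompose (pade_denom (Suc N)) sqX) \<le> 2 * Suc j" "degree (pcompose (pade_numer (Suc N)) sqX) \<le> 2 * Suc j"
      using degree_pade[of j] unfolding N by (simp_all add: degree_pcompose)
    then show ?thesis unfolding T_def by (intro degree_add_le degree_mult_le') (auto simp: j_def)
  qed
  have key: "cpoly T (of_real x) * hyp_F 0 (of_real (x^2)) =
      cpoly Q (of_real x) * (hyp_F (Suc (Suc N)) (of_real (x^2)) * (of_real (x^2) / 2) * (of_real (x^2) ^ Suc N * of_real K))"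
    if x: "0 < x" "x < 1" for x
  proof -
    have x2: "norm (complex_of_real (x^2)) < 1" using norm_sq_less_1[of "of_real x"] x by simp
    define z where "z = complex_of_real (x^2)"
    have t0: "cpoly P (of_real x) * hyp_F 0 z + cpoly Q (of_real x) * hyp_E z = 0"
      using 0[OF x] by (simp add: two_term_def z_def)
    have "cpoly T (of_real x) * hyp_F 0 z = cpoly (pade_denom (Suc N)) z * (cpoly P (of_real x) * hyp_F 0 z + cpoly Q (of_real x) * hyp_E z)
        + cpoly Q (of_real x) * (hyp_F 0 z * cpoly (pade_numer (Suc N)) z - hyp_E z * cpoly (pade_denom (Suc N)) z)"
      unfolding T_def by (simp add: cpoly_sqX z_def algebra_simps)
    also have "\<dots> = cpoly Q (of_real x) * (hyp_F (Suc (Suc N)) z * (z / 2) * (z ^ Suc N * of_real K))"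
      unfolding t0 pade_remainder[OF x2[folded z_def]] PK by simp
    finally show ?thesis unfolding z_def .
  qed
  have T0: "T = 0"
  proof (rule ccontr)
    assume T: "T \<noteq> 0"
    define m where "m = order 0 T"
    obtain t where t: "T = [:- 0, 1:] ^ m * t" "\<not> [:- 0, 1:] dvd t" using order_decomp[OF T, of 0] m_def by blast
    have t0: "poly t 0 \<noteq> 0" using t(2) by (metis poly_eq_0_iff_dvd)
    have "m \<le> degree T" unfolding m_def by (rule order_degree[OF T])
    then have m: "m < 2 * (N + 2)" using dT by (simp add: N_def)
    have e: "cpoly t (of_real x) * hyp_F 0 (of_real (x^2)) =
      of_real x ^ (2 * (N + 2) - m) * (cpoly Q (of_real x) * hyp_F (Suc (Suc N)) (of_real (x^2)) * (of_real K / 2))" if x: "0 < x" "x < 1" for x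
    proof -
      have "of_real x ^ m * (cpoly t (of_real x) * hyp_F 0 (of_real (x^2))) = cpoly T (of_real x) * hyp_F 0 (of_real (x^2))"
        by (subst t(1)) (simp add: cpoly_power)
      also have "\<dots> = of_real x ^ (2 * (N + 2)) * (cpoly Q (of_real x) * hyp_F (Suc (Suc N)) (of_real (x^2)) * (of_real K / 2))"
        unfolding key[OF x] unfolding of_real_power power_mult power_add by (simp add: power2_eq_square mult_ac)
      also have "of_real x ^ (2 * (N + 2)) = (of_real x ^ m * of_real x ^ (2 * (N + 2) - m) :: complex)"
        using m by (metis le_add_diff_inverse less_imp_le power_add)
      finally show ?thesis using x by (simp add: mult.assoc)
    qed
    have cont: "continuous_on (ball 0 1) (\<lambda>z. cpoly t z * hyp_F 0 (z^2))"
      "continuous_on (ball 0 1) (\<lambda>z. z ^ (2 * (N + 2) - m) * (cpoly Q z * hyp_F (Suc (Suc N)) (z^2) * (of_real K / 2)))"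
      by (intro holomorphic_on_imp_continuous_on holomorphic_intros holomorphic_sq hyp_F_holomorphic)+
    have lim0: "((\<lambda>x. complex_of_real x) \<longlongrightarrow> 0) (at_right 0)"
      using tendsto_of_real[OF tendsto_ident_at[of "0::real" "{0<..}"], where 'a = complex] by simp
    have l1: "((\<lambda>x. cpoly t (of_real x) * hyp_F 0 ((of_real x)^2)) \<longlongrightarrow> cpoly t 0 * hyp_F 0 (0^2)) (at_right 0)"
      by (rule isCont_tendsto_compose[OF continuous_on_interior[OF cont(1)] lim0]) simp
    have l2: "((\<lambda>x. of_real x ^ (2 * (N + 2) - m) * (cpoly Q (of_real x) * hyp_F (Suc (Suc N)) ((of_real x)^2) * (of_real K / 2)))
       \<longlongrightarrow> 0 ^ (2 * (N + 2) - m) * (cpoly Q 0 * hyp_F (Suc (Suc N)) (0^2) * (of_real K / 2))) (at_right 0)"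
      by (rule isCont_tendsto_compose[OF continuous_on_interior[OF cont(2)] lim0]) simp
    have ev: "\<forall>\<^sub>F x in at_right 0. cpoly t (of_real x) * hyp_F 0 ((of_real x)^2) =
        of_real x ^ (2 * (N + 2) - m) * (cpoly Q (of_real x) * hyp_F (Suc (Suc N)) ((of_real x)^2) * (of_real K / 2))"
    proof (rule eventually_mono[OF eventually_at_right_real[of 0 1]])
      fix x :: real assume "x \<in> {0<..<1}"
      then show "cpoly t (of_real x) * hyp_F 0 ((of_real x)^2) =
          of_real x ^ (2 * (N + 2) - m) * (cpoly Q (of_real x) * hyp_F (Suc (Suc N)) ((of_real x)^2) * (of_real K / 2))"
        using e[of x] by (simp only: of_real_power greaterThanLessThan_iff)
    qed simp
    have "cpoly t 0 * hyp_F 0 (0^2) = 0 ^ (2 * (N + 2) - m) * (cpoly Q 0 * hyp_F (Suc (Suc N)) (0^2) * (of_real K / 2))"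
      by (rule tendsto_unique[OF _ l1 Lim_transform_eventually[OF l2]]) (use ev in \<open>auto elim: eventually_mono\<close>)
    moreover have "(0::complex) ^ (2 * (N + 2) - m) = 0" using m by (intro zero_power) simp
    ultimately have "cpoly t 0 * hyp_F 0 0 = 0" by (metis mult_zero_left zero_power2)
    moreover have "hyp_F 0 0 = 1" by (simp add: hyp_F_def powser_zero)
    ultimately show False using t0 poly_cr[of t 0] by simp
  qed
  have "poly Q x = 0" if x: "0 < x" "x < 1" for x
  proof -
    have x2: "0 \<le> x^2" "x^2 < 1" using x by (auto simp: power_less_one_iff abs_square_less_1)
    have "hyp_F (Suc (Suc N)) (of_real (x^2)) \<noteq> 0" using real_hyp_F_pos[OF x2, of "Suc (Suc N)"] by (subst hyp_F_real[OF x2]) auto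
    then have "cpoly Q (of_real x) = 0" using key[OF x] x K unfolding T0 by auto
    then show ?thesis by (simp add: poly_cr)
  qed
  then have inf: "{0<..<1} \<subseteq> {x. poly Q x = 0}" by auto
  have Q: "Q = 0"
  proof (rule ccontr)
    assume "Q \<noteq> 0"
    then show False using poly_roots_finite[of Q] finite_subset[OF inf] infinite_Ioo[of "0::real" 1] by auto
  qed
  have "pcompose (pade_denom (Suc N)) sqX \<noteq> 0"
  proof
    assume "pcompose (pade_denom (Suc N)) sqX = 0"
    then have "poly (pcompose (pade_denom (Suc N)) sqX) 0 = 0" by simp
    then show False by (simp add: pade_denom_def del: sturm.simps)
  qed
  then show ?thesis using T0 Q by (simp add: T_def)
qed

lemma pade_denom_nonzero:
  assumes "norm z < 1"
  shows "cpoly (pade_denom (2 * j + 2)) z \<noteq> 0"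
proof -
  have "0 < poly (pade_denom (2 * j + 2)) (norm z)" using assms by (intro pade_denom_pos) auto
  also have "\<dots> \<le> norm (cpoly (pade_denom (2 * j + 2)) z)" by (rule norm_pade_denom_ge) (use assms in auto)
  finally show ?thesis by auto
qed

lemma ex_small_avoiding:
  assumes "finite (B :: real set)"
  shows "\<exists>\<epsilon>. 0 < \<epsilon> \<and> \<epsilon> < 1 / real (Suc j) \<and> \<epsilon> \<notin> B"
proof -
  have "infinite ({0<..<1 / real (Suc j)} - B)" using assms infinite_Ioo[of 0 "1 / real (Suc j)"] by simp
  then obtain \<epsilon> where "\<epsilon> \<in> {0<..<1 / real (Suc j)} - B" using infinite_imp_nonempty by blast
  then show ?thesis by auto
qed

text \<open>A small constant added to \<open>V\<close> moves its roots away from the finitely many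
  points at which the sign argument needs \<open>V\<close> to be nonzero. With
  \<open>deg V \<le> deg U\<close> the maximum in the root count is \<open>deg U\<close>.\<close>

lemma two_term_approx_roots:
  fixes U V B C :: "real poly"
  assumes "degree B \<le> Suc j" "degree C \<le> Suc j" "strict_mono_on {..<Suc j} x"
    "\<And>i. i < Suc j \<Longrightarrow> x i > 1" "\<And>i. i < Suc j \<Longrightarrow> poly B (x i) = 0"
    "\<And>i. i < Suc j \<Longrightarrow> (-1) ^ i * poly C (x i) * s > 0"
    and le: "degree V \<le> degree U"
  shows "\<exists>\<epsilon>. 0 < \<epsilon> \<and> \<epsilon> < 1 / real (Suc j) \<and>
    (U * pcompose B sqX + (V + [:\<epsilon>:]) * pcompose C sqX \<noteq> 0 \<longrightarrow>
     (\<forall>Z. finite Z \<longrightarrow> (\<forall>z\<in>Z. cmod z < 1) \<longrightarrow>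
       (\<Sum>z\<in>Z. order z (map_poly complex_of_real (U * pcompose B sqX + (V + [:\<epsilon>:]) * pcompose C sqX)))
         \<le> degree U + degree V + 2))"
proof -
  \<comment> \<open>The entry \<open>- poly V 0\<close> prevents \<open>V + [:\<epsilon>:]\<close>
    from being the zero polynomial.\<close>
  define bad where "bad = insert (- poly V 0) ((\<lambda>i. - poly V (sqrt (x i))) ` {..<Suc j} \<union> (\<lambda>i. - poly V (- sqrt (x i))) ` {..<Suc j})"
  have "finite bad" by (simp add: bad_def)
  from ex_small_avoiding[OF this, of j] obtain \<epsilon> where \<epsilon>: "0 < \<epsilon>" "\<epsilon> < 1 / real (Suc j)" "\<epsilon> \<notin> bad" by auto
  have V0: "V + [:\<epsilon>:] \<noteq> 0"
  proof
    assume "V + [:\<epsilon>:] = 0"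
    then have "poly (V + [:\<epsilon>:]) 0 = 0" by simp
    then show False using \<epsilon>(3) by (simp add: bad_def)
  qed
  have dV: "degree (V + [:\<epsilon>:]) \<le> degree V" by (intro degree_add_le) auto
  have "(\<Sum>z\<in>Z. order z (map_poly complex_of_real (U * pcompose B sqX + (V + [:\<epsilon>:]) * pcompose C sqX)))
         \<le> degree U + degree V + 2"
    if "U * pcompose B sqX + (V + [:\<epsilon>:]) * pcompose C sqX \<noteq> 0" "finite Z" "\<forall>z\<in>Z. cmod z < 1" for Z
  proof -
    have "(\<Sum>z\<in>Z. order z (map_poly complex_of_real (U * pcompose B sqX + (V + [:\<epsilon>:]) * pcompose C sqX)))
       \<le> max (degree U) (degree (V + [:\<epsilon>:])) + degree (V + [:\<epsilon>:]) + 2"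
    proof (rule roots_off_cuts[OF assms(1-6) _ V0 that(1,2)])
      fix i assume "i < Suc j"
      then have "\<epsilon> \<noteq> - poly V (sqrt (x i))" "\<epsilon> \<noteq> - poly V (- sqrt (x i))" using \<epsilon>(3) by (auto simp: bad_def)
      then show "poly (V + [:\<epsilon>:]) (sqrt (x i)) \<noteq> 0 \<and> poly (V + [:\<epsilon>:]) (- sqrt (x i)) \<noteq> 0" by auto
    qed (use that in auto)
    also have "\<dots> \<le> degree U + degree V + 2" using dV le by auto
    finally show ?thesis .
  qed
  then show ?thesis using \<epsilon> by blast
qed

text \<open>The coefficient that is squared in the sign argument must be the one of smaller degree:
  this is \<open>Q\<close> at the zeros of the denominators, or \<open>P\<close> at the zeros of the
  numerators. Only that one is perturbed.\<close>

lemma two_term_approx: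
  "\<exists>\<alpha> \<epsilon>. \<alpha> \<longlonglongrightarrow> 0 \<and> \<epsilon> \<longlonglongrightarrow> 0 \<and> (\<forall>j.
     (P + [:\<alpha> j:]) * pcompose (pade_denom (2 * j + 2)) sqX + (Q + [:\<epsilon> j:]) * pcompose (pade_numer (2 * j + 2)) sqX \<noteq> 0 \<longrightarrow>
     (\<forall>Z. finite Z \<longrightarrow> (\<forall>z\<in>Z. cmod z < 1) \<longrightarrow>
       (\<Sum>z\<in>Z. order z (map_poly complex_of_real
          ((P + [:\<alpha> j:]) * pcompose (pade_denom (2 * j + 2)) sqX + (Q + [:\<epsilon> j:]) * pcompose (pade_numer (2 * j + 2)) sqX)))
         \<le> degree P + degree Q + 2))"
proof -
  have lim: "\<epsilon> \<longlonglongrightarrow> 0" if "\<And>j. 0 < \<epsilon> j \<and> \<epsilon> j < 1 / real (Suc j)" for \<epsilon> :: "nat \<Rightarrow> real"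
    by (rule tendsto_sandwich[OF _ _ tendsto_const LIMSEQ_inverse_real_of_nat])
       (use that in \<open>auto intro!: always_eventually simp: inverse_eq_divide less_imp_le\<close>)
  show ?thesis
  proof (cases "degree Q \<le> degree P")
    case True
    have "\<exists>\<epsilon>. 0 < \<epsilon> \<and> \<epsilon> < 1 / real (Suc j) \<and>
      (P * pcompose (pade_denom (2 * j + 2)) sqX + (Q + [:\<epsilon>:]) * pcompose (pade_numer (2 * j + 2)) sqX \<noteq> 0 \<longrightarrow>
       (\<forall>Z. finite Z \<longrightarrow> (\<forall>z\<in>Z. cmod z < 1) \<longrightarrow>
       (\<Sum>z\<in>Z. order z (map_poly complex_of_real (P * pcompose (pade_denom (2 * j + 2)) sqX + (Q + [:\<epsilon>:]) * pcompose (pade_numer (2 * j + 2)) sqX)))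
         \<le> degree P + degree Q + 2))" for j
      by (rule pade_denom_roots[of j], rule two_term_approx_roots[OF degree_pade _ _ _ _ True])
    then obtain \<epsilon> where e: "\<And>j. 0 < \<epsilon> j \<and> \<epsilon> j < 1 / real (Suc j)" "\<And>j. P * pcompose (pade_denom (2 * j + 2)) sqX + (Q + [:\<epsilon> j:]) * pcompose (pade_numer (2 * j + 2)) sqX \<noteq> 0 \<longrightarrow>
       (\<forall>Z. finite Z \<longrightarrow> (\<forall>z\<in>Z. cmod z < 1) \<longrightarrow>
       (\<Sum>z\<in>Z. order z (map_poly complex_of_real (P * pcompose (pade_denom (2 * j + 2)) sqX + (Q + [:\<epsilon> j:]) * pcompose (pade_numer (2 * j + 2)) sqX)))
         \<le> degree P + degree Q + 2)" by metis
    show ?thesis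
      by (rule exI[of _ "\<lambda>_. 0"], rule exI[of _ \<epsilon>]) (use e(2) lim[OF e(1)] in simp)
  next
    case False
    then have le: "degree P \<le> degree Q" by simp
    have "\<exists>\<epsilon>. 0 < \<epsilon> \<and> \<epsilon> < 1 / real (Suc j) \<and>
      (Q * pcompose (pade_numer (2 * j + 2)) sqX + (P + [:\<epsilon>:]) * pcompose (pade_denom (2 * j + 2)) sqX \<noteq> 0 \<longrightarrow>
       (\<forall>Z. finite Z \<longrightarrow> (\<forall>z\<in>Z. cmod z < 1) \<longrightarrow>
       (\<Sum>z\<in>Z. order z (map_poly complex_of_real (Q * pcompose (pade_numer (2 * j + 2)) sqX + (P + [:\<epsilon>:]) * pcompose (pade_denom (2 * j + 2)) sqX)))
         \<le> degree Q + degree P + 2))" for j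
      by (rule pade_numer_roots[of j], rule two_term_approx_roots[OF degree_pade(2,1) _ _ _ _ le])
    then obtain \<epsilon> where e: "\<And>j. 0 < \<epsilon> j \<and> \<epsilon> j < 1 / real (Suc j)" "\<And>j. Q * pcompose (pade_numer (2 * j + 2)) sqX + (P + [:\<epsilon> j:]) * pcompose (pade_denom (2 * j + 2)) sqX \<noteq> 0 \<longrightarrow>
       (\<forall>Z. finite Z \<longrightarrow> (\<forall>z\<in>Z. cmod z < 1) \<longrightarrow>
       (\<Sum>z\<in>Z. order z (map_poly complex_of_real (Q * pcompose (pade_numer (2 * j + 2)) sqX + (P + [:\<epsilon> j:]) * pcompose (pade_denom (2 * j + 2)) sqX)))
         \<le> degree Q + degree P + 2)" by metis
    show ?thesis
      by (rule exI[of _ \<epsilon>], rule exI[of _ "\<lambda>_. 0"]) (use e(2) lim[OF e(1)] in \<open>simp add: add.commute\<close>)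
  qed
qed

text \<open>The approximants are \<open>S j * h j\<close>, a polynomial times
  \<open>F\<^sub>0 / B\<^sub>j\<close> at \<open>k\<^sup>2\<close>. The second factor has no zeros
  near the real diameter, because \<open>F\<^sub>0 \<ge> 1\<close> on \<open>[0, 1)\<close>, and the
  polynomial is covered by the root count.\<close>

theorem two_term_multiplicities:
  assumes nz: "P \<noteq> 0 \<or> Q \<noteq> 0" and C: "finite C" "C \<subseteq> {-1<..<1::real}"
    and a: "\<And>c k. c \<in> C \<Longrightarrow> k < a c \<Longrightarrow> (deriv ^^ k) (two_term P Q) (of_real c) = 0"
  shows "(\<Sum>c\<in>C. a c) \<le> degree P + degree Q + 2"
proof -
  obtain \<alpha> \<epsilon> where lim: "\<alpha> \<longlonglongrightarrow> 0" "\<epsilon> \<longlonglongrightarrow> 0" and T: "\<And>j Z.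
     (P + [:\<alpha> j:]) * pcompose (pade_denom (2 * j + 2)) sqX + (Q + [:\<epsilon> j:]) * pcompose (pade_numer (2 * j + 2)) sqX \<noteq> 0 \<Longrightarrow>
     finite Z \<Longrightarrow> (\<forall>z\<in>Z. cmod z < 1) \<Longrightarrow>
       (\<Sum>z\<in>Z. order z (map_poly complex_of_real
          ((P + [:\<alpha> j:]) * pcompose (pade_denom (2 * j + 2)) sqX + (Q + [:\<epsilon> j:]) * pcompose (pade_numer (2 * j + 2)) sqX)))
         \<le> degree P + degree Q + 2"
    using two_term_approx[of P Q] by metis
  define S where "S j = (P + [:\<alpha> j:]) * pcompose (pade_denom (2 * j + 2)) sqX + (Q + [:\<epsilon> j:]) * pcompose (pade_numer (2 * j + 2)) sqX" for j
  obtain x0 where x0: "0 < x0" "x0 < 1" "two_term P Q (of_real x0) \<noteq> 0" using two_term_eq_0_imp nz by blast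
  define h where "h j z = hyp_F 0 (z^2) / cpoly (pade_denom (2 * j + 2)) (z^2)" for j z
  show ?thesis
  proof (rule multiplicities_le_limit[of "two_term P Q" "of_real x0" h S])
    show "two_term P Q holomorphic_on ball 0 1" by (rule two_term_holomorphic)
    show "complex_of_real x0 \<in> ball 0 1" using x0 by simp
    show "h j holomorphic_on ball 0 1" for j
      unfolding h_def
    proof (intro holomorphic_on_divide holomorphic_sq hyp_F_holomorphic)
      show "cpoly (pade_denom (2 * j + 2)) holomorphic_on ball 0 1" by (intro holomorphic_intros)
      show "cpoly (pade_denom (2 * j + 2)) (z^2) \<noteq> 0" if "z \<in> ball 0 1" for z
        using that by (intro pade_denom_nonzero norm_sq_less_1) simp
    qed
    show "\<exists>e>0. \<forall>n. \<forall>z\<in>ball (of_real x) e. h n z \<noteq> 0" if x: "x \<in> {-1<..<1}" for x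
    proof -
      have xb: "complex_of_real x \<in> ball 0 1" using x by auto
      have x2: "0 \<le> x^2" "x^2 < 1" using x by (auto simp: abs_square_less_1)
      have "hyp_F 0 ((of_real x)^2) \<noteq> 0" using real_hyp_F_pos[OF x2, of 0] hyp_F_real[OF x2, of 0] by auto
      moreover have "continuous (at (complex_of_real x)) (\<lambda>z. hyp_F 0 (z^2))"
        using holomorphic_on_imp_continuous_on[OF holomorphic_sq[OF hyp_F_holomorphic[of 0]]] xb
        by (simp add: continuous_on_eq_continuous_at)
      ultimately have "\<forall>\<^sub>F z in nhds (complex_of_real x). hyp_F 0 (z^2) \<noteq> 0"
        unfolding eventually_nhds_conv_at isCont_def using tendsto_imp_eventually_ne by auto
      moreover have "\<forall>\<^sub>F z in nhds (complex_of_real x). z \<in> ball 0 1" using xb by (intro eventually_nhds_in_open) auto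
      ultimately have "\<forall>\<^sub>F z in nhds (complex_of_real x). hyp_F 0 (z^2) \<noteq> 0 \<and> z \<in> ball 0 1" by (rule eventually_conj)
      then obtain e where "e > 0" "\<And>z. dist z (of_real x) < e \<Longrightarrow> hyp_F 0 (z^2) \<noteq> 0 \<and> z \<in> ball 0 1"
        unfolding eventually_nhds_metric by blast
      then show ?thesis
        using pade_denom_nonzero[OF norm_sq_less_1]
        by (intro exI[of _ e] conjI allI ballI) (auto simp: h_def dist_commute simp del: One_nat_def add_2_eq_Suc')
    qed
    show "uniform_limit (cball 0 r) (\<lambda>j z. cpoly (S j) z * h j z) (two_term P Q) sequentially" if r: "0 < r" "r < 1" for r
    proof -
      have bdd: "bounded (g ` cball 0 r)" if "g holomorphic_on ball 0 1" for g :: "complex \<Rightarrow> complex"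
        using that r by (intro compact_imp_bounded compact_continuous_image)
          (auto intro!: holomorphic_on_imp_continuous_on intro: holomorphic_on_subset)
      have sq: "norm (z^2) \<le> r" if "norm z \<le> r" for z :: complex
        using mult_mono[of "norm z" r "norm z" 1] that r by (simp add: norm_power power2_eq_square norm_mult)
      have W: "uniform_limit (cball 0 r) (\<lambda>j z. hyp_F 0 (z^2) * cpoly (pade_numer (2 * j + 2)) (z^2) / cpoly (pade_denom (2 * j + 2)) (z^2))
          (\<lambda>z. hyp_E (z^2)) sequentially"
        by (rule uniform_limit_compose'[OF pade_uniform_limit[of "r"]])
           (use r sq in auto)
      have pe: "uniform_limit (cball 0 r) (\<lambda>j z. cpoly (R + [:\<delta> j:]) z) (cpoly R) sequentially" if "\<delta> \<longlonglongrightarrow> 0" for R and \<delta> :: "nat \<Rightarrow> real"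
      proof (rule uniform_limitI)
        fix e :: real assume "e > 0"
        then have "\<forall>\<^sub>F j in sequentially. \<bar>\<delta> j\<bar> < e"
          using order_tendstoD(2)[OF tendsto_rabs_zero[OF that]] by simp
        then show "\<forall>\<^sub>F j in sequentially. \<forall>z\<in>cball 0 r. dist (cpoly (R + [:\<delta> j:]) z) (cpoly R z) < e"
          by eventually_elim (simp add: dist_norm)
      qed
      have "uniform_limit (cball 0 r) (\<lambda>j z. cpoly (P + [:\<alpha> j:]) z * hyp_F 0 (z^2) + cpoly (Q + [:\<epsilon> j:]) z *
         (hyp_F 0 (z^2) * cpoly (pade_numer (2 * j + 2)) (z^2) / cpoly (pade_denom (2 * j + 2)) (z^2))) (two_term P Q) sequentially"
        unfolding two_term_def
        by (intro uniform_limit_add uniform_lim_mult pe lim W uniform_limit_const bdd holomorphic_sq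
             hyp_F_holomorphic hyp_E_holomorphic) (auto intro!: holomorphic_intros)
      then show ?thesis
      proof (rule uniform_limit_cong'[THEN iffD1, rotated -1])
        fix j z assume "z \<in> cball (0::complex) r"
        then have "norm z < 1" using r by simp
        then have "cpoly (pade_denom (2 * j + 2)) (z^2) \<noteq> 0" by (intro pade_denom_nonzero norm_sq_less_1)
        then show "cpoly (P + [:\<alpha> j:]) z * hyp_F 0 (z^2) + cpoly (Q + [:\<epsilon> j:]) z *
         (hyp_F 0 (z^2) * cpoly (pade_numer (2 * j + 2)) (z^2) / cpoly (pade_denom (2 * j + 2)) (z^2)) = cpoly (S j) z * h j z"
          unfolding S_def h_def by (simp add: cpoly_sqX field_simps)
      qed simp
    qed
  qed (use x0 T C a in \<open>auto simp: S_def\<close>)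
qed

section \<open>Power series of the elliptic integrals\<close>

text \<open>
  In terms of the series \<open>J_series i\<close>, written \<open>J\<^sub>i\<close> here and taken at \<open>k\<^sup>2\<close>, one has \<open>K = \<pi>/2 J\<^sub>0\<close>,
  \<open>E = \<pi>/2 (J\<^sub>0 - k\<^sup>2 J\<^sub>1)\<close> and \<open>\<Pi>(\<mu>, k) = \<pi>/2 (\<Sum>i. \<mu>\<^sup>i J\<^sub>i)\<close>.
\<close>

definition half_coeff :: "nat \<Rightarrow> real" where "half_coeff n = pochhammer (1/2) n / fact n"

lemma half_coeff_0 [simp]: "half_coeff 0 = 1" by (simp add: half_coeff_def)

lemma half_coeff_Suc: "half_coeff (Suc n) = half_coeff n * (2 * real n + 1) / (2 * real n + 2)"
  by (simp add: half_coeff_def pochhammer_Suc field_simps)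

lemma half_coeff_Suc': "half_coeff (Suc n) * (2 * real n + 2) = half_coeff n * (2 * real n + 1)"
  by (simp add: half_coeff_Suc)

lemma half_coeff_pos: "half_coeff n > 0" unfolding half_coeff_def by (intro divide_pos_pos pochhammer_pos) auto

lemma half_coeff_le_1: "half_coeff n \<le> 1"
proof (induction n)
  case (Suc n)
  have "half_coeff n * (2 * real n + 1) / (2 * real n + 2) \<le> 1 * (2 * real n + 1) / (2 * real n + 2)"
    using Suc by (intro divide_right_mono mult_right_mono) auto
  also have "\<dots> \<le> 1" by simp
  finally show ?case by (simp add: half_coeff_Suc)
qed simp

text \<open>One factor is the coefficient of \<open>x ^ j\<close> in
  \<open>1 / sqrt (1 - x)\<close>, the other the Wallis integral of
  \<open>z ^ (2 (i + j)) / sqrt (1 - z\<^sup>2)\<close> divided by \<open>\<pi> / 2\<close>.\<close>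

definition J_coeff :: "nat \<Rightarrow> nat \<Rightarrow> real" where "J_coeff i j = half_coeff j * half_coeff (i + j)"

lemma J_coeff_bounds: "0 < J_coeff i j" "J_coeff i j \<le> 1"
  using half_coeff_pos half_coeff_le_1 by (simp_all add: J_coeff_def mult_le_one less_imp_le)

text \<open>Polymorphic, since the real series expresses the integrals and the complex one their
  holomorphic extension.\<close>

definition J_series :: "nat \<Rightarrow> 'a::{real_normed_field,banach} \<Rightarrow> 'a" where
  "J_series i z = (\<Sum>j. of_real (J_coeff i j) * z ^ j)"

definition J_deriv :: "nat \<Rightarrow> 'a::{real_normed_field,banach} \<Rightarrow> 'a" where
  "J_deriv i z = (\<Sum>j. of_real (real (Suc j) * J_coeff i (Suc j)) * z ^ j)"

lemma J_series_summable:
  assumes "norm (z::'a::{real_normed_field,banach}) < 1"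
  shows "summable (\<lambda>j. norm (of_real (J_coeff i j) * z ^ j))" and "norm (J_series i z) \<le> 1 / (1 - norm z)"
proof -
  have le: "norm (of_real (J_coeff i j) * z ^ j) \<le> norm z ^ j" for j
    using J_coeff_bounds[of i j] by (simp add: norm_mult norm_power mult_left_le_one_le less_imp_le)
  have g: "summable (\<lambda>j. norm z ^ j)" using assms by (intro summable_geometric) simp
  show s: "summable (\<lambda>j. norm (of_real (J_coeff i j) * z ^ j))"
    by (rule summable_comparison_test'[OF g, of 0]) (use le in simp)
  have "norm (J_series i z) \<le> (\<Sum>j. norm (of_real (J_coeff i j) * z ^ j))" unfolding J_series_def by (rule summable_norm[OF s])
  also have "\<dots> \<le> (\<Sum>j. norm z ^ j)" by (rule suminf_le[OF le s g])
  also have "\<dots> = 1 / (1 - norm z)" using assms by (intro suminf_geometric) simp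
  finally show "norm (J_series i z) \<le> 1 / (1 - norm z)" .
qed

lemma J_series_sums: "norm (z::'a::{real_normed_field,banach}) < 1 \<Longrightarrow> (\<lambda>j. of_real (J_coeff i j) * z ^ j) sums J_series i z"
  unfolding J_series_def by (intro summable_sums summable_norm_cancel[OF J_series_summable(1)])

lemma J_deriv_summable:
  assumes "norm (z::'a::{real_normed_field,banach}) < 1"
  shows "summable (\<lambda>j. norm (of_real (real (Suc j) * J_coeff i (Suc j)) * z ^ j))"
    and "norm (J_deriv i z) \<le> 1 / (1 - norm z)^2"
proof -
  have le: "norm (of_real (real (Suc j) * J_coeff i (Suc j)) * z ^ j) \<le> real (Suc j) * norm z ^ j" for j
  proof -
    have "norm (of_real (real (Suc j) * J_coeff i (Suc j)) * z ^ j) = real (Suc j) * J_coeff i (Suc j) * norm z ^ j"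
      using J_coeff_bounds(1)[of i "Suc j"] by (simp add: norm_mult norm_power abs_mult del: of_nat_Suc)
    also have "\<dots> \<le> real (Suc j) * 1 * norm z ^ j"
      using J_coeff_bounds(2)[of i "Suc j"] by (intro mult_right_mono mult_left_mono) auto
    finally show ?thesis by simp
  qed
  have g: "(\<lambda>j. real (Suc j) * norm z ^ j) sums (1 / (1 - norm z)^2)"
    using geometric_deriv_sums[of "norm z"] assms by simp
  show s: "summable (\<lambda>j. norm (of_real (real (Suc j) * J_coeff i (Suc j)) * z ^ j))"
    by (rule summable_comparison_test'[OF sums_summable[OF g], of 0]) (use le in simp)
  have "norm (J_deriv i z) \<le> (\<Sum>j. norm (of_real (real (Suc j) * J_coeff i (Suc j)) * z ^ j))"
    unfolding J_deriv_def by (rule summable_norm[OF s])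
  also have "\<dots> \<le> (\<Sum>j. real (Suc j) * norm z ^ j)" by (rule suminf_le[OF le s sums_summable[OF g]])
  also have "\<dots> = 1 / (1 - norm z)^2" using g by (rule sums_unique[symmetric])
  finally show "norm (J_deriv i z) \<le> 1 / (1 - norm z)^2" .
qed

lemma J_deriv_sums: "norm (z::'a::{real_normed_field,banach}) < 1 \<Longrightarrow>
    (\<lambda>j. of_real (real (Suc j) * J_coeff i (Suc j)) * z ^ j) sums J_deriv i z"
  unfolding J_deriv_def by (intro summable_sums summable_norm_cancel[OF J_deriv_summable(1)])

lemma J_series_has_derivative:
  assumes "norm (z::'a::{real_normed_field,banach}) < 1"
  shows "(J_series i has_field_derivative J_deriv i z) (at z)"
proof -
  define K where "K = (of_real ((1 + norm z) / 2) :: 'a)"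
  have "norm K = (1 + norm z) / 2" unfolding K_def norm_of_real by simp
  then have K: "norm z < norm K" "norm K < 1" using assms by auto
  have "((\<lambda>x. \<Sum>n. of_real (J_coeff i n) * x ^ n) has_field_derivative (\<Sum>n. diffs (\<lambda>n. of_real (J_coeff i n)) n * z ^ n)) (at z)"
    by (rule termdiffs_strong[OF summable_norm_cancel[OF J_series_summable(1)[OF K(2)]] K(1)])
  also have "(\<lambda>x. \<Sum>n. of_real (J_coeff i n) * x ^ n) = J_series i" by (rule ext) (simp add: J_series_def)
  also have "(\<Sum>n. diffs (\<lambda>n. of_real (J_coeff i n)) n * z ^ n) = J_deriv i z"
    by (simp add: J_deriv_def diffs_def)
  finally show ?thesis .
qed

lemma times_z_sums:
  assumes "(\<lambda>j. c j * z ^ j) sums (s::'a::real_normed_field)"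
  shows "(\<lambda>j. (case j of 0 \<Rightarrow> 0 | Suc k \<Rightarrow> c k) * z ^ j) sums (z * s)"
proof -
  have "(\<lambda>j. (case Suc j of 0 \<Rightarrow> 0 | Suc k \<Rightarrow> c k) * z ^ Suc j) sums (z * s)"
    using sums_mult[OF assms, of z] by (simp add: mult_ac)
  from sums_Suc[OF this] show ?thesis by simp
qed

text \<open>Coefficientwise this is the recursion of \<open>half_coeff\<close> applied to the first
  factor of \<open>J_coeff\<close>.\<close>

lemma J_series_relation1:
  assumes z: "norm (z::'a::{real_normed_field,banach}) < 1"
  shows "2 * z * J_deriv (Suc i) z = 2 * J_deriv i z - J_series (Suc i) z"
proof -
  have "(\<lambda>j. 2 * ((case j of 0 \<Rightarrow> 0 | Suc k \<Rightarrow> of_real (real (Suc k) * J_coeff (Suc i) (Suc k))) * z ^ j)) sums (2 * (z * J_deriv (Suc i) z))"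
    by (intro sums_mult times_z_sums J_deriv_sums z)
  moreover have "(\<lambda>j. 2 * (of_real (real (Suc j) * J_coeff i (Suc j)) * z ^ j) - of_real (J_coeff (Suc i) j) * z ^ j) sums
      (2 * J_deriv i z - J_series (Suc i) z)"
    by (intro sums_diff sums_mult J_deriv_sums J_series_sums z)
  moreover have "2 * ((case j of 0 \<Rightarrow> 0 | Suc k \<Rightarrow> of_real (real (Suc k) * J_coeff (Suc i) (Suc k))) * z ^ j) =
     2 * (of_real (real (Suc j) * J_coeff i (Suc j)) * z ^ j) - of_real (J_coeff (Suc i) j) * z ^ j" for j
  proof -
    have "(case j of 0 \<Rightarrow> 0 | Suc k \<Rightarrow> of_real (real (Suc k) * J_coeff (Suc i) (Suc k))) = (of_real (real j * J_coeff (Suc i) j) :: 'a)"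
      by (cases j) auto
    moreover have "2 * (real j * J_coeff (Suc i) j) = 2 * (real (Suc j) * J_coeff i (Suc j)) - J_coeff (Suc i) j"
    proof -
      have "2 * (real (Suc j) * J_coeff i (Suc j)) = (half_coeff (Suc j) * (2 * real j + 2)) * half_coeff (Suc (i + j))"
        by (simp add: J_coeff_def algebra_simps)
      then show ?thesis unfolding half_coeff_Suc' by (simp add: J_coeff_def algebra_simps)
    qed
    then have "2 * (of_real (real j * J_coeff (Suc i) j) :: 'a) = 2 * of_real (real (Suc j) * J_coeff i (Suc j)) - of_real (J_coeff (Suc i) j)"
      by (metis of_real_diff of_real_mult of_real_numeral)
    moreover have "2 * (x * w) = 2 * (y * w) - v * w" if "2 * x = 2 * y - v" for x y v w :: 'a
      using that by (metis left_diff_distrib mult.assoc)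
    ultimately show ?thesis by metis
  qed
  ultimately have "2 * (z * J_deriv (Suc i) z) = 2 * J_deriv i z - J_series (Suc i) z" using sums_unique2 by auto
  then show ?thesis by (simp add: mult.assoc)
qed

text \<open>Legendre's formula for the derivative of \<open>K\<close>, with \<open>J\<^sub>1\<close>
  in place of \<open>E\<close>.\<close>

lemma J_series_relation2:
  assumes z: "norm (z::'a::{real_normed_field,banach}) < 1"
  shows "2 * (1 - z) * J_deriv 0 z = J_series 0 z - J_series 1 z"
proof -
  have "(\<lambda>j. 2 * (of_real (real (Suc j) * J_coeff 0 (Suc j)) * z ^ j - (case j of 0 \<Rightarrow> 0 | Suc k \<Rightarrow> of_real (real (Suc k) * J_coeff 0 (Suc k))) * z ^ j))
      sums (2 * (J_deriv 0 z - z * J_deriv 0 z))"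
    by (intro sums_diff sums_mult times_z_sums J_deriv_sums z)
  moreover have "(\<lambda>j. of_real (J_coeff 0 j) * z ^ j - of_real (J_coeff 1 j) * z ^ j) sums (J_series 0 z - J_series 1 z)"
    by (intro sums_diff J_series_sums z)
  moreover have "2 * (of_real (real (Suc j) * J_coeff 0 (Suc j)) * z ^ j - (case j of 0 \<Rightarrow> 0 | Suc k \<Rightarrow> of_real (real (Suc k) * J_coeff 0 (Suc k))) * z ^ j) =
     of_real (J_coeff 0 j) * z ^ j - of_real (J_coeff 1 j) * z ^ j" for j
  proof -
    have "(case j of 0 \<Rightarrow> 0 | Suc k \<Rightarrow> of_real (real (Suc k) * J_coeff 0 (Suc k))) = (of_real (real j * J_coeff 0 j) :: 'a)"
      by (cases j) auto
    moreover have "2 * (real (Suc j) * J_coeff 0 (Suc j) - real j * J_coeff 0 j) = J_coeff 0 j - J_coeff 1 j"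
    proof -
      have "2 * (real (Suc j) * J_coeff 0 (Suc j)) = (half_coeff (Suc j) * (2 * real j + 2)) * half_coeff (Suc j)"
        by (simp add: J_coeff_def algebra_simps)
      also have "\<dots> = half_coeff j * (half_coeff (Suc j) * (2 * real j + 2)) - half_coeff j * half_coeff (Suc j)"
        by (subst half_coeff_Suc') (simp add: algebra_simps)
      also have "\<dots> = 2 * (real j * J_coeff 0 j) + J_coeff 0 j - J_coeff 1 j"
        unfolding half_coeff_Suc' by (simp add: J_coeff_def algebra_simps)
      finally show ?thesis by simp
    qed
    then have "2 * (of_real (real (Suc j) * J_coeff 0 (Suc j)) - of_real (real j * J_coeff 0 j)) = (of_real (J_coeff 0 j) - of_real (J_coeff 1 j) :: 'a)"
      by (metis of_real_diff of_real_mult of_real_numeral)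
    moreover have "2 * (x * w - y * w) = u * w - v * w" if "2 * (x - y) = u - v" for x y u v w :: 'a
    proof -
      have "2 * (x * w - y * w) = (2 * (x - y)) * w" by (simp add: algebra_simps)
      then show ?thesis unfolding that by (simp add: algebra_simps)
    qed
    ultimately show ?thesis by simp
  qed
  ultimately have "2 * (J_deriv 0 z - z * J_deriv 0 z) = J_series 0 z - J_series 1 z" using sums_unique2 by auto
  then show ?thesis by (simp add: algebra_simps)
qed

text \<open>The recurrence between the integrals of successive even powers of \<open>z\<close>.
  Summed against powers of \<open>m\<close> it becomes the differential equation of
  \<open>\<Pi>\<close> in its first argument.\<close>

lemma J_series_relation3:
  assumes z: "norm (z::'a::{real_normed_field,banach}) < 1"
  shows "(2 * of_nat i + 3) * z * J_series (i + 2) z = (2 * of_nat i + 2) * (1 + z) * J_series (i + 1) z - (2 * of_nat i + 1) * J_series i z"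
proof -
  define c3 c2 c1 where "c3 = 2 * real i + 3" and "c2 = 2 * real i + 2" and "c1 = 2 * real i + 1"
  let ?s = "\<lambda>n j. (case j of 0 \<Rightarrow> 0 | Suc k \<Rightarrow> of_real (J_coeff n k)) :: 'a"
  have "(\<lambda>j. of_real c3 * (?s (i + 2) j * z ^ j)) sums (of_real c3 * (z * J_series (i + 2) z))"
    by (intro sums_mult times_z_sums J_series_sums z)
  moreover have "(\<lambda>j. of_real c2 * (of_real (J_coeff (i + 1) j) * z ^ j + ?s (i + 1) j * z ^ j) - of_real c1 * (of_real (J_coeff i j) * z ^ j))
     sums (of_real c2 * (J_series (i + 1) z + z * J_series (i + 1) z) - of_real c1 * J_series i z)"
    by (intro sums_diff sums_add sums_mult times_z_sums J_series_sums z)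
  moreover have "of_real c3 * (?s (i + 2) j * z ^ j) =
     of_real c2 * (of_real (J_coeff (i + 1) j) * z ^ j + ?s (i + 1) j * z ^ j) - of_real c1 * (of_real (J_coeff i j) * z ^ j)" for j
  proof -
    define t where "t n = (case j of 0 \<Rightarrow> 0 | Suc k \<Rightarrow> J_coeff n k)" for n
    have t: "?s n j = of_real (t n)" for n by (cases j) (auto simp: t_def)
    have "c3 * t (i + 2) = c2 * (J_coeff (i + 1) j + t (i + 1)) - c1 * J_coeff i j"
    proof (cases j)
      case 0
      then show ?thesis by (simp add: t_def J_coeff_def half_coeff_Suc c1_def c2_def field_simps)
    next
      case (Suc k)
      define n where "n = i + k"
      define b B where "b = half_coeff k" and "B = half_coeff (Suc n)"
      have e: "J_coeff (i + 2) k = b * (B * (2 * real (Suc n) + 1) / (2 * real (Suc n) + 2))"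
        "J_coeff (i + 1) k = b * B"
        "J_coeff (i + 1) (Suc k) = b * (2 * real k + 1) / (2 * real k + 2) * (B * (2 * real (Suc n) + 1) / (2 * real (Suc n) + 2))"
        "J_coeff i (Suc k) = b * (2 * real k + 1) / (2 * real k + 2) * B"
        using half_coeff_Suc[of "Suc n"] by (simp_all add: J_coeff_def b_def B_def n_def half_coeff_Suc[of k])
      have n: "real n = real i + real k" by (simp add: n_def)
      have "b * B * (c3 * ((2 * real (Suc n) + 1) / (2 * real (Suc n) + 2))) =
        b * B * (c2 * ((2 * real k + 1) / (2 * real k + 2) * ((2 * real (Suc n) + 1) / (2 * real (Suc n) + 2)) + 1) - c1 * ((2 * real k + 1) / (2 * real k + 2)))"
      proof -
        have p: "2 * real k + 2 > 0" "2 * (real i + real k) + 4 > 0" by auto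
        have "c3 * ((2 * real (Suc n) + 1) / (2 * real (Suc n) + 2)) =
          c2 * ((2 * real k + 1) / (2 * real k + 2) * ((2 * real (Suc n) + 1) / (2 * real (Suc n) + 2)) + 1) - c1 * ((2 * real k + 1) / (2 * real k + 2))"
          unfolding c1_def c2_def c3_def of_nat_Suc n using p
          by (simp add: divide_simps) (simp add: algebra_simps)
        then show ?thesis by simp
      qed
      then show ?thesis unfolding t_def Suc by (simp only: e nat.case) (simp add: algebra_simps)
    qed
    then have "of_real c3 * of_real (t (i + 2)) = of_real c2 * (of_real (J_coeff (i + 1) j) + of_real (t (i + 1))) - (of_real c1 * of_real (J_coeff i j) :: 'a)"
      by (metis of_real_diff of_real_mult of_real_add)
    moreover have "k3 * (x * w) = k2 * (y * w + v * w) - k1 * (u * w)" if "k3 * x = k2 * (y + v) - k1 * u"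
      for k1 k2 k3 x y u v w :: 'a
    proof -
      have "k3 * (x * w) = (k3 * x) * w" by (simp only: mult.assoc)
      then show ?thesis unfolding that by (simp add: algebra_simps)
    qed
    ultimately show ?thesis unfolding t by metis
  qed
  ultimately have e: "of_real c3 * (z * J_series (i + 2) z) = of_real c2 * (J_series (i + 1) z + z * J_series (i + 1) z) - of_real c1 * J_series i z"
    using sums_unique2 by auto
  have "of_real c3 = (2 * of_nat i + 3 :: 'a)" "of_real c2 = (2 * of_nat i + 2 :: 'a)" "of_real c1 = (2 * of_nat i + 1 :: 'a)"
    by (simp_all add: c1_def c2_def c3_def)
  with e show ?thesis by (simp add: algebra_simps)
qed

section \<open>The integral of the third kind as a series in both arguments\<close>

definition Pi_series :: "'a::{real_normed_field,banach} \<Rightarrow> 'a \<Rightarrow> 'a" where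
  "Pi_series m z = (\<Sum>i. m ^ i * J_series i z)"
definition Pi_series_dm :: "'a::{real_normed_field,banach} \<Rightarrow> 'a \<Rightarrow> 'a" where
  "Pi_series_dm m z = (\<Sum>i. of_nat (Suc i) * m ^ i * J_series (Suc i) z)"
definition Pi_series_dz :: "'a::{real_normed_field,banach} \<Rightarrow> 'a \<Rightarrow> 'a" where
  "Pi_series_dz m z = (\<Sum>i. m ^ i * J_deriv i z)"

lemma summable_bounded_times:
  assumes "norm (m::'a::{real_normed_field,banach}) < 1" "\<And>i. norm (f i) \<le> C"
  shows "summable (\<lambda>i. of_nat (Suc i) * m ^ i * f i)"
proof (rule summable_comparison_test'[of _ 0])
  show "summable (\<lambda>i. (real (Suc i) * norm m ^ i) * C)"
    using geometric_deriv_sums[of "norm m"] assms(1) by (intro summable_mult2) (auto intro: sums_summable)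
  show "norm (of_nat (Suc i) * m ^ i * f i) \<le> (real (Suc i) * norm m ^ i) * C" for i
    using assms(2)[of i] by (simp add: norm_mult norm_power mult_left_mono del: of_nat_Suc)
qed

lemma summable_bounded_times':
  assumes "norm (m::'a::{real_normed_field,banach}) < 1" "\<And>i. norm (f i) \<le> C"
  shows "summable (\<lambda>i. m ^ i * f i)"
proof (rule summable_comparison_test'[of _ 0])
  show "summable (\<lambda>i. (norm m ^ i) * C)"
    using assms(1) by (intro summable_mult2 summable_geometric) auto
  show "norm (m ^ i * f i) \<le> (norm m ^ i) * C" for i
    using assms(2)[of i] by (simp add: norm_mult norm_power mult_left_mono)
qed

context
  fixes m z :: "'a::{real_normed_field,banach}"
  assumes m: "norm m < 1" and z: "norm z < 1"
begin

lemma Pi_series_sums: "(\<lambda>i. m ^ i * J_series i z) sums Pi_series m z"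
  unfolding Pi_series_def by (rule summable_sums, rule summable_bounded_times'[OF m], rule J_series_summable(2)[OF z])
lemma Pi_series_dm_sums: "(\<lambda>i. of_nat (Suc i) * m ^ i * J_series (Suc i) z) sums Pi_series_dm m z"
  unfolding Pi_series_dm_def by (rule summable_sums, rule summable_bounded_times[OF m], rule J_series_summable(2)[OF z])
lemma Pi_series_dz_sums: "(\<lambda>i. m ^ i * J_deriv i z) sums Pi_series_dz m z"
  unfolding Pi_series_dz_def by (rule summable_sums, rule summable_bounded_times'[OF m], rule J_deriv_summable(2)[OF z])

text \<open>The tail is characterised by \<open>m * V\<close> rather than by a quotient, because
  \<open>m\<close> may be 0.\<close>

lemma Pi_series_tail:
  obtains V where "(\<lambda>i. m ^ i * J_series (Suc i) z) sums V" "m * V = Pi_series m z - J_series 0 z"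
proof -
  have "(\<lambda>i. m ^ i * J_series (Suc i) z) sums (\<Sum>i. m ^ i * J_series (Suc i) z)"
    by (rule summable_sums, rule summable_bounded_times'[OF m], rule J_series_summable(2)[OF z])
  moreover from sums_mult[OF this, of m]
  have "(\<lambda>i. m ^ Suc i * J_series (Suc i) z) sums (m * (\<Sum>i. m ^ i * J_series (Suc i) z))" by (simp add: mult_ac)
  then have "(\<lambda>i. m ^ i * J_series i z) sums (m * (\<Sum>i. m ^ i * J_series (Suc i) z) + m ^ 0 * J_series 0 z)"
    by (rule sums_Suc)
  then have "m * (\<Sum>i. m ^ i * J_series (Suc i) z) = Pi_series m z - J_series 0 z"
    using sums_unique2[OF _ Pi_series_sums] by (simp add: eq_diff_eq)
  ultimately show thesis by (rule that)
qed

text \<open>The classical derivative of \<open>\<Pi>\<close> with respect to the squared modulus,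
  obtained by summing \<open>J_series_relation1\<close> against powers of \<open>m\<close> and
  eliminating \<open>J_deriv 0\<close> by Legendre's formula.\<close>

lemma Pi_series_dz_relation: "2 * (1 - z) * (z - m) * Pi_series_dz m z = J_series 0 z - z * J_series 1 z - (1 - z) * Pi_series m z"
proof -
  obtain V where V: "(\<lambda>i. m ^ i * J_series (Suc i) z) sums V" "m * V = Pi_series m z - J_series 0 z" by (rule Pi_series_tail)
  have s: "(\<lambda>i. 2 * z * (m ^ Suc i * J_deriv (Suc i) z)) sums (2 * z * (Pi_series_dz m z - m ^ 0 * J_deriv 0 z))"
    using sums_Suc_iff[of "\<lambda>i. m ^ i * J_deriv i z" "Pi_series_dz m z - m ^ 0 * J_deriv 0 z"] Pi_series_dz_sums
    by (intro sums_mult) (simp del: power_Suc)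
  have "(\<lambda>i. m * (2 * (m ^ i * J_deriv i z) - m ^ i * J_series (Suc i) z)) sums (m * (2 * Pi_series_dz m z - V))"
    by (intro sums_mult sums_diff Pi_series_dz_sums V)
  moreover have "(\<lambda>i. m * (2 * (m ^ i * J_deriv i z) - m ^ i * J_series (Suc i) z)) = (\<lambda>i. 2 * z * (m ^ Suc i * J_deriv (Suc i) z))"
  proof
    fix i
    have "2 * z * (m ^ Suc i * J_deriv (Suc i) z) = m ^ Suc i * (2 * z * J_deriv (Suc i) z)" by (simp add: mult_ac)
    then show "m * (2 * (m ^ i * J_deriv i z) - m ^ i * J_series (Suc i) z) = 2 * z * (m ^ Suc i * J_deriv (Suc i) z)"
      unfolding J_series_relation1[OF z] by (simp add: algebra_simps)
  qed
  ultimately have "2 * z * (Pi_series_dz m z - J_deriv 0 z) = m * (2 * Pi_series_dz m z - V)" using sums_unique2[OF s] by simp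
  then have e: "2 * (z - m) * Pi_series_dz m z = 2 * z * J_deriv 0 z - (Pi_series m z - J_series 0 z)"
    unfolding V(2)[symmetric] by (simp add: algebra_simps)
  have "2 * (1 - z) * (z - m) * Pi_series_dz m z = (1 - z) * (2 * (z - m) * Pi_series_dz m z)" by (simp only: mult_ac)
  also have "\<dots> = z * (2 * (1 - z) * J_deriv 0 z) - (1 - z) * (Pi_series m z - J_series 0 z)"
    unfolding e by (simp add: algebra_simps)
  finally show ?thesis unfolding J_series_relation2[OF z] by (simp add: algebra_simps)
qed

text \<open>The classical derivative with respect to the characteristic. The weights
  \<open>2 i + 1\<close>, \<open>2 i + 2\<close> and \<open>2 i + 3\<close> of
  \<open>J_series_relation3\<close> turn into the derivative in \<open>m\<close> when the series is
  summed.\<close>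

lemma Pi_series_dm_relation:
  "2 * m * (1 - m) * (m - z) * Pi_series_dm m z = (m^2 - z) * Pi_series m z + (z - m) * J_series 0 z + m * (J_series 0 z - z * J_series 1 z)"
proof -
  obtain V where V: "(\<lambda>i. m ^ i * J_series (Suc i) z) sums V" "m * V = Pi_series m z - J_series 0 z" by (rule Pi_series_tail)
  let ?S0 = "Pi_series m z" and ?S1 = "Pi_series_dm m z"
  have u: "(\<lambda>i. 2 * (of_nat (Suc i) * m ^ i * J_series (Suc i) z) - m ^ i * J_series (Suc i) z) sums (2 * ?S1 - V)"
    by (intro sums_diff sums_mult Pi_series_dm_sums V)
  have "(\<lambda>i. 2 * (of_nat (Suc (Suc i)) * m ^ Suc i * J_series (Suc (Suc i)) z) - m ^ Suc i * J_series (Suc (Suc i)) z) sums (2 * ?S1 - V - J_series 1 z)"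
    using sums_split_initial_segment[OF u, of 1] by (simp add: algebra_simps)
  from sums_mult[OF this, of z]
  have l: "(\<lambda>i. m * (m ^ i * ((2 * of_nat i + 3) * z * J_series (i + 2) z))) sums (z * (2 * ?S1 - V - J_series 1 z))"
    by (rule back_subst[of "\<lambda>f. f sums _"]) (auto simp: algebra_simps)
  have s1: "(\<lambda>i. of_nat (Suc i) * m ^ Suc i * J_series (Suc i) z) sums (m * ?S1)"
    using sums_mult[OF Pi_series_dm_sums, of m] by (simp add: mult_ac)
  have s1': "(\<lambda>i. of_nat i * m ^ i * J_series i z) sums (m * ?S1 + of_nat 0 * m ^ 0 * J_series 0 z)"
    by (rule sums_Suc[OF s1])
  have "(\<lambda>i. m * ((1 + z) * (2 * (of_nat (Suc i) * m ^ i * J_series (Suc i) z)) - (2 * (of_nat i * m ^ i * J_series i z) + m ^ i * J_series i z)))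
      sums (m * ((1 + z) * (2 * ?S1) - (2 * (m * ?S1 + of_nat 0 * m ^ 0 * J_series 0 z) + ?S0)))"
    by (intro sums_mult sums_diff sums_add Pi_series_dm_sums s1' Pi_series_sums)
  then have "(\<lambda>i. m * (m ^ i * ((2 * of_nat i + 3) * z * J_series (i + 2) z)))
      sums (m * ((1 + z) * (2 * ?S1) - (2 * (m * ?S1 + of_nat 0 * m ^ 0 * J_series 0 z) + ?S0)))"
  proof (rule back_subst[of "\<lambda>f. f sums _"], intro ext)
    fix i
    show "m * ((1 + z) * (2 * (of_nat (Suc i) * m ^ i * J_series (Suc i) z)) - (2 * (of_nat i * m ^ i * J_series i z) + m ^ i * J_series i z)) =
     m * (m ^ i * ((2 * of_nat i + 3) * z * J_series (i + 2) z))"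
      unfolding J_series_relation3[OF z] by (simp add: algebra_simps)
  qed
  then have "z * (2 * ?S1 - V - J_series 1 z) = m * ((1 + z) * (2 * ?S1) - (2 * (m * ?S1) + ?S0))"
    using sums_unique2[OF l, of "m * ((1 + z) * (2 * ?S1) - (2 * (m * ?S1 + of_nat 0 * m ^ 0 * J_series 0 z) + ?S0))"] by simp
  \<comment> \<open>One more factor \<open>m\<close> turns the tail \<open>V\<close> into
    \<open>Pi_series m z - J_series 0 z\<close>.\<close>
  then have "m * (z * (2 * ?S1 - V - J_series 1 z)) = m * (m * ((1 + z) * (2 * ?S1) - (2 * (m * ?S1) + ?S0)))" by simp
  then have "z * (2 * m * ?S1 - m * V - m * J_series 1 z) = m * (m * ((1 + z) * (2 * ?S1) - (2 * (m * ?S1) + ?S0)))"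
    by (simp add: algebra_simps)
  then show ?thesis unfolding V(2) by (simp add: algebra_simps power2_eq_square)
qed

end

text \<open>The series needs both arguments of norm below 1, and off the real axis
  \<open>\<bar>\<mu>\<bar>\<close> may exceed 1 within the unit disc. In general only a
  neighbourhood of the real interval is available.\<close>

definition Pi_domain :: "real poly \<Rightarrow> complex set" where
  "Pi_domain \<mu> = {k. norm k < 1 \<and> norm (cpoly \<mu> k) < 1}"

lemma open_Pi_domain: "open (Pi_domain \<mu>)"
  unfolding Pi_domain_def by (intro open_Collect_conj open_Collect_less continuous_intros)

lemma J_series_sq_derivative:
  assumes "norm (k::complex) < 1"
  shows "((\<lambda>k. J_series i (k^2)) has_field_derivative J_deriv i (k^2) * (2 * k)) (at k)"
  by (rule DERIV_chain2[of "J_series i" _ "\<lambda>k. k^2", OF J_series_has_derivative[OF norm_sq_less_1[OF assms]]])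
     (auto intro!: derivative_eq_intros)

text \<open>The series is differentiated term by term after \<open>m = \<mu>(k)\<close> and
  \<open>z = k\<^sup>2\<close> have been inserted, so that no chain rule in two variables is
  involved. Locally uniform convergence comes from a common bound \<open>r < 1\<close> on
  \<open>\<bar>k\<bar>\<close> and \<open>\<bar>\<mu>(k)\<bar>\<close>.\<close>

lemma Pi_series_comp_derivative:
  assumes x: "x \<in> Pi_domain \<mu>"
  shows "((\<lambda>k. Pi_series (cpoly \<mu> k) (k^2)) has_field_derivative
    (cpoly (pderiv \<mu>) x * Pi_series_dm (cpoly \<mu> x) (x^2) + 2 * x * Pi_series_dz (cpoly \<mu> x) (x^2))) (at x)"
proof -
  define f where "f n k = cpoly \<mu> k ^ n * J_series n (k^2)" for n k
  define f' where "f' n k = of_nat n * cpoly \<mu> k ^ (n - 1) * cpoly (pderiv \<mu>) k * J_series n (k^2) + cpoly \<mu> k ^ n * (2 * k * J_deriv n (k^2))" for n k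
  have dom: "norm (k^2) < 1" "norm (cpoly \<mu> k) < 1" if "k \<in> Pi_domain \<mu>" for k
    using that norm_sq_less_1 by (auto simp: Pi_domain_def)
  have "\<exists>g g'. \<forall>x\<in>Pi_domain \<mu>. (\<lambda>n. f n x) sums g x \<and> (\<lambda>n. f' n x) sums g' x \<and> (g has_field_derivative g' x) (at x)"
  proof (rule series_and_derivative_comparison_complex[OF open_Pi_domain])
    fix n k assume k: "k \<in> Pi_domain \<mu>"
    have 1: "(cpoly \<mu> has_field_derivative cpoly (pderiv \<mu>) k) (at k)"
      unfolding map_poly_cr_simps by (rule poly_DERIV)
    have "((\<lambda>k. J_series n (k^2)) has_field_derivative J_deriv n (k^2) * (2 * k)) (at k)"
      by (rule J_series_sq_derivative) (use k in \<open>simp add: Pi_domain_def\<close>)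
    then show "(f n has_field_derivative f' n k) (at k)"
      unfolding f_def f'_def using 1 by (auto intro!: derivative_eq_intros simp: algebra_simps map_poly_cr_simps)
  next
    fix k assume k: "k \<in> Pi_domain \<mu>"
    then have "max (norm k) (norm (cpoly \<mu> k)) < 1" by (simp add: Pi_domain_def)
    then obtain r where r: "max (norm k) (norm (cpoly \<mu> k)) < r" "r < 1" using dense by blast
    have r0: "0 \<le> r" using r(1) norm_ge_zero[of k] by linarith
    define U where "U = {k. norm k < r \<and> norm (cpoly \<mu> k) < r}"
    have "open U" unfolding U_def by (intro open_Collect_conj open_Collect_less continuous_intros)
    moreover have "k \<in> U" using r by (simp add: U_def)
    ultimately obtain d where d: "d > 0" "ball k d \<subseteq> U" by (meson open_contains_ball)
    have r2: "r^2 < 1" using r r0 by (simp add: abs_square_less_1)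
    define h where "h n = complex_of_real (r ^ n * (1 / (1 - r^2)))" for n
    have "summable h" unfolding h_def using r r0 by (intro summable_of_real summable_mult2 summable_geometric) auto
    moreover have "range h \<subseteq> \<real>\<^sub>\<ge>\<^sub>0" using r0 r2 by (auto simp: h_def complex_nonneg_Reals_iff)
    moreover have "norm (f n y) \<le> norm (h n)" if "y \<in> ball k d \<inter> Pi_domain \<mu>" for n y
    proof -
      have y: "norm y < r" "norm (cpoly \<mu> y) < r" using that d by (auto simp: U_def)
      have y2: "norm (y^2) \<le> r^2" using y by (simp add: norm_power power_mono)
      have "norm (J_series n (y^2)) \<le> 1 / (1 - norm (y^2))" using y2 r2 by (intro J_series_summable(2)) simp
      also have "\<dots> \<le> 1 / (1 - r^2)" using y2 r2 by (intro divide_left_mono) auto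
      finally have "norm (f n y) \<le> r ^ n * (1 / (1 - r^2))"
        unfolding f_def norm_mult norm_power using y r0 by (intro mult_mono power_mono) auto
      also have "\<dots> = norm (h n)" using r0 r2 unfolding h_def norm_of_real by (subst abs_of_nonneg) auto
      finally show ?thesis .
    qed
    ultimately show "\<exists>d h. 0 < d \<and> summable h \<and> range h \<subseteq> \<real>\<^sub>\<ge>\<^sub>0 \<and>
        (\<forall>\<^sub>F n in sequentially. \<forall>y\<in>ball k d \<inter> Pi_domain \<mu>. cmod (f n y) \<le> cmod (h n))"
      using d(1) by (intro exI[of _ d] exI[of _ h]) auto
  qed
  then obtain g g' where g: "\<And>k. k \<in> Pi_domain \<mu> \<Longrightarrow> (\<lambda>n. f n k) sums g k"
    "\<And>k. k \<in> Pi_domain \<mu> \<Longrightarrow> (\<lambda>n. f' n k) sums g' k" "\<And>k. k \<in> Pi_domain \<mu> \<Longrightarrow> (g has_field_derivative g' k) (at k)"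
    by blast
  have ge: "g k = Pi_series (cpoly \<mu> k) (k^2)" if "k \<in> Pi_domain \<mu>" for k
    using sums_unique2[OF g(1)[OF that]] Pi_series_sums[OF dom(2)[OF that] dom(1)[OF that]] by (simp add: f_def)
  let ?m = "cpoly \<mu> x" and ?z = "x^2"
  have s1: "(\<lambda>n. of_nat n * ?m ^ (n - 1) * J_series n ?z) sums (Pi_series_dm ?m ?z + of_nat 0 * ?m ^ (0 - 1) * J_series 0 ?z)"
    using Pi_series_dm_sums[OF dom(2)[OF x] dom(1)[OF x]] by (intro sums_Suc) simp
  have "(\<lambda>n. cpoly (pderiv \<mu>) x * (of_nat n * ?m ^ (n - 1) * J_series n ?z) + 2 * x * (?m ^ n * J_deriv n ?z)) sums
     (cpoly (pderiv \<mu>) x * (Pi_series_dm ?m ?z + of_nat 0 * ?m ^ (0 - 1) * J_series 0 ?z) + 2 * x * Pi_series_dz ?m ?z)"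
    by (intro sums_add sums_mult s1 Pi_series_dz_sums dom x)
  moreover have "cpoly (pderiv \<mu>) x * (of_nat n * ?m ^ (n - 1) * J_series n ?z) + 2 * x * (?m ^ n * J_deriv n ?z) = f' n x" for n
    by (simp add: f'_def mult_ac)
  ultimately have "g' x = cpoly (pderiv \<mu>) x * Pi_series_dm ?m ?z + 2 * x * Pi_series_dz ?m ?z"
    using sums_unique2[OF g(2)[OF x]] by simp
  then show ?thesis
    using has_field_derivative_transform_within_open[OF g(3)[OF x] open_Pi_domain x ge] by simp
qed

definition E_series :: "complex \<Rightarrow> complex" where "E_series z = J_series 0 z - z * J_series 1 z"

lemma hyp_F_eq_J_series: "hyp_F 0 z = J_series 0 z" "hyp_F 1 z = 2 * J_series 1 z" if "norm z < 1"
proof -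
  have c0: "hyp_coeff 0 j = J_coeff 0 j" for j
    by (simp add: hyp_coeff_def J_coeff_def half_coeff_def hyp_a_def hyp_b_def hyp_c_def pochhammer_fact[symmetric])
  have c1: "hyp_coeff 1 j = 2 * J_coeff 1 j" for j
  proof -
    have "pochhammer (2::real) j = fact (Suc j)" using pochhammer_rec[of "1::real" j] by (simp add: pochhammer_fact)
    moreover have "pochhammer (3/2::real) j = 2 * pochhammer (1/2) (Suc j)" using pochhammer_rec[of "1/2::real" j] by simp
    ultimately show ?thesis
      by (simp add: hyp_coeff_def J_coeff_def half_coeff_def hyp_a_def hyp_b_def hyp_c_def mult_ac del: fact_Suc)
  qed
  show "hyp_F 0 z = J_series 0 z" by (simp add: hyp_F_def J_series_def c0)
  have "hyp_F 1 z = (\<Sum>j. 2 * (of_real (J_coeff 1 j) * z ^ j))" unfolding hyp_F_def c1 by (simp add: mult.assoc)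
  also have "\<dots> = 2 * J_series 1 z" unfolding J_series_def using J_series_sums[OF that] by (intro suminf_mult) (auto intro: sums_summable)
  finally show "hyp_F 1 z = 2 * J_series 1 z" .
qed

lemma two_term_eq: "norm k < 1 \<Longrightarrow> two_term P Q k = cpoly P k * J_series 0 (k^2) + cpoly Q k * E_series (k^2)"
  using hyp_F_eq_J_series[OF norm_sq_less_1[of k]] by (simp add: two_term_def hyp_E_def E_series_def)

text \<open>The formula for the derivative is multiplied by \<open>k (1 - k\<^sup>2)\<close>, so
  that it makes sense at \<open>k = 0\<close> as well.\<close>

lemma eJ0_sq_derivative:
  assumes "norm k < 1"
  obtains d where "((\<lambda>k::complex. J_series 0 (k^2)) has_field_derivative d) (at k)" "k * (1 - k^2) * d = E_series (k^2) - (1 - k^2) * J_series 0 (k^2)"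
proof
  have z: "norm (k^2) < 1" using assms by (rule norm_sq_less_1)
  show "((\<lambda>k. J_series 0 (k^2)) has_field_derivative J_deriv 0 (k^2) * (2 * k)) (at k)"
    by (rule J_series_sq_derivative[OF assms])
  have "k * (1 - k^2) * (J_deriv 0 (k^2) * (2 * k)) = k^2 * (2 * (1 - k^2) * J_deriv 0 (k^2))"
    by (simp add: algebra_simps power2_eq_square)
  then show "k * (1 - k^2) * (J_deriv 0 (k^2) * (2 * k)) = E_series (k^2) - (1 - k^2) * J_series 0 (k^2)"
    unfolding J_series_relation2[OF z] by (simp add: E_series_def algebra_simps)
qed

lemma E_series_sq_derivative:
  assumes "norm k < 1"
  obtains d where "((\<lambda>k. E_series (k^2)) has_field_derivative d) (at k)" "k * d = E_series (k^2) - J_series 0 (k^2)"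
proof
  have z: "norm (k^2) < 1" using assms by (rule norm_sq_less_1)
  have d: "((\<lambda>k. J_series i (k^2)) has_field_derivative J_deriv i (k^2) * (2 * k)) (at k)" for i
    by (rule J_series_sq_derivative[OF assms])
  have "((\<lambda>k. E_series (k^2)) has_field_derivative J_deriv 0 (k^2) * (2 * k) - (2 * k * J_series 1 (k^2) + J_deriv 1 (k^2) * (2 * k) * k^2)) (at k)"
    unfolding E_series_def by (rule derivative_eq_intros d refl | simp)+
  also have "J_deriv 0 (k^2) * (2 * k) - (2 * k * J_series 1 (k^2) + J_deriv 1 (k^2) * (2 * k) * k^2) =
      2 * k * J_deriv 0 (k^2) - 2 * k * J_series 1 (k^2) - k * (2 * k^2 * J_deriv (Suc 0) (k^2))"
    by (simp add: algebra_simps)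
  also have "\<dots> = - k * J_series 1 (k^2)" unfolding J_series_relation1[OF z] by (simp add: algebra_simps)
  finally show "((\<lambda>k. E_series (k^2)) has_field_derivative - k * J_series 1 (k^2)) (at k)" .
  show "k * (- k * J_series 1 (k^2)) = E_series (k^2) - J_series 0 (k^2)" by (simp add: E_series_def power2_eq_square)
qed

text \<open>On the real interval this is \<open>2 / \<pi>\<close> times the elliptic
  combination.\<close>

definition comb_ext :: "real poly \<Rightarrow> real poly \<Rightarrow> real poly \<Rightarrow> real poly \<Rightarrow> complex \<Rightarrow> complex" where
  "comb_ext p q r \<mu> k = cpoly p k * J_series 0 (k^2) + cpoly q k * E_series (k^2) + cpoly r k * Pi_series (cpoly \<mu> k) (k^2)"

definition comb_reduced :: "real poly \<Rightarrow> real poly \<Rightarrow> real poly \<Rightarrow> real poly \<Rightarrow> complex \<Rightarrow> complex" where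
  "comb_reduced p q r \<mu> k = 2 * cpoly (sing_poly \<mu>) k * (cpoly r k * deriv (comb_ext p q r \<mu>) k - cpoly (pderiv r) k * comb_ext p q r \<mu> k)
     + cpoly r k * cpoly (weight_poly \<mu>) k * comb_ext p q r \<mu> k"

lemma cpoly_deriv: "(cpoly p has_field_derivative cpoly (pderiv p) k) (at k)"
  unfolding map_poly_cr_simps by (rule poly_DERIV)

lemma comb_ext_derivative:
  assumes k: "k \<in> Pi_domain \<mu>"
  shows "\<exists>d. (comb_ext p q r \<mu> has_field_derivative d) (at k)"
    and "k * (1 - k^2) * comb_reduced p q r \<mu> k = two_term (reduced_K p q r \<mu>) (reduced_E p q r \<mu>) k"
proof -
  have k1: "norm k < 1" and z: "norm (k^2) < 1" and m: "norm (cpoly \<mu> k) < 1"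
    using k norm_sq_less_1 by (auto simp: Pi_domain_def)
  obtain dK where dK: "((\<lambda>k::complex. J_series 0 (k^2)) has_field_derivative dK) (at k)"
    "k * (1 - k^2) * dK = E_series (k^2) - (1 - k^2) * J_series 0 (k^2)" using eJ0_sq_derivative[OF k1] .
  obtain dE where dE: "((\<lambda>k. E_series (k^2)) has_field_derivative dE) (at k)" "k * dE = E_series (k^2) - J_series 0 (k^2)"
    using E_series_sq_derivative[OF k1] .
  define dP where "dP = cpoly (pderiv \<mu>) k * Pi_series_dm (cpoly \<mu> k) (k^2) + 2 * k * Pi_series_dz (cpoly \<mu> k) (k^2)"
  have dP: "((\<lambda>k. Pi_series (cpoly \<mu> k) (k^2)) has_field_derivative dP) (at k)"
    unfolding dP_def by (rule Pi_series_comp_derivative[OF k])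
  let ?K = "J_series 0 (k^2)" and ?E = "E_series (k^2)" and ?P = "Pi_series (cpoly \<mu> k) (k^2)"
  define d where "d = (cpoly (pderiv p) k * ?K + dK * cpoly p k) + (cpoly (pderiv q) k * ?E + dE * cpoly q k) + (cpoly (pderiv r) k * ?P + dP * cpoly r k)"
  have der: "(comb_ext p q r \<mu> has_field_derivative d) (at k)"
    unfolding comb_ext_def d_def by (intro DERIV_add DERIV_mult cpoly_deriv dK(1) dE(1) dP)
  then show "\<exists>d. (comb_ext p q r \<mu> has_field_derivative d) (at k)" by blast
  have Pi_eq: "(1 - k^2) * (2 * cpoly (sing_poly \<mu>) k * dP) =
      (1 - k^2) * cpoly (pderiv \<mu>) k * ((cpoly \<mu> k ^ 2 - k^2) * ?P + (k^2 - cpoly \<mu> k) * ?K + cpoly \<mu> k * ?E)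
      + 2 * k * cpoly \<mu> k * (1 - cpoly \<mu> k) * ((1 - k^2) * ?P - ?E)"
  proof -
    have Y: "cpoly (sing_poly \<mu>) k = cpoly \<mu> k * (1 - cpoly \<mu> k) * (cpoly \<mu> k - k^2)" by (simp add: sing_poly_def cpoly_power mult.assoc)
    have "(1 - k^2) * (2 * cpoly (sing_poly \<mu>) k * dP) =
        (1 - k^2) * cpoly (pderiv \<mu>) k * (2 * cpoly \<mu> k * (1 - cpoly \<mu> k) * (cpoly \<mu> k - k^2) * Pi_series_dm (cpoly \<mu> k) (k^2))
        - 2 * k * cpoly \<mu> k * (1 - cpoly \<mu> k) * (2 * (1 - k^2) * (k^2 - cpoly \<mu> k) * Pi_series_dz (cpoly \<mu> k) (k^2))"
      unfolding dP_def Y by (simp add: algebra_simps)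
    then show ?thesis unfolding Pi_series_dm_relation[OF m z] Pi_series_dz_relation[OF m z] E_series_def by (simp add: algebra_simps)
  qed
  have H: "comb_reduced p q r \<mu> k = 2 * cpoly (sing_poly \<mu>) k * (cpoly r k * d - cpoly (pderiv r) k * comb_ext p q r \<mu> k) + cpoly r k * cpoly (weight_poly \<mu>) k * comb_ext p q r \<mu> k"
    unfolding comb_reduced_def using DERIV_imp_deriv[OF der] by simp
  have T: "cpoly (weight_poly \<mu>) k = - (cpoly (pderiv \<mu>) k * (cpoly \<mu> k ^ 2 - k^2) + 2 * k * cpoly \<mu> k * (1 - cpoly \<mu> k))"
    unfolding weight_poly_alt by (simp add: cpoly_power map_poly_cr_simps(6))
  have key: "x * w * (D * (r * ((p' * K + dK * p) + (q' * E + dE * q) + (r' * P + dP * r)) - r' * (p * K + q * E + r * P)) + r * T * (p * K + q * E + r * P))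
     = w * (x * (D * (r * p' - r' * p) + r * T * p) - r * D * (p + q) + x * r^2 * \<mu>' * (x^2 - m)) * K
     + (w * (x * (D * (r * q' - r' * q) + r * T * q) + r * D * q) + r * D * p + r^2 * m * x * (w * \<mu>' - 2 * x * (1 - m))) * E"
    if eK: "x * w * dK = E - w * K" and E_series: "x * dE = E - K"
     and eP: "w * (D * dP) = w * \<mu>' * ((m^2 - x^2) * P + (x^2 - m) * K + m * E) + 2 * x * m * (1 - m) * (w * P - E)"
     and T: "T = - (\<mu>' * (m^2 - x^2) + 2 * x * m * (1 - m))"
    for x w D r p p' q q' r' K dK E dE P dP T m \<mu>' :: complex
  proof -
    have "x * w * (D * (r * ((p' * K + dK * p) + (q' * E + dE * q) + (r' * P + dP * r)) - r' * (p * K + q * E + r * P)) + r * T * (p * K + q * E + r * P))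
      = x * w * (D * (r * p' - r' * p) + r * T * p) * K + x * w * (D * (r * q' - r' * q) + r * T * q) * E
      + D * r * p * (x * w * dK) + D * r * q * w * (x * dE) + x * r^2 * (w * (D * dP)) + x * w * r^2 * T * P"
      by (simp add: algebra_simps power2_eq_square)
    also have "\<dots> = w * (x * (D * (r * p' - r' * p) + r * T * p) - r * D * (p + q) + x * r^2 * \<mu>' * (x^2 - m)) * K
     + (w * (x * (D * (r * q' - r' * q) + r * T * q) + r * D * q) + r * D * p + r^2 * m * x * (w * \<mu>' - 2 * x * (1 - m))) * E"
    proof -
      \<comment> \<open>Here the integral of the third kind disappears: its coefficient in the
        derivative is cancelled by \<open>T\<close>.\<close>
      have PT: "x * r^2 * (w * (D * dP)) + x * w * r^2 * T * P =
        x * r^2 * (w * \<mu>' * ((x^2 - m) * K + m * E) - 2 * x * m * (1 - m) * E)"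
        unfolding eP T by (simp add: algebra_simps power2_eq_square)
      show ?thesis unfolding eK E_series add.assoc PT by (simp add: algebra_simps power2_eq_square)
    qed
    finally show ?thesis .
  qed
  show "k * (1 - k^2) * comb_reduced p q r \<mu> k = two_term (reduced_K p q r \<mu>) (reduced_E p q r \<mu>) k"
    unfolding H two_term_eq[OF k1] comb_ext_def d_def
    by (subst key[OF dK(2) dE(2) Pi_eq T])
       (simp add: reduced_K_def reduced_E_def forcing_poly_def cpoly_power map_poly_cr_simps(6) mult_ac
          del: distrib_left_numeral distrib_right_numeral right_diff_distrib_numeral left_diff_distrib_numeral)
qed

section \<open>The elliptic integrals as power series\<close>

lemma has_integral_nonneg_series:
  fixes f :: "nat \<Rightarrow> real \<Rightarrow> real"
  assumes int: "\<And>n. (f n has_integral c n) S" and nn: "\<And>n x. x \<in> S \<Longrightarrow> f n x \<ge> 0"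
    and g: "\<And>x. x \<in> S \<Longrightarrow> (\<lambda>n. f n x) sums g x" and c: "c sums C"
  shows "(g has_integral C) S"
\<comment> \<open>Nonnegative terms make the partial sums increase, so convergence of the sums of
  the integrals is all that has to be supplied.\<close>
proof (rule has_integral_monotone_convergence_increasing)
  show "((\<lambda>x. \<Sum>n<k. f n x) has_integral (\<Sum>n<k. c n)) S" for k
    by (intro has_integral_sum int) auto
  show "(\<Sum>n<k. f n x) \<le> (\<Sum>n<Suc k. f n x)" if "x \<in> S" for k x using nn[OF that] by simp
  show "(\<lambda>k. \<Sum>n<k. f n x) \<longlonglongrightarrow> g x" if "x \<in> S" for x using g[OF that] by (simp add: sums_def)
  show "(\<lambda>k. \<Sum>n<k. c n) \<longlonglongrightarrow> C" using c by (simp add: sums_def)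
qed

text \<open>The recursion comes from integrating the derivative of
  \<open>z ^ (2 n + 1) * sqrt (1 - z\<^sup>2)\<close>, a function that is 0 at both ends.\<close>

lemma wallis_integral: "((\<lambda>z. z ^ (2 * n) / sqrt (1 - z\<^sup>2)) has_integral (pi / 2 * half_coeff n)) {0..1}"
proof (induction n)
  case 0
  have "((\<lambda>z. 1 / sqrt (1 - z\<^sup>2)) has_integral (arcsin 1 - arcsin 0)) {0..1}"
  proof (rule fundamental_theorem_of_calculus_interior)
    show "continuous_on {0..1} arcsin" by (rule continuous_on_subset[OF continuous_on_arcsin']) auto
    show "(arcsin has_vector_derivative 1 / sqrt (1 - x\<^sup>2)) (at x)" if "x \<in> {0<..<1}" for x
      using that DERIV_arcsin[of x] by (simp add: has_real_derivative_iff_has_vector_derivative[symmetric] inverse_eq_divide)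
  qed simp
  then show ?case by simp
next
  case (Suc n)
  have "((\<lambda>z. ((2 * real n + 1) * z ^ (2 * n) - (2 * real n + 2) * z ^ (2 * n + 2)) / sqrt (1 - z\<^sup>2)) has_integral
     (1 ^ (2 * n + 1) * sqrt (1 - 1\<^sup>2) - 0 ^ (2 * n + 1) * sqrt (1 - 0\<^sup>2))) {0..1}"
  proof (rule fundamental_theorem_of_calculus_interior)
    show "continuous_on {0..1} (\<lambda>z::real. z ^ (2 * n + 1) * sqrt (1 - z\<^sup>2))" by (intro continuous_intros)
    fix x :: real assume x: "x \<in> {0<..<1}"
    then have pos: "1 - x\<^sup>2 > 0" by (simp add: abs_square_less_1)
    have "((\<lambda>z. z ^ (2 * n + 1) * sqrt (1 - z\<^sup>2)) has_real_derivative
       real (2 * n + 1) * x ^ (2 * n) * sqrt (1 - x\<^sup>2) + (- (2 * x)) * (inverse (sqrt (1 - x\<^sup>2)) / 2) * x ^ (2 * n + 1)) (at x)"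
    proof (rule DERIV_mult)
      show "((\<lambda>z. z ^ (2 * n + 1)) has_real_derivative real (2 * n + 1) * x ^ (2 * n)) (at x)"
        using DERIV_pow[of "2 * n + 1" x] by simp
      show "((\<lambda>z. sqrt (1 - z\<^sup>2)) has_real_derivative (- (2 * x)) * (inverse (sqrt (1 - x\<^sup>2)) / 2)) (at x)"
        using pos by (auto intro!: derivative_eq_intros simp: field_simps)
    qed
    also have "real (2 * n + 1) * x ^ (2 * n) * sqrt (1 - x\<^sup>2) + (- (2 * x)) * (inverse (sqrt (1 - x\<^sup>2)) / 2) * x ^ (2 * n + 1)
      = ((2 * real n + 1) * x ^ (2 * n) - (2 * real n + 2) * x ^ (2 * n + 2)) / sqrt (1 - x\<^sup>2)"
    proof -
      have "sqrt (1 - x\<^sup>2) = (1 - x\<^sup>2) / sqrt (1 - x\<^sup>2)" using pos by (simp add: real_div_sqrt)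
      then have "real (2 * n + 1) * x ^ (2 * n) * sqrt (1 - x\<^sup>2) = real (2 * n + 1) * x ^ (2 * n) * ((1 - x\<^sup>2) / sqrt (1 - x\<^sup>2))" by simp
      then show ?thesis using pos by (simp add: field_simps power2_eq_square)
    qed
    finally show "((\<lambda>z. z ^ (2 * n + 1) * sqrt (1 - z\<^sup>2)) has_vector_derivative
        ((2 * real n + 1) * x ^ (2 * n) - (2 * real n + 2) * x ^ (2 * n + 2)) / sqrt (1 - x\<^sup>2)) (at x)"
      by (simp add: has_real_derivative_iff_has_vector_derivative)
  qed simp
  then have i0: "((\<lambda>z. ((2 * real n + 1) * z ^ (2 * n) - (2 * real n + 2) * z ^ (2 * n + 2)) / sqrt (1 - z\<^sup>2)) has_integral 0) {0..1}"
    by simp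
  have "((\<lambda>z. (1 / (2 * real n + 2)) * ((2 * real n + 1) * (z ^ (2 * n) / sqrt (1 - z\<^sup>2))
      - ((2 * real n + 1) * z ^ (2 * n) - (2 * real n + 2) * z ^ (2 * n + 2)) / sqrt (1 - z\<^sup>2)))
      has_integral ((1 / (2 * real n + 2)) * ((2 * real n + 1) * (pi / 2 * half_coeff n) - 0))) {0..1}"
    by (intro has_integral_mult_right has_integral_diff Suc i0)
  moreover have "(1 / (2 * real n + 2)) * ((2 * real n + 1) * (z ^ (2 * n) / sqrt (1 - z\<^sup>2))
      - ((2 * real n + 1) * z ^ (2 * n) - (2 * real n + 2) * z ^ (2 * n + 2)) / sqrt (1 - z\<^sup>2)) = z ^ (2 * Suc n) / sqrt (1 - z\<^sup>2)" for z :: real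
  proof -
    define w where "w = 1 / sqrt (1 - z\<^sup>2)"
    have d: "a / sqrt (1 - z\<^sup>2) = a * w" for a by (simp add: w_def)
    have p: "2 * real n + 2 \<noteq> 0" by linarith
    have "(1 / (2 * real n + 2)) * ((2 * real n + 1) * (z ^ (2 * n) * w) - ((2 * real n + 1) * z ^ (2 * n) - (2 * real n + 2) * z ^ (2 * n + 2)) * w)
       = (1 / (2 * real n + 2)) * ((2 * real n + 2) * (z ^ (2 * n + 2) * w))" by (simp only: algebra_simps)
    also have "\<dots> = z ^ (2 * n + 2) * w" using p by simp
    finally show ?thesis unfolding d by simp
  qed
  moreover have "(1 / (2 * real n + 2)) * ((2 * real n + 1) * (pi / 2 * half_coeff n) - 0) = pi / 2 * half_coeff (Suc n)"
    by (simp add: half_coeff_Suc)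
  ultimately show ?case by (simp only:)
qed

lemma inverse_sqrt_sums:
  assumes "0 \<le> x" "x < 1"
  shows "(\<lambda>j. half_coeff j * x ^ j) sums (1 / sqrt (1 - x))"
proof -
  have "(\<lambda>n. ((-1/2) gchoose n) * (- x) ^ n) sums (1 + (- x)) powr (-1/2)"
    using assms by (intro gen_binomial_real) auto
  moreover have "((-1/2) gchoose n) * (- x) ^ n = half_coeff n * x ^ n" for n
  proof -
    have "((-1/2 :: real) gchoose n) = (-1) ^ n * half_coeff n" by (simp add: gbinomial_pochhammer half_coeff_def)
    then have "((-1/2) gchoose n) * (- x) ^ n = half_coeff n * ((-1) * (- x)) ^ n" by (simp only: power_mult_distrib mult_ac)
    then show ?thesis by simp
  qed
  moreover have "(1 + (- x)) powr (-1/2) = 1 / sqrt (1 - x)"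
    using powr_minus_divide[of "1 - x" "1/2"] powr_half_sqrt[of "1 - x"] assms by simp
  ultimately show ?thesis by simp
qed

context
  fixes k :: real
  assumes k: "k \<in> {-1<..<1}"
begin

lemma k2: "0 \<le> k\<^sup>2" "k\<^sup>2 < 1" using k by (auto simp: abs_square_less_1)

text \<open>The binomial series of \<open>1 / sqrt (1 - k\<^sup>2 z\<^sup>2)\<close> is integrated
  by Wallis' formula. At \<open>z = 1\<close> the pointwise identity holds because division by 0
  makes both sides 0.\<close>

lemma J_series_integral: "((\<lambda>z. z ^ (2 * i) / sqrt ((1 - z\<^sup>2) * (1 - k\<^sup>2 * z\<^sup>2))) has_integral (pi / 2 * J_series i (k\<^sup>2))) {0..1}"
proof (rule has_integral_nonneg_series)
  fix n
  have "((\<lambda>z. (half_coeff n * (k\<^sup>2) ^ n) * (z ^ (2 * (i + n)) / sqrt (1 - z\<^sup>2))) has_integral ((half_coeff n * (k\<^sup>2) ^ n) * (pi / 2 * half_coeff (i + n)))) {0..1}"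
    by (intro has_integral_mult_right wallis_integral)
  then show "((\<lambda>z. (half_coeff n * (k\<^sup>2) ^ n) * (z ^ (2 * (i + n)) / sqrt (1 - z\<^sup>2))) has_integral (pi / 2 * (J_coeff i n * (k\<^sup>2) ^ n))) {0..1}"
    by (simp add: J_coeff_def mult_ac)
next
  fix n and x :: real assume "x \<in> {0..1}"
  then have "x\<^sup>2 \<le> 1" "0 \<le> x" by (auto simp: power_le_one)
  then show "0 \<le> (half_coeff n * (k\<^sup>2) ^ n) * (x ^ (2 * (i + n)) / sqrt (1 - x\<^sup>2))"
    using half_coeff_pos[of n] by (intro mult_nonneg_nonneg divide_nonneg_nonneg) auto
next
  show "(\<lambda>n. pi / 2 * (J_coeff i n * (k\<^sup>2) ^ n)) sums (pi / 2 * J_series i (k\<^sup>2))"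
    using J_series_sums[of "k\<^sup>2" i] k2 by (intro sums_mult) simp
next
  fix x :: real assume x: "x \<in> {0..1}"
  have x2: "0 \<le> x\<^sup>2" "x\<^sup>2 \<le> 1" using x by (auto simp: power_le_one)
  have kx: "0 \<le> k\<^sup>2 * x\<^sup>2" "k\<^sup>2 * x\<^sup>2 < 1" using k2 x2 mult_mono[of "k\<^sup>2" "k\<^sup>2" "x\<^sup>2" 1] by auto
  have sm: "(\<lambda>n. (x ^ (2 * i) / sqrt (1 - x\<^sup>2)) * (half_coeff n * (k\<^sup>2 * x\<^sup>2) ^ n)) sums ((x ^ (2 * i) / sqrt (1 - x\<^sup>2)) * (1 / sqrt (1 - k\<^sup>2 * x\<^sup>2)))"
    by (intro sums_mult inverse_sqrt_sums kx)
  show "(\<lambda>n. (half_coeff n * (k\<^sup>2) ^ n) * (x ^ (2 * (i + n)) / sqrt (1 - x\<^sup>2))) sums (x ^ (2 * i) / sqrt ((1 - x\<^sup>2) * (1 - k\<^sup>2 * x\<^sup>2)))"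
  proof -
    have "x ^ (2 * (i + n)) = x ^ (2 * i) * (x\<^sup>2) ^ n" for n unfolding distrib_left power_add power_mult[of x 2 n] ..
    with sm show ?thesis by (simp add: real_sqrt_mult power_mult_distrib mult_ac)
  qed
qed

lemma elliptic_K_eq: "elliptic_K k = pi / 2 * J_series 0 (k\<^sup>2)"
  unfolding elliptic_K_def using integral_unique[OF J_series_integral[of 0]] by simp

lemma elliptic_E_eq: "elliptic_E k = pi / 2 * (J_series 0 (k\<^sup>2) - k\<^sup>2 * J_series 1 (k\<^sup>2))"
proof -
  have "((\<lambda>z. z ^ (2 * 0) / sqrt ((1 - z\<^sup>2) * (1 - k\<^sup>2 * z\<^sup>2)) - k\<^sup>2 * (z ^ (2 * 1) / sqrt ((1 - z\<^sup>2) * (1 - k\<^sup>2 * z\<^sup>2))))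
     has_integral (pi / 2 * J_series 0 (k\<^sup>2) - k\<^sup>2 * (pi / 2 * J_series 1 (k\<^sup>2)))) {0..1}"
    by (intro has_integral_diff has_integral_mult_right J_series_integral)
  moreover have "z ^ (2 * 0) / sqrt ((1 - z\<^sup>2) * (1 - k\<^sup>2 * z\<^sup>2)) - k\<^sup>2 * (z ^ (2 * 1) / sqrt ((1 - z\<^sup>2) * (1 - k\<^sup>2 * z\<^sup>2)))
      = sqrt (1 - k\<^sup>2 * z\<^sup>2) / sqrt (1 - z\<^sup>2)" if "z \<in> {0..1}" for z
  proof -
    have "z\<^sup>2 \<le> 1" using that by (auto simp: power_le_one)
    then have kz: "1 - k\<^sup>2 * z\<^sup>2 > 0" using k2 mult_mono[of "k\<^sup>2" "k\<^sup>2" "z\<^sup>2" 1] by auto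
    have "z ^ (2 * 0) / sqrt ((1 - z\<^sup>2) * (1 - k\<^sup>2 * z\<^sup>2)) - k\<^sup>2 * (z ^ (2 * 1) / sqrt ((1 - z\<^sup>2) * (1 - k\<^sup>2 * z\<^sup>2)))
       = ((1 - k\<^sup>2 * z\<^sup>2) / sqrt (1 - k\<^sup>2 * z\<^sup>2)) / sqrt (1 - z\<^sup>2)"
      by (simp add: real_sqrt_mult diff_divide_distrib mult.commute)
    also have "(1 - k\<^sup>2 * z\<^sup>2) / sqrt (1 - k\<^sup>2 * z\<^sup>2) = sqrt (1 - k\<^sup>2 * z\<^sup>2)" using kz by (intro real_div_sqrt) simp
    finally show ?thesis .
  qed
  ultimately have "((\<lambda>z. sqrt (1 - k\<^sup>2 * z\<^sup>2) / sqrt (1 - z\<^sup>2)) has_integral (pi / 2 * J_series 0 (k\<^sup>2) - k\<^sup>2 * (pi / 2 * J_series 1 (k\<^sup>2)))) {0..1}"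
    by (rule has_integral_eq[rotated]) auto
  then show ?thesis unfolding elliptic_E_def by (subst integral_unique) (auto simp: algebra_simps)
qed

text \<open>The geometric series of \<open>1 / (1 - m z\<^sup>2)\<close>, integrated term by
  term.\<close>

lemma elliptic_Pi_sums:
  assumes m: "0 \<le> m" "m < 1" and s: "(\<lambda>i. m ^ i * J_series i (k\<^sup>2)) sums s"
  shows "elliptic_Pi m k = pi / 2 * s"
proof -
  have "(elliptic_Pi_integrand m k has_integral (pi / 2 * s)) {0..1}"
  proof (rule has_integral_nonneg_series)
    fix n
    show "((\<lambda>z. m ^ n * (z ^ (2 * n) / sqrt ((1 - z\<^sup>2) * (1 - k\<^sup>2 * z\<^sup>2)))) has_integral (m ^ n * (pi / 2 * J_series n (k\<^sup>2)))) {0..1}"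
      by (intro has_integral_mult_right J_series_integral)
  next
    fix n and x :: real assume x: "x \<in> {0..1}"
    then have "x\<^sup>2 \<le> 1" by (auto simp: power_le_one)
    moreover from this have "k\<^sup>2 * x\<^sup>2 \<le> 1" using k2 mult_mono[of "k\<^sup>2" 1 "x\<^sup>2" 1] by auto
    ultimately show "0 \<le> m ^ n * (x ^ (2 * n) / sqrt ((1 - x\<^sup>2) * (1 - k\<^sup>2 * x\<^sup>2)))"
      using m x by (intro mult_nonneg_nonneg divide_nonneg_nonneg zero_le_power real_sqrt_ge_zero) auto
  next
    show "(\<lambda>n. m ^ n * (pi / 2 * J_series n (k\<^sup>2))) sums (pi / 2 * s)"
      using sums_mult[OF s, of "pi / 2"] by (simp add: mult_ac)
  next
    fix x :: real assume x: "x \<in> {0..1}"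
    then have "x\<^sup>2 \<le> 1" by (auto simp: power_le_one)
    then have "norm (m * x\<^sup>2) < 1" using m mult_mono[of m m "x\<^sup>2" 1] by auto
    then have "(\<lambda>n. (m * x\<^sup>2) ^ n * (1 / sqrt ((1 - x\<^sup>2) * (1 - k\<^sup>2 * x\<^sup>2)))) sums ((1 / (1 - m * x\<^sup>2)) * (1 / sqrt ((1 - x\<^sup>2) * (1 - k\<^sup>2 * x\<^sup>2))))"
      by (intro sums_mult2 geometric_sums)
    then show "(\<lambda>n. m ^ n * (x ^ (2 * n) / sqrt ((1 - x\<^sup>2) * (1 - k\<^sup>2 * x\<^sup>2)))) sums elliptic_Pi_integrand m k x"
      unfolding elliptic_Pi_integrand_def power_mult[of x 2] by (simp add: power_mult_distrib)
  qed
  then show ?thesis unfolding elliptic_Pi_def by (rule integral_unique)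
qed

text \<open>For \<open>m > 1\<close> the integrand has a simple pole at
  \<open>z0 = 1 / sqrt m\<close>, inside the interval, and is positive before it. Up to
  \<open>t < z0\<close> its integral grows at least like a multiple of
  \<open>- ln (1 - sqrt m t)\<close>, whereas integrability up to \<open>z0\<close> would bound
  it.\<close>

lemma Pi_integrable_imp_less_1:
  assumes m: "0 \<le> m" "m \<noteq> 1" and int: "elliptic_Pi_integrand m k integrable_on {0..1}"
  shows "m < 1"
proof (rule ccontr)
  assume "\<not> m < 1"
  then have m1: "m > 1" using m by simp
  define c where "c = sqrt m"
  have c: "c > 1" "c^2 = m" using m1 by (auto simp: c_def)
  define z0 where "z0 = 1 / c"
  have z0: "0 < z0" "z0 < 1" using c by (auto simp: z0_def)
  define f where "f = elliptic_Pi_integrand m k"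
  have low: "1 / (1 + c) * (1 / (1 - c * z)) \<le> f z" and nn: "f z \<ge> 0" if z: "0 \<le> z" "z < z0" for z
  proof -
    have cz: "0 \<le> c * z" "c * z < 1" using z c by (auto simp: z0_def field_simps)
    have z1: "z < 1" using z z0 by simp
    have z2: "z\<^sup>2 < 1" using z z1 by (simp add: abs_square_less_1)
    have kz: "0 \<le> k\<^sup>2 * z\<^sup>2" "k\<^sup>2 * z\<^sup>2 < 1" using k2 z2 mult_mono[of "k\<^sup>2" "k\<^sup>2" "z\<^sup>2" 1] by auto
    have S: "0 < sqrt ((1 - z\<^sup>2) * (1 - k\<^sup>2 * z\<^sup>2))" "sqrt ((1 - z\<^sup>2) * (1 - k\<^sup>2 * z\<^sup>2)) \<le> 1"
      using z2 kz by (auto intro!: mult_le_one)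
    have e: "1 - m * z\<^sup>2 = (1 - c * z) * (1 + c * z)" unfolding c(2)[symmetric] by (simp add: algebra_simps power2_eq_square)
    have pos: "0 < (1 - c * z) * (1 + c * z) * sqrt ((1 - z\<^sup>2) * (1 - k\<^sup>2 * z\<^sup>2))" using cz S by (intro mult_pos_pos) auto
    have "(1 - c * z) * (1 + c * z) * sqrt ((1 - z\<^sup>2) * (1 - k\<^sup>2 * z\<^sup>2)) \<le> (1 - c * z) * (1 + c) * 1"
      using cz S c z1 by (intro mult_mono) auto
    then have "1 / ((1 - c * z) * (1 + c)) \<le> 1 / ((1 - c * z) * (1 + c * z) * sqrt ((1 - z\<^sup>2) * (1 - k\<^sup>2 * z\<^sup>2)))"
      using pos cz c by (intro divide_left_mono) (auto intro!: mult_pos_pos)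
    then show "1 / (1 + c) * (1 / (1 - c * z)) \<le> f z" by (simp add: f_def elliptic_Pi_integrand_def e mult.commute)
    show "f z \<ge> 0" using pos by (simp add: f_def elliptic_Pi_integrand_def e)
  qed
  have int0: "f integrable_on {0..z0}" using integrable_on_subinterval[OF int, of 0 z0] z0 by (auto simp: f_def)
  define B where "B = integral {0..z0} f"
  have bound: "1 / (1 + c) * (- ln (1 - c * t) / c) \<le> B" if t: "0 < t" "t < z0" for t
  proof -
    have ct: "c * z < 1" if "z \<le> t" for z
    proof -
      have "c * z \<le> c * t" using that c by simp
      also have "\<dots> < 1" using t c by (simp add: z0_def field_simps)
      finally show ?thesis .
    qed
    have "((\<lambda>z. 1 / (1 + c) * (1 / (1 - c * z))) has_integral (1 / (1 + c) * (- ln (1 - c * t) / c) - 1 / (1 + c) * (- ln (1 - c * 0) / c))) {0..t}"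
    proof (rule fundamental_theorem_of_calculus)
      show "((\<lambda>z. 1 / (1 + c) * (- ln (1 - c * z) / c)) has_vector_derivative 1 / (1 + c) * (1 / (1 - c * x))) (at x within {0..t})"
        if "x \<in> {0..t}" for x
      proof -
        have "((\<lambda>z. - ln (1 - c * z) / c) has_real_derivative 1 / (1 - c * x)) (at x within {0..t})"
          using ct[of x] that c by (auto intro!: derivative_eq_intros)
        from DERIV_cmult[OF this, of "1 / (1 + c)"] show ?thesis
          by (simp add: has_real_derivative_iff_has_vector_derivative)
      qed
    qed (use t in simp)
    then have i1: "((\<lambda>z. 1 / (1 + c) * (1 / (1 - c * z))) has_integral (1 / (1 + c) * (- ln (1 - c * t) / c))) {0..t}" by simp
    have i2: "f integrable_on {0..t}" using integrable_on_subinterval[OF int0, of 0 t] t by auto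
    have i3: "f integrable_on {t..z0}" using integrable_on_subinterval[OF int0, of t z0] t by auto
    have "1 / (1 + c) * (- ln (1 - c * t) / c) \<le> integral {0..t} f"
      by (rule has_integral_le[OF i1 integrable_integral[OF i2]]) (use low t in auto)
    also have "\<dots> \<le> integral {0..t} f + integral {t..z0} f"
    proof -
      \<comment> \<open>The sign of \<open>f\<close> is known only before \<open>z0\<close>, so its
        value at \<open>z0\<close> is replaced by 0.\<close>
      have "0 \<le> integral {t..z0} f"
      proof (rule has_integral_nonneg[OF has_integral_spike[of "{z0}" _ "\<lambda>x. if x = z0 then 0 else f x"]])
        show "((\<lambda>x. if x = z0 then 0 else f x) has_integral integral {t..z0} f) {t..z0}"
          by (rule has_integral_spike[OF negligible_sing[of z0] _ integrable_integral[OF i3]]) auto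
      qed (use nn t in auto)
      then show ?thesis by simp
    qed
    also have "\<dots> = B" unfolding B_def using t int0 by (intro Henstock_Kurzweil_Integration.integral_combine) auto
    finally show ?thesis .
  qed
  \<comment> \<open>Chosen so that the lower bound becomes \<open>\<bar>B\<bar> + 1\<close> at the
    point \<open>t\<close> with \<open>- ln (1 - c t) = M\<close>.\<close>
  define M where "M = c * (1 + c) * (\<bar>B\<bar> + 1)"
  have M: "M > 0" unfolding M_def using c by (intro mult_pos_pos) auto
  define t where "t = (1 - exp (- M)) / c"
  have t: "0 < t" "t < z0" using M c by (auto simp: t_def z0_def divide_simps)
  have "1 - c * t = exp (- M)" using c by (simp add: t_def)
  then have "1 / (1 + c) * (M / c) \<le> B" using bound[OF t] by simp
  moreover have "1 / (1 + c) * (M / c) = \<bar>B\<bar> + 1" using c by (simp add: M_def)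
  ultimately show False by linarith
qed

end

section \<open>The weighted Rolle argument\<close>

lemma fps_expansion_unique: "(\<lambda>x. f (c + x)) has_fps_expansion F \<Longrightarrow> fps_expansion f c = F"
  by (rule fps_ext) (simp add: fps_expansion_def fps_nth_fps_expansion higher_deriv_shift_0[of _ f c] o_def)

lemma fps_expansion_arith:
  assumes "f analytic_on {c}" "g analytic_on {c}"
  shows "fps_expansion (\<lambda>z. f z * g z) c = fps_expansion f c * fps_expansion g c"
    and "fps_expansion (\<lambda>z. f z + g z) c = fps_expansion f c + fps_expansion g c"
    and "fps_expansion (\<lambda>z. f z - g z) c = fps_expansion f c - fps_expansion g c"
  by (rule fps_expansion_unique, intro has_fps_expansion_mult has_fps_expansion_add has_fps_expansion_diff
      analytic_at_imp_has_fps_expansion assms)+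

lemma fps_expansion_deriv:
  assumes "f analytic_on {c}"
  shows "fps_expansion (deriv f) c = fps_deriv (fps_expansion f c)"
proof (rule fps_ext)
  fix n
  have "(deriv ^^ Suc n) f c = (deriv ^^ n) (deriv f) c" by (simp only: funpow_Suc_right o_apply)
  then show "fps_nth (fps_expansion (deriv f) c) n = fps_nth (fps_deriv (fps_expansion f c)) n"
    by (simp add: fps_expansion_def field_simps del: funpow.simps of_nat_Suc)
qed

lemma fps_X_power_dvd_iff: "fps_X ^ n dvd (F :: 'a::field fps) \<longleftrightarrow> (\<forall>j<n. fps_nth F j = 0)"
proof
  assume "fps_X ^ n dvd F"
  then show "\<forall>j<n. fps_nth F j = 0" by (auto elim!: dvdE simp: fps_X_power_mult_nth)
next
  assume *: "\<forall>j<n. fps_nth F j = 0"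
  have "F = fps_X ^ n * fps_shift n F"
    by (rule fps_ext) (use * in \<open>simp add: fps_X_power_mult_nth\<close>)
  then show "fps_X ^ n dvd F" by (metis dvd_triv_left)
qed

lemma higher_derivs_0_iff: "(\<forall>j<n. (deriv ^^ j) f c = 0) \<longleftrightarrow> fps_X ^ n dvd fps_expansion f c"
  by (simp add: fps_X_power_dvd_iff fps_expansion_def)

lemma fps_X_power_dvd_deriv: "fps_X ^ n dvd F \<Longrightarrow> fps_X ^ (n - 1) dvd fps_deriv (F :: complex fps)"
  by (auto simp: fps_X_power_dvd_iff)

lemma fps_X_power_dvd_unit_mult:
  assumes "fps_nth U 0 \<noteq> (0::complex)" "fps_X ^ n dvd U * F"
  shows "fps_X ^ n dvd F"
  using assms dvd_mult_unit_iff'[of U "fps_X ^ n" F] by (simp add: dvd_mult_unit_iff' fps_is_unit_iff)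

lemma cpoly_analytic: "cpoly p analytic_on S"
  by (rule analytic_on_subset[of _ UNIV]) (auto simp: analytic_on_open intro!: holomorphic_intros)

abbreviation poly_fps :: "real poly \<Rightarrow> real \<Rightarrow> complex fps" where "poly_fps p c \<equiv> fps_expansion (cpoly p) (of_real c)"

lemma poly_fps_mult: "poly_fps (p * q) c = poly_fps p c * poly_fps q c"
  using fps_expansion_arith(1)[of "cpoly p" "of_real c" "cpoly q", OF cpoly_analytic cpoly_analytic] by simp

lemma poly_fps_lin_factor: "fps_X dvd poly_fps (lin_factor c) c"
  using fps_X_power_dvd_iff[of 1 "poly_fps (lin_factor c) c"] by (simp add: fps_expansion_def lin_factor_def)

lemma poly_fps_dvd_power: "lin_factor c ^ n dvd p \<Longrightarrow> fps_X ^ n dvd poly_fps p c"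
proof -
  assume "lin_factor c ^ n dvd p"
  then obtain g where "p = lin_factor c ^ n * g" by (elim dvdE)
  moreover have "poly_fps (lin_factor c ^ n) c = poly_fps (lin_factor c) c ^ n"
  proof (induction n)
    case 0
    have "cpoly 1 = (\<lambda>_. 1)" by auto
    then show ?case using fps_expansion_unique[of "\<lambda>_. 1" "of_real c" 1] by simp
  qed (simp only: power_Suc poly_fps_mult)
  ultimately show ?thesis using dvd_power_same[OF poly_fps_lin_factor] by (simp only: poly_fps_mult dvd_mult2)
qed

lemma prod_lin_factor_dvd:
  assumes "finite M" "\<And>c. c \<in> M \<Longrightarrow> poly p c = 0"
  shows "(\<Prod>c\<in>M. lin_factor c) dvd (p :: real poly)"
  using assms
proof (induction M rule: finite_induct)
  case (insert c M)
  then obtain g where g: "p = (\<Prod>c\<in>M. lin_factor c) * g" by (auto elim!: dvdE)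
  have "poly (\<Prod>c\<in>M. lin_factor c) c \<noteq> 0" using insert by (auto simp: poly_prod)
  then have "lin_factor c dvd g" using insert.prems[of c] unfolding g by (simp add: lin_factor_dvd_iff)
  then show ?case using insert g by (simp add: mult.commute mult_dvd_mono)
qed simp

text \<open>Of the \<open>card A - 1\<close> gaps between neighbouring points of a nonempty
  \<open>A\<close>, each point of \<open>B\<close> spoils at most two. The function
  \<open>nx\<close> gives the right neighbour.\<close>

lemma gap_count:
  fixes A B :: "real set"
  assumes "finite A" "B \<subseteq> A"
  obtains R nx where "R \<subseteq> A - B" "\<And>x. x \<in> R \<Longrightarrow> nx x \<in> A - B \<and> x < nx x \<and> {x<..<nx x} \<inter> A = {}"
    "card A \<le> card R + 1 + 2 * card B" "\<And>x y. x \<in> R \<Longrightarrow> y \<in> R \<Longrightarrow> x < y \<Longrightarrow> nx x \<le> y"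
proof -
  define nx where "nx x = Min {y\<in>A. x < y}" for x
  define A' where "A' = {x\<in>A. \<exists>y\<in>A. x < y}"
  have nx: "nx x \<in> A" "x < nx x" "\<And>y. y \<in> A \<Longrightarrow> x < y \<Longrightarrow> nx x \<le> y" if "x \<in> A'" for x
  proof -
    have f: "finite {y\<in>A. x < y}" "{y\<in>A. x < y} \<noteq> {}" using assms(1) that by (auto simp: A'_def)
    then have "nx x \<in> {y\<in>A. x < y}" unfolding nx_def by (rule Min_in)
    then show "nx x \<in> A" "x < nx x" by auto
    show "\<And>y. y \<in> A \<Longrightarrow> x < y \<Longrightarrow> nx x \<le> y" unfolding nx_def using f by (auto intro: Min_le)
  qed
  define R where "R = {x\<in>A'. x \<notin> B \<and> nx x \<notin> B}"
  define Q where "Q = {x\<in>A'. nx x \<in> B}"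
  have fin: "finite A'" "finite B" "finite R" "finite Q"
    using assms finite_subset by (auto simp: A'_def R_def Q_def)
  have "inj_on nx A'"
  proof (rule linorder_inj_onI)
    fix x y assume "x < y" "x \<in> A'" "y \<in> A'"
    then have "nx x \<le> y" "y < nx y" using nx by (auto simp: A'_def)
    then show "nx x \<noteq> nx y" by simp
  qed auto
  then have "inj_on nx Q" by (rule inj_on_subset) (auto simp: Q_def)
  then have cQ: "card Q \<le> card B" using fin by (intro card_inj_on_le[of nx]) (auto simp: Q_def)
  have "A' \<subseteq> R \<union> (B \<union> Q)" by (auto simp: R_def Q_def)
  then have cA': "card A' \<le> card R + (card B + card Q)"
    using card_mono[of "R \<union> (B \<union> Q)" A'] card_Un_le[of R "B \<union> Q"] card_Un_le[of B Q] fin by simp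
  have "A \<subseteq> A' \<union> (if A = {} then {} else {Max A})"
    using assms(1) by (auto simp: A'_def not_less[symmetric]) (metis Max_in Max_ge empty_iff leD linorder_neqE_linordered_idom order_less_le)
  then have "card A \<le> card (A' \<union> (if A = {} then {} else {Max A}))" using fin by (intro card_mono) auto
  also have "\<dots> \<le> card A' + 1" using card_Un_le[of A' "if A = {} then {} else {Max A}"] by (auto split: if_splits)
  finally have "card A \<le> card R + 1 + 2 * card B" using cA' cQ by simp
  then show thesis
  proof (rule that[of R nx, rotated 2])
    show "R \<subseteq> A - B" by (auto simp: R_def A'_def)
    show "nx x \<in> A - B \<and> x < nx x \<and> {x<..<nx x} \<inter> A = {}" if "x \<in> R" for x
      using nx[of x] that by (fastforce simp: R_def)
    show "nx x \<le> y" if "x \<in> R" "y \<in> R" "x < y" for x y using nx[of x] that by (auto simp: R_def A'_def)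
  qed
qed

text \<open>With the absolute value the logarithmic derivative is \<open>1 / (2 y)\<close> for
  either sign of \<open>y\<close>, so one formula for the weight serves on every gap.\<close>

lemma sqrt_abs_derivative:
  assumes "y \<noteq> 0"
  shows "((\<lambda>y. sqrt \<bar>y\<bar>) has_real_derivative sqrt \<bar>y\<bar> / (2 * y)) (at y)"
proof (cases "y > 0")
  case True
  have "(sqrt has_real_derivative inverse (sqrt y) / 2) (at y)" using True by (rule DERIV_real_sqrt)
  also have "inverse (sqrt y) / 2 = sqrt \<bar>y\<bar> / (2 * y)" using True by (simp add: field_simps)
  finally show ?thesis
    by (rule has_field_derivative_transform_within_open[of _ _ _ "{0<..}"]) (use True in auto)
next
  case False
  then have y: "- y > 0" using assms by simp
  have "((\<lambda>y. sqrt (- y)) has_real_derivative inverse (sqrt (- y)) / 2 * (- 1)) (at y)"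
    by (rule DERIV_chain2[of sqrt _ "\<lambda>y. - y", OF DERIV_real_sqrt[OF y]]) (auto intro!: derivative_eq_intros)
  also have "inverse (sqrt (- y)) / 2 * (- 1) = sqrt \<bar>y\<bar> / (2 * y)" using y by (simp add: field_simps)
  finally show ?thesis
    by (rule has_field_derivative_transform_within_open[of _ _ _ "{..<0}"]) (use y in auto)
qed

section \<open>From the complex extension to the real axis\<close>

lemma J_series_of_real:
  assumes "\<bar>y\<bar> < 1"
  shows "J_series i (of_real y :: complex) = of_real (J_series i y)"
proof -
  have "(\<lambda>j. of_real (of_real (J_coeff i j) * y ^ j) :: complex) sums of_real (J_series i y)"
    using J_series_sums[of y i] assms by (simp only: sums_of_real_iff) auto
  then show ?thesis using sums_unique2[OF J_series_sums[of "of_real y :: complex" i]] assms by simp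
qed

text \<open>Along the real axis the extension has imaginary part 0, so its derivative is real there
  and equals the real derivative.\<close>

lemma deriv_of_real_extension:
  assumes g: "g holomorphic_on A" "open A" and A: "\<And>x. x \<in> {-1<..<1} \<Longrightarrow> complex_of_real x \<in> A"
    and f: "\<And>x. x \<in> {-1<..<1} \<Longrightarrow> of_real (f x) = g (of_real x)"
    and x: "x \<in> {-1<..<1::real}"
  shows "(f has_real_derivative deriv f x) (at x)" and "of_real (deriv f x) = deriv g (of_real x)"
proof -
  define D where "D = deriv g (of_real x)"
  have "(g has_field_derivative D) (at (of_real x))"
    unfolding D_def using holomorphic_derivI[OF g A[OF x]] .
  then have v: "((\<lambda>t. g (of_real t)) has_vector_derivative D) (at x)" by (rule has_vector_derivative_real_field)
  have "((\<lambda>t. complex_of_real (f t)) has_vector_derivative D) (at x)"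
    by (rule has_vector_derivative_transform_within_open[OF v, of "{-1<..<1}"]) (use x f in auto)
  then have re: "((\<lambda>t. Re (complex_of_real (f t))) has_vector_derivative Re D) (at x)"
    and im: "((\<lambda>t. Im (complex_of_real (f t))) has_vector_derivative Im D) (at x)"
    using bounded_linear.has_vector_derivative[OF bounded_linear_Re] bounded_linear.has_vector_derivative[OF bounded_linear_Im] by blast+
  have fd: "(f has_real_derivative Re D) (at x)" using re by (simp add: has_real_derivative_iff_has_vector_derivative)
  then have df: "deriv f x = Re D" by (rule DERIV_imp_deriv)
  show "(f has_real_derivative deriv f x) (at x)" using fd df by simp
  have "((\<lambda>t. 0::real) has_vector_derivative Im D) (at x)" using im by simp
  then have "Im D = 0" using vector_derivative_unique_at[OF _ has_vector_derivative_const] by blast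
  then show "of_real (deriv f x) = deriv g (of_real x)" unfolding df D_def[symmetric] by (simp add: complex_eq_iff)
qed

lemma higher_deriv_of_real_extension:
  assumes g: "g holomorphic_on A" "open A" and A: "\<And>x. x \<in> {-1<..<1} \<Longrightarrow> complex_of_real x \<in> A"
    and f: "\<And>x. x \<in> {-1<..<1} \<Longrightarrow> of_real (f x) = g (of_real x)"
    and x: "x \<in> {-1<..<1::real}"
  shows "of_real ((deriv ^^ j) f x) = (deriv ^^ j) g (of_real x)"
  using x
proof (induction j arbitrary: x)
  case (Suc j)
  then show ?case
    using deriv_of_real_extension(2)[OF holomorphic_higher_deriv[OF g, of j] g(2) A, of "(deriv ^^ j) f" x] by simp
qed (use f in simp)

text \<open>The bound \<open>poly \<mu> x < 1\<close> is what the convergence of the integral of the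
  third kind yields for a nonnegative \<open>\<mu>\<close> that avoids the value 1.\<close>

locale elliptic_mu =
  fixes \<mu> :: "real poly"
  assumes \<mu>_bounds: "\<And>x. x \<in> {-1<..<1} \<Longrightarrow> 0 \<le> poly \<mu> x \<and> poly \<mu> x < 1"
    and \<mu>_neq: "\<mu> \<noteq> 0" "\<mu> \<noteq> [:0, 1:]^2"
begin

lemma real_in_dom: "x \<in> {-1<..<1} \<Longrightarrow> of_real x \<in> Pi_domain \<mu>"
  using \<mu>_bounds[of x] by (auto simp: Pi_domain_def poly_cr)

lemma comb_ext_of_real:
  assumes x: "x \<in> {-1<..<1}"
  shows "of_real (elliptic_comb p q r \<mu> x) = of_real (pi / 2) * comb_ext p q r \<mu> (of_real x)"
proof -
  have x2: "\<bar>x\<^sup>2\<bar> < 1" using k2[OF x] by simp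
  have m: "0 \<le> poly \<mu> x" "poly \<mu> x < 1" using \<mu>_bounds[OF x] by auto
  have z: "norm ((complex_of_real x)\<^sup>2) < 1" using x2 by (simp add: norm_power)
  have s: "(\<lambda>i. poly \<mu> x ^ i * J_series i (x\<^sup>2)) sums Pi_series (poly \<mu> x) (x\<^sup>2)"
    by (rule Pi_series_sums) (use m x2 in auto)
  have "(\<lambda>i. complex_of_real (poly \<mu> x ^ i * J_series i (x\<^sup>2))) sums of_real (Pi_series (poly \<mu> x) (x\<^sup>2))"
    using s by (simp only: sums_of_real_iff)
  moreover have "(\<lambda>i. cpoly \<mu> (of_real x) ^ i * J_series i ((of_real x)\<^sup>2)) sums Pi_series (cpoly \<mu> (of_real x)) ((complex_of_real x)\<^sup>2)"
    by (rule Pi_series_sums) (use m z in \<open>auto simp: poly_cr\<close>)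
  moreover have "(\<lambda>i. cpoly \<mu> (of_real x) ^ i * J_series i ((complex_of_real x)\<^sup>2)) = (\<lambda>i. of_real (poly \<mu> x ^ i * J_series i (x\<^sup>2)))"
    using J_series_of_real[OF x2] by (simp add: poly_cr)
  ultimately have P: "Pi_series (cpoly \<mu> (of_real x)) ((complex_of_real x)\<^sup>2) = of_real (Pi_series (poly \<mu> x) (x\<^sup>2))"
    using sums_unique2 by metis
  show ?thesis
    unfolding elliptic_comb_def elliptic_K_eq[OF x] elliptic_E_eq[OF x] elliptic_Pi_sums[OF x m s] comb_ext_def P E_series_def
    using J_series_of_real[OF x2] by (simp add: poly_cr algebra_simps)
qed

definition comb_scaled :: "real poly \<Rightarrow> real poly \<Rightarrow> real poly \<Rightarrow> complex \<Rightarrow> complex" where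
  "comb_scaled p q r z = of_real (pi / 2) * comb_ext p q r \<mu> z"

lemma comb_ext_holomorphic: "comb_ext p q r \<mu> holomorphic_on Pi_domain \<mu>"
  using comb_ext_derivative(1)[of _ \<mu> p q r] open_Pi_domain[of \<mu>]
  by (auto simp: holomorphic_on_open)

lemma comb_scaled_holomorphic: "comb_scaled p q r holomorphic_on Pi_domain \<mu>"
  unfolding comb_scaled_def by (intro holomorphic_intros comb_ext_holomorphic)

lemma comb_has_derivative:
  assumes "x \<in> {-1<..<1}"
  shows "(elliptic_comb p q r \<mu> has_real_derivative deriv (elliptic_comb p q r \<mu>) x) (at x)"
    and "of_real (deriv (elliptic_comb p q r \<mu>) x) = of_real (pi / 2) * deriv (comb_ext p q r \<mu>) (of_real x)"
proof -
  show "(elliptic_comb p q r \<mu> has_real_derivative deriv (elliptic_comb p q r \<mu>) x) (at x)"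
    by (rule deriv_of_real_extension(1)[OF comb_scaled_holomorphic open_Pi_domain real_in_dom])
       (use assms comb_ext_of_real in \<open>auto simp: comb_scaled_def\<close>)
  have "of_real (deriv (elliptic_comb p q r \<mu>) x) = deriv (comb_scaled p q r) (of_real x)"
    by (rule deriv_of_real_extension(2)[OF comb_scaled_holomorphic open_Pi_domain real_in_dom])
       (use assms comb_ext_of_real in \<open>auto simp: comb_scaled_def\<close>)
  also have "\<dots> = of_real (pi / 2) * deriv (comb_ext p q r \<mu>) (of_real x)"
    unfolding comb_scaled_def
    by (rule deriv_cmult) (use holomorphic_on_imp_differentiable_at[OF comb_ext_holomorphic open_Pi_domain real_in_dom[OF assms]] in auto)
  finally show "of_real (deriv (elliptic_comb p q r \<mu>) x) = of_real (pi / 2) * deriv (comb_ext p q r \<mu>) (of_real x)" .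
qed

lemma comb_higher_deriv_0:
  assumes "x \<in> {-1<..<1}"
  shows "(deriv ^^ j) (elliptic_comb p q r \<mu>) x = 0 \<longleftrightarrow> (deriv ^^ j) (comb_ext p q r \<mu>) (of_real x) = 0"
proof -
  have "of_real ((deriv ^^ j) (elliptic_comb p q r \<mu>) x) = (deriv ^^ j) (comb_scaled p q r) (of_real x)"
    by (rule higher_deriv_of_real_extension[OF comb_scaled_holomorphic open_Pi_domain real_in_dom])
       (use assms comb_ext_of_real in \<open>auto simp: comb_scaled_def\<close>)
  also have "\<dots> = of_real (pi / 2) * (deriv ^^ j) (comb_ext p q r \<mu>) (of_real x)"
    unfolding comb_scaled_def by (rule higher_deriv_cmult[OF comb_ext_holomorphic real_in_dom[OF assms] open_Pi_domain])
  finally show ?thesis by (metis mult_eq_0_iff of_real_eq_0_iff pi_half_neq_zero)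
qed

lemma double_root:
  assumes c: "c \<in> {-1<..<1}" "poly \<mu> c = 0"
  shows "lin_factor c ^ 2 dvd \<mu>" "lin_factor c dvd pderiv \<mu>"
proof -
  have "poly (pderiv \<mu>) c = 0"
  proof (rule DERIV_local_min[OF poly_DERIV])
    show "0 < min (1 - c) (c + 1)" using c by auto
    show "\<forall>y. \<bar>c - y\<bar> < min (1 - c) (c + 1) \<longrightarrow> poly \<mu> c \<le> poly \<mu> y"
      using \<mu>_bounds c(2) by (auto simp: abs_less_iff)
  qed
  then show d: "lin_factor c dvd pderiv \<mu>" by (simp add: lin_factor_dvd_iff)
  obtain g where g: "\<mu> = lin_factor c * g" using c(2) by (metis lin_factor_dvd_iff dvdE)
  have "poly g c = 0" using \<open>poly (pderiv \<mu>) c = 0\<close> unfolding g by (simp add: pderiv_mult)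
  then have "lin_factor c dvd g" by (simp add: lin_factor_dvd_iff)
  then show "lin_factor c ^ 2 dvd \<mu>" unfolding g power2_eq_square by (rule mult_dvd_mono[OF dvd_refl])
qed

text \<open>Each end point is a zero of the combination or of \<open>\<mu> - k\<^sup>2\<close>, and
  in both cases the weighted function \<open>F\<close> is 0 there. At a zero of
  \<open>\<mu> - k\<^sup>2\<close> the square root may fail to be differentiable, so these zeros can
  be end points of a gap but must not lie inside it.\<close>

lemma rolle_gap:
  assumes ab: "-1 < a" "a < b" "b < 1"
    and r: "\<And>x. a \<le> x \<Longrightarrow> x \<le> b \<Longrightarrow> poly r x \<noteq> 0" and m: "\<And>x. a \<le> x \<Longrightarrow> x \<le> b \<Longrightarrow> poly \<mu> x \<noteq> 0"
    and v: "\<And>x. a < x \<Longrightarrow> x < b \<Longrightarrow> poly \<mu> x \<noteq> x\<^sup>2"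
    and ends: "\<And>x. x \<in> {a, b} \<Longrightarrow> elliptic_comb p q r \<mu> x = 0 \<or> poly \<mu> x = x\<^sup>2"
  shows "\<exists>\<xi>. a < \<xi> \<and> \<xi> < b \<and> comb_reduced p q r \<mu> (of_real \<xi>) = 0"
proof -
  define Z where "Z = (1 - \<mu>) * (\<mu> - [:0, 1:]^2)"
  define f where "f = elliptic_comb p q r \<mu>"
  define \<omega> where "\<omega> x = poly Z x / poly \<mu> x" for x
  define F where "F x = f x * sqrt \<bar>\<omega> x\<bar> / poly r x" for x
  have inI: "x \<in> {-1<..<1}" if "a \<le> x" "x \<le> b" for x using that ab by auto
  have fd: "(f has_real_derivative deriv f x) (at x)" if "a \<le> x" "x \<le> b" for x
    unfolding f_def by (rule comb_has_derivative(1)[OF inI[OF that]])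
  have cont: "continuous_on {a..b} F"
    unfolding F_def \<omega>_def
  proof (intro continuous_intros)
    show "continuous_on {a..b} f"
      using fd by (intro continuous_at_imp_continuous_on ballI DERIV_isCont) auto
  qed (use r m in auto)
  have Z0: "poly Z x \<noteq> 0" if "a < x" "x < b" for x
    using v[OF that] \<mu>_bounds[of x] that ab by (auto simp: Z_def power2_eq_square)
  have Fd: "(F has_real_derivative ((deriv f x * sqrt \<bar>\<omega> x\<bar> + (sqrt \<bar>\<omega> x\<bar> / (2 * \<omega> x) * ((poly (pderiv Z) x * poly \<mu> x - poly Z x * poly (pderiv \<mu>) x) / (poly \<mu> x * poly \<mu> x))) * f x) * poly r x
       - f x * sqrt \<bar>\<omega> x\<bar> * poly (pderiv r) x) / (poly r x * poly r x)) (at x)" if x: "a < x" "x < b" for x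
  proof -
    have "\<omega> x \<noteq> 0" using Z0[OF x] m[of x] x by (simp add: \<omega>_def)
    have "(\<omega> has_real_derivative (poly (pderiv Z) x * poly \<mu> x - poly Z x * poly (pderiv \<mu>) x) / (poly \<mu> x * poly \<mu> x)) (at x)"
      unfolding \<omega>_def by (intro DERIV_divide poly_DERIV) (use m x in auto)
    from DERIV_chain2[OF sqrt_abs_derivative[OF \<open>\<omega> x \<noteq> 0\<close>] this]
    have w: "((\<lambda>x. sqrt \<bar>\<omega> x\<bar>) has_real_derivative sqrt \<bar>\<omega> x\<bar> / (2 * \<omega> x) * ((poly (pderiv Z) x * poly \<mu> x - poly Z x * poly (pderiv \<mu>) x) / (poly \<mu> x * poly \<mu> x))) (at x)" .
    show ?thesis unfolding F_def
      by (intro DERIV_divide DERIV_mult fd w poly_DERIV) (use r x in auto)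
  qed
  have F0: "F x = 0" if "x \<in> {a, b}" for x
    using ends[OF that] by (auto simp: F_def f_def \<omega>_def Z_def power2_eq_square)
  have "\<exists>\<xi>. a < \<xi> \<and> \<xi> < b \<and> DERIV F \<xi> :> 0"
    using F0 Fd by (intro Rolle[OF ab(2) _ cont]) (auto simp: real_differentiable_def)
  then obtain \<xi> where \<xi>: "a < \<xi>" "\<xi> < b" "DERIV F \<xi> :> 0" by blast
  have nz: "poly r \<xi> \<noteq> 0" "poly \<mu> \<xi> \<noteq> 0" "poly Z \<xi> \<noteq> 0" using r m Z0 \<xi> by auto
  define s where "s = sqrt \<bar>\<omega> \<xi>\<bar>"
  have s: "s \<noteq> 0" using nz by (simp add: s_def \<omega>_def)
  have eq: "((deriv f \<xi> * s + (s / (2 * \<omega> \<xi>) * ((poly (pderiv Z) \<xi> * poly \<mu> \<xi> - poly Z \<xi> * poly (pderiv \<mu>) \<xi>) / (poly \<mu> \<xi> * poly \<mu> \<xi>))) * f \<xi>) * poly r \<xi>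
       - f \<xi> * s * poly (pderiv r) \<xi>) / (poly r \<xi> * poly r \<xi>) = 0"
    using DERIV_unique[OF Fd[OF \<xi>(1,2)] \<xi>(3)] unfolding s_def .
  have e: "2 * (poly \<mu> \<xi> * poly Z \<xi>) * (poly r \<xi> * deriv f \<xi> - poly (pderiv r) \<xi> * f \<xi>)
      + poly r \<xi> * (poly \<mu> \<xi> * poly (pderiv Z) \<xi> - poly (pderiv \<mu>) \<xi> * poly Z \<xi>) * f \<xi> = 0"
    (is "?e = 0")
  proof -
    have "(s * poly \<mu> \<xi>) * ?e = 0"
      using eq nz s unfolding \<omega>_def by (simp add: field_simps)
    then show ?thesis using nz s by simp
  qed
  let ?x = "complex_of_real \<xi>"
  have x: "\<xi> \<in> {-1<..<1}" using \<xi> ab by auto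
  have "of_real (pi / 2) * comb_reduced p q r \<mu> ?x = of_real (2 * (poly \<mu> \<xi> * poly Z \<xi>) * (poly r \<xi> * deriv f \<xi> - poly (pderiv r) \<xi> * f \<xi>)
      + poly r \<xi> * (poly \<mu> \<xi> * poly (pderiv Z) \<xi> - poly (pderiv \<mu>) \<xi> * poly Z \<xi>) * f \<xi>)"
    unfolding comb_reduced_def weight_poly_eq[OF Z_def] f_def of_real_add of_real_mult of_real_diff
      comb_has_derivative(2)[OF x] comb_ext_of_real[OF x]
    by (simp add: poly_cr[symmetric]) (simp add: algebra_simps)
  then show ?thesis unfolding e using \<xi> by (intro exI[of _ \<xi>]) auto
qed

end

text \<open>Differentiation loses one order, so the coefficient of the derivative carries one factor
  more than that of \<open>F\<close>.\<close>

lemma fps_X_power_dvd_combination: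
  assumes "fps_X ^ Suc i dvd A" "fps_X ^ i dvd B" "fps_X ^ n dvd (F :: complex fps)"
  shows "fps_X ^ (n + i) dvd A * fps_deriv F + B * F"
proof (rule dvd_add)
  have "fps_X ^ (Suc i + (n - 1)) dvd A * fps_deriv F"
    unfolding power_add by (intro mult_dvd_mono assms fps_X_power_dvd_deriv)
  then show "fps_X ^ (n + i) dvd A * fps_deriv F"
    by (rule dvd_trans[OF le_imp_power_dvd, rotated]) simp
  have "fps_X ^ (i + n) dvd B * F"
    unfolding power_add by (intro mult_dvd_mono assms)
  then show "fps_X ^ (n + i) dvd B * F" by (simp add: add.commute)
qed

lemma poly_fps_lin_factor_eq: "poly_fps (lin_factor c) c = fps_X"
proof (rule fps_expansion_unique)
  have "(\<lambda>x. cpoly (lin_factor c) (of_real c + x)) = (\<lambda>x. x)" by (auto simp: lin_factor_def)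
  then show "(\<lambda>x. cpoly (lin_factor c) (of_real c + x)) has_fps_expansion fps_X"
    by (simp add: has_fps_expansion_fps_X)
qed

lemma poly_fps_nth_0: "fps_nth (poly_fps p c) 0 = of_real (poly p c)"
  by (simp add: fps_expansion_def poly_cr)

lemma fps_expansion_cpoly_mult:
  assumes "f analytic_on {of_real c}"
  shows "fps_expansion (\<lambda>z. cpoly p z * f z) (of_real c) = poly_fps p c * fps_expansion f (of_real c)"
  by (rule fps_expansion_arith(1)[OF cpoly_analytic assms])

lemma two_term_common_factor: "two_term (h * P) (h * Q) z = cpoly h z * two_term P Q z"
  by (simp add: two_term_def algebra_simps)

lemma two_term_analytic: "c \<in> {-1<..<1} \<Longrightarrow> two_term P Q analytic_on {of_real c}"
  unfolding analytic_at by (rule exI[of _ "ball 0 1"]) (use two_term_holomorphic in auto)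

context elliptic_mu
begin

lemma poly_\<mu>_0: "poly \<mu> 0 \<ge> 0" "poly \<mu> 0 \<noteq> 1" "poly \<mu> 0 = 0 \<Longrightarrow> poly (pderiv \<mu>) 0 = 0"
  using \<mu>_bounds[of 0] double_root(2)[of 0] by (auto simp: lin_factor_dvd_iff)

lemma coefs_neq_0: "r \<noteq> 0 \<Longrightarrow> reduced_K p q r \<mu> \<noteq> 0 \<or> reduced_E p q r \<mu> \<noteq> 0"
  using reduced_coefs_eq_0_imp[of p q r \<mu>] \<mu>_neq poly_\<mu>_0 by auto

lemma comb_ext_analytic: "c \<in> {-1<..<1} \<Longrightarrow> comb_ext p q r \<mu> analytic_on {of_real c}"
  unfolding analytic_at by (rule exI[of _ "Pi_domain \<mu>"]) (use comb_ext_holomorphic open_Pi_domain real_in_dom in auto)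

lemma two_term_expansion:
  fixes p q r :: "real poly"
  assumes c: "c \<in> {-1<..<1}"
  defines "F \<equiv> fps_expansion (comb_ext p q r \<mu>) (of_real c)"
  shows "fps_expansion (two_term (reduced_K p q r \<mu>) (reduced_E p q r \<mu>)) (of_real c)
     = poly_fps ([:0, 1:] * (1 - [:0, 1:]^2)) c * (poly_fps (2 * sing_poly \<mu> * r) c * fps_deriv F + poly_fps (r * weight_poly \<mu> - 2 * sing_poly \<mu> * pderiv r) c * F)"
proof -
  let ?f = "comb_ext p q r \<mu>" and ?c = "complex_of_real c"
  define g where "g z = cpoly (2 * sing_poly \<mu> * r) z * deriv ?f z + cpoly (r * weight_poly \<mu> - 2 * sing_poly \<mu> * pderiv r) z * ?f z" for z
  have an: "?f analytic_on {?c}" "deriv ?f analytic_on {?c}"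
    using comb_ext_analytic[OF c, of p q r] by (auto intro: analytic_intros)
  have ev: "eventually (\<lambda>z. z \<in> Pi_domain \<mu>) (nhds ?c)"
    using open_Pi_domain real_in_dom[OF c] by (rule eventually_nhds_in_open)
  have tw: "cpoly 2 z = 2" for z by (metis cpoly_simps(1,4) one_add_one)
  have "eventually (\<lambda>z. two_term (reduced_K p q r \<mu>) (reduced_E p q r \<mu>) z = cpoly ([:0, 1:] * (1 - [:0, 1:]^2)) z * g z) (nhds ?c)"
    by (rule eventually_mono[OF ev])
       (simp add: comb_ext_derivative(2)[symmetric] comb_reduced_def g_def tw power2_eq_square algebra_simps)
  then have "fps_expansion (two_term (reduced_K p q r \<mu>) (reduced_E p q r \<mu>)) ?c
      = fps_expansion (\<lambda>z. cpoly ([:0, 1:] * (1 - [:0, 1:]^2)) z * g z) ?c"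
    unfolding fps_expansion_def by (intro arg_cong[of _ _ Abs_fps] ext) (simp add: higher_deriv_cong_ev)
  also have "\<dots> = poly_fps ([:0, 1:] * (1 - [:0, 1:]^2)) c * fps_expansion g ?c"
    by (rule fps_expansion_cpoly_mult) (unfold g_def, intro analytic_intros an cpoly_analytic)
  also have "fps_expansion g ?c = fps_expansion (\<lambda>z. cpoly (2 * sing_poly \<mu> * r) z * deriv ?f z) ?c
      + fps_expansion (\<lambda>z. cpoly (r * weight_poly \<mu> - 2 * sing_poly \<mu> * pderiv r) z * ?f z) ?c"
    unfolding g_def by (intro fps_expansion_arith(2) analytic_intros an cpoly_analytic)
  also have "\<dots> = poly_fps (2 * sing_poly \<mu> * r) c * fps_deriv F + poly_fps (r * weight_poly \<mu> - 2 * sing_poly \<mu> * pderiv r) c * F"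
    unfolding F_def by (simp only: fps_expansion_cpoly_mult[OF an(1)] fps_expansion_cpoly_mult[OF an(2)] fps_expansion_deriv[OF an(1)])
  finally show ?thesis .
qed

text \<open>In general the derivative costs one order. At a zero of \<open>r\<close> the coefficient
  \<open>2 Y r\<close> makes up for it. At a zero of \<open>\<mu>\<close>, where \<open>Y\<close>
  vanishes at least doubly and \<open>T\<close> at least simply, one order is gained; it is spent
  later on a common factor of the two coefficients.\<close>

lemma two_term_order:
  fixes p q r :: "real poly"
  assumes c: "c \<in> {-1<..<1}" and n: "\<And>j. j < n \<Longrightarrow> (deriv ^^ j) (comb_ext p q r \<mu>) (of_real c) = 0"
  defines "G \<equiv> fps_expansion (two_term (reduced_K p q r \<mu>) (reduced_E p q r \<mu>)) (of_real c)"
  shows "fps_X ^ (n - 1) dvd G" "poly r c = 0 \<Longrightarrow> fps_X ^ n dvd G" "poly \<mu> c = 0 \<Longrightarrow> fps_X ^ Suc n dvd G"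
proof -
  have F: "fps_X ^ n dvd fps_expansion (comb_ext p q r \<mu>) (of_real c)"
    using n higher_derivs_0_iff by blast
  note G = G_def[unfolded two_term_expansion[OF c, of p q r]]
  show "fps_X ^ (n - 1) dvd G"
    unfolding G by (intro dvd_mult dvd_add fps_X_power_dvd_deriv F dvd_trans[OF le_imp_power_dvd F]) simp
  show "fps_X ^ n dvd G" if "poly r c = 0"
  proof -
    have "fps_X ^ Suc 0 dvd poly_fps (2 * sing_poly \<mu> * r) c"
      by (rule poly_fps_dvd_power) (use that in \<open>simp add: lin_factor_dvd_iff\<close>)
    from fps_X_power_dvd_combination[OF this _ F, of "poly_fps (r * weight_poly \<mu> - 2 * sing_poly \<mu> * pderiv r) c"]
    show ?thesis unfolding G by (intro dvd_mult) (simp del: cpoly_simps)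
  qed
  show "fps_X ^ Suc n dvd G" if "poly \<mu> c = 0"
  proof -
    have "fps_X ^ Suc 1 dvd poly_fps (2 * sing_poly \<mu> * r) c"
      by (rule poly_fps_dvd_power) (use double_root(1)[OF c that] in \<open>simp add: sing_poly_def numeral_2_eq_2 dvd_mult dvd_mult2 del: power_Suc\<close>)
    moreover have "fps_X ^ 1 dvd poly_fps (r * weight_poly \<mu> - 2 * sing_poly \<mu> * pderiv r) c"
      by (rule poly_fps_dvd_power) (use that double_root(2)[OF c that] in
        \<open>auto simp: weight_poly_def sing_poly_def lin_factor_dvd_iff\<close>)
    ultimately have "fps_X ^ (n + 1) dvd poly_fps (2 * sing_poly \<mu> * r) c * fps_deriv (fps_expansion (comb_ext p q r \<mu>) (of_real c))
        + poly_fps (r * weight_poly \<mu> - 2 * sing_poly \<mu> * pderiv r) c * fps_expansion (comb_ext p q r \<mu>) (of_real c)"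
      by (rule fps_X_power_dvd_combination[OF _ _ F])
    then show ?thesis unfolding G by (intro dvd_mult) (simp del: cpoly_simps)
  qed
qed

text \<open>A zero loses at most one order, and each usable gap returns one through Rolle's theorem.
  Zeros of \<open>r\<close> and \<open>\<mu>\<close> spoil two gaps each but lose no order
  themselves, so the net cost of each is 1. For the zeros of \<open>r\<close> this is paid by
  \<open>degree r\<close>, for those of \<open>\<mu>\<close> by the degree saved on division by
  \<open>h\<close>.\<close>

theorem multiplicities_le:
  assumes r: "r \<noteq> 0" and C: "finite C" "C \<subseteq> {-1<..<1}"
    and a: "\<And>c. c \<in> C \<Longrightarrow> a c > 0"
      "\<And>c j. c \<in> C \<Longrightarrow> j < a c \<Longrightarrow> (deriv ^^ j) (elliptic_comb p q r \<mu>) c = 0"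
  shows "(\<Sum>c\<in>C. a c) \<le> degree (reduced_K p q r \<mu>) + degree (reduced_E p q r \<mu>) + degree r + 3"
proof -
  define S where "S = {x. poly r x = 0} \<inter> {-1<..<1}"
  define M where "M = {x. poly \<mu> x = 0} \<inter> {-1<..<1}"
  define V where "V = {x. poly (\<mu> - [:0, 1:]^2) x = 0} \<inter> {-1<..<1}"
  have fin: "finite S" "finite M" "finite V"
    unfolding S_def M_def V_def by (intro finite_Int disjI1 poly_roots_finite; use r \<mu>_neq in simp)+
  have cS: "card S \<le> degree r"
    unfolding S_def using card_poly_roots_bound[OF r] card_mono[OF poly_roots_finite[OF r], of "{x. poly r x = 0} \<inter> {-1<..<1}"] by simp
  define h where "h = (\<Prod>c\<in>M. lin_factor c)"
  have ph: "poly h x = 0 \<longleftrightarrow> x \<in> M" for x unfolding h_def using fin by (auto simp: poly_prod)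
  have h0: "h \<noteq> 0" and dh: "degree h = card M" unfolding h_def using fin
    by (simp_all add: degree_prod_eq_sum_degree lin_factor_def)
  have rM: "poly \<mu> c = 0" "poly (pderiv \<mu>) c = 0" if "c \<in> M" for c
    using that double_root(2)[of c] by (auto simp: M_def lin_factor_dvd_iff)
  have "h dvd reduced_K p q r \<mu>" "h dvd reduced_E p q r \<mu>"
    unfolding h_def using rM by (auto intro!: prod_lin_factor_dvd fin simp: reduced_K_def reduced_E_def sing_poly_def weight_poly_def)
  then obtain P Q where PQ: "reduced_K p q r \<mu> = h * P" "reduced_E p q r \<mu> = h * Q" by (auto elim!: dvdE)
  have nz: "P \<noteq> 0 \<or> Q \<noteq> 0" using coefs_neq_0[OF r, of p q] unfolding PQ by auto
  \<comment> \<open>One of \<open>P\<close> and \<open>Q\<close> may be 0, so only one copy of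
    \<open>card M\<close> is certain to be saved.\<close>
  have degs: "degree P + degree Q + card M \<le> degree (reduced_K p q r \<mu>) + degree (reduced_E p q r \<mu>)"
    unfolding PQ dh[symmetric] using nz h0 by (cases "P = 0"; cases "Q = 0") (simp_all add: degree_mult_eq)

  \<comment> \<open>The zeros of \<open>\<mu> - k\<^sup>2\<close> are included because the weight
    vanishes there: they are further end points for Rolle's theorem and are thereby kept out of the
    interior of the gaps.\<close>
  define A where "A = C \<union> V \<union> S \<union> M"
  define B where "B = S \<union> M"
  define a' where "a' c = (if c \<in> C then a c else 0)" for c
  have finA: "finite A" "finite B" "B \<subseteq> A" using fin C by (auto simp: A_def B_def)
  have A1: "A \<subseteq> {-1<..<1}" using C by (auto simp: A_def V_def S_def M_def)
  obtain R nx where R: "R \<subseteq> A - B" and nx: "\<And>x. x \<in> R \<Longrightarrow> nx x \<in> A - B \<and> x < nx x \<and> {x<..<nx x} \<inter> A = {}"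
    and cR: "card A \<le> card R + 1 + 2 * card B" and mono: "\<And>x y. x \<in> R \<Longrightarrow> y \<in> R \<Longrightarrow> x < y \<Longrightarrow> nx x \<le> y"
    proof (rule gap_count[OF finA(1,3)], goal_cases)
    case prems: (1 R nx)
    show ?case by (rule prems(1)[OF prems(2-5)])
  qed
  have "\<exists>\<xi>. x < \<xi> \<and> \<xi> < nx x \<and> comb_reduced p q r \<mu> (of_real \<xi>) = 0" if x: "x \<in> R" for x
  proof -
    have i: "x \<in> {-1<..<1}" "nx x \<in> {-1<..<1}" using R nx[OF x] A1 x by auto
    have nB: "y \<in> {-1<..<1}" "y \<notin> B" "y \<in> {x<..<nx x} \<Longrightarrow> y \<notin> A" if "x \<le> y" "y \<le> nx x" for y
    proof -
      show "y \<in> {-1<..<1}" using that i by auto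
      show "y \<in> {x<..<nx x} \<Longrightarrow> y \<notin> A" using nx[OF x] by auto
      then show "y \<notin> B" using that R nx[OF x] x finA(3) by (cases "y = x \<or> y = nx x") auto
    qed
    show ?thesis
    proof (rule rolle_gap)
      show "-1 < x" "x < nx x" "nx x < 1" using i nx[OF x] by auto
      show "poly r y \<noteq> 0" "poly \<mu> y \<noteq> 0" if "x \<le> y" "y \<le> nx x" for y
        using nB(1,2)[OF that] by (auto simp: B_def S_def M_def)
      show "poly \<mu> y \<noteq> y\<^sup>2" if "x < y" "y < nx x" for y
        using nB(1,3)[of y] that by (auto simp: A_def V_def power2_eq_square)
      fix y assume "y \<in> {x, nx x}"
      then have "y \<in> A - B" using R nx[OF x] x by auto
      then have "y \<in> C \<or> y \<in> V" by (auto simp: A_def B_def)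
      then show "elliptic_comb p q r \<mu> y = 0 \<or> poly \<mu> y = y\<^sup>2"
        using a(2)[of y 0] a(1)[of y] by (auto simp: V_def power2_eq_square)
    qed
  qed
  then obtain \<xi> where \<xi>: "\<And>x. x \<in> R \<Longrightarrow> x < \<xi> x \<and> \<xi> x < nx x \<and> comb_reduced p q r \<mu> (of_real (\<xi> x)) = 0" by metis
  have \<xi>A: "\<xi> x \<notin> A" "\<xi> x \<in> {-1<..<1}" if "x \<in> R" for x
    using \<xi>[OF that] nx[OF that] R that A1 by fastforce+
  have inj: "inj_on \<xi> R"
  proof (rule linorder_inj_onI)
    fix x y assume "x < y" "x \<in> R" "y \<in> R"
    then have "\<xi> x < nx x" "nx x \<le> y" "y < \<xi> y" using \<xi> mono by auto
    then show "\<xi> x \<noteq> \<xi> y" by simp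
  qed auto
  have finR: "finite R" using R finA finite_subset by blast

  \<comment> \<open>The orders guaranteed for \<open>P K + Q E\<close>: the full order at zeros of
    \<open>r\<close> and \<open>\<mu>\<close>, one less at the other points of \<open>A\<close>, and
    1 at the points from Rolle's theorem. At a point of \<open>V\<close> outside \<open>C\<close>
    and \<open>B\<close> the truncated subtraction gives 0.\<close>
  define b where "b c = (if c \<in> B then a' c else if c \<in> A then a' c - 1 else 1)" for c
  have vanish: "(deriv ^^ j) (two_term P Q) (of_real c) = 0" if c: "c \<in> A \<union> \<xi> ` R" and j: "j < b c" for c j
  proof (cases "c \<in> A")
    case True
    then have c1: "c \<in> {-1<..<1}" using A1 by auto
    have n: "(deriv ^^ j) (comb_ext p q r \<mu>) (of_real c) = 0" if "j < a' c" for j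
      using that a(2)[of c j] comb_higher_deriv_0[OF c1, of j p q r] by (simp add: a'_def split: if_splits)
    note o = two_term_order[OF c1 n, simplified PQ]
    have e: "fps_expansion (two_term (h * P) (h * Q)) (of_real c) = poly_fps h c * fps_expansion (two_term P Q) (of_real c)"
      using fps_expansion_cpoly_mult[OF two_term_analytic[OF c1], of h P Q] by (simp add: two_term_common_factor[abs_def])
    have "fps_X ^ b c dvd fps_expansion (two_term P Q) (of_real c)"
    proof (cases "c \<in> M")
      case M: True
      define h' where "h' = (\<Prod>c\<in>M - {c}. lin_factor c)"
      have hh: "h = lin_factor c * h'" unfolding h_def h'_def by (rule prod.remove[OF fin(2) M])
      have "poly h' c \<noteq> 0" unfolding h'_def using fin by (auto simp: poly_prod)
      have "fps_X ^ Suc (a' c) dvd fps_X * (poly_fps h' c * fps_expansion (two_term P Q) (of_real c))"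
        using o(3) rM(1)[OF M] unfolding e by (simp only: hh poly_fps_mult poly_fps_lin_factor_eq mult.assoc)
      then have "fps_X ^ a' c dvd poly_fps h' c * fps_expansion (two_term P Q) (of_real c)" by simp
      then have "fps_X ^ a' c dvd fps_expansion (two_term P Q) (of_real c)"
        by (rule fps_X_power_dvd_unit_mult[rotated]) (use \<open>poly h' c \<noteq> 0\<close> in \<open>simp add: poly_fps_nth_0\<close>)
      then show ?thesis using M by (simp add: b_def B_def)
    next
      case M: False
      have "fps_X ^ b c dvd poly_fps h c * fps_expansion (two_term P Q) (of_real c)"
        using o(1,2) M True unfolding e by (auto simp: b_def B_def S_def)
      then show ?thesis
        by (rule fps_X_power_dvd_unit_mult[rotated]) (use ph M in \<open>simp add: poly_fps_nth_0\<close>)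
    qed
    then show ?thesis using j unfolding higher_derivs_0_iff[symmetric] by blast
  next
    case False
    then obtain x where x: "x \<in> R" "c = \<xi> x" using c by auto
    have c1: "c \<in> {-1<..<1}" "c \<notin> M" using \<xi>A[OF x(1)] x(2) by (auto simp: A_def)
    have "c \<notin> B" using False finA(3) by auto
    then have "j = 0" using j False by (simp add: b_def)
    have "two_term (h * P) (h * Q) (of_real c) = 0"
      using comb_ext_derivative(2)[OF real_in_dom[OF c1(1)], of p q r] \<xi>[OF x(1)] x(2) unfolding PQ by simp
    then have "two_term P Q (of_real c) = 0" unfolding two_term_common_factor using ph c1(2) by (simp add: poly_cr)
    then show ?thesis using \<open>j = 0\<close> by simp
  qed
  have bound: "(\<Sum>c\<in>A \<union> \<xi> ` R. b c) \<le> degree P + degree Q + 2"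
    by (rule two_term_multiplicities[OF nz]) (use finA finR A1 \<xi>A(2) vanish in auto)
  have "(\<Sum>c\<in>A \<union> \<xi> ` R. b c) = (\<Sum>c\<in>A. b c) + (\<Sum>c\<in>\<xi> ` R. b c)"
    by (rule sum.union_disjoint) (use finA finR \<xi>A(1) in auto)
  also have "(\<Sum>c\<in>\<xi> ` R. b c) = (\<Sum>c\<in>\<xi> ` R. 1)"
    by (rule sum.cong) (use \<xi>A(1) finA(3) in \<open>auto simp: b_def\<close>)
  also have "\<dots> = card R" using inj by (simp add: card_image)
  finally have b1: "(\<Sum>c\<in>A. b c) + card R \<le> degree P + degree Q + 2" using bound by simp
  have "(\<Sum>c\<in>C. a c) = (\<Sum>c\<in>A. a' c)"
    by (rule sum.mono_neutral_cong_left) (use finA in \<open>auto simp: a'_def A_def\<close>)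
  also have "\<dots> \<le> (\<Sum>c\<in>A. b c + (if c \<in> B then 0 else 1))"
    by (rule sum_mono) (auto simp: b_def)
  also have "\<dots> = (\<Sum>c\<in>A. b c) + card (A - B)"
    using finA by (simp add: sum.distrib sum.If_cases Diff_eq)
  finally have "(\<Sum>c\<in>C. a c) \<le> (\<Sum>c\<in>A. b c) + card (A - B)" .
  moreover have "card (A - B) = card A - card B" "card B \<le> card A"
    using finA by (auto intro: card_Diff_subset card_mono)
  moreover have "card B \<le> card S + card M" unfolding B_def by (rule card_Un_le)
  \<comment> \<open>\<open>card (A - B)\<close> is at most \<open>card R + 1 + card B\<close>. The
    term \<open>card R\<close> is absorbed by \<open>b1\<close>, and \<open>card B\<close> splits
    into \<open>card S \<le> degree r\<close> and \<open>card M\<close>.\<close>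
  ultimately show ?thesis using b1 cR cS degs by linarith
qed

end

section \<open>The upper bound\<close>

lemma degree_mult_leI: "degree p \<le> a \<Longrightarrow> degree q \<le> b \<Longrightarrow> a + b \<le> n \<Longrightarrow> degree (p * q :: real poly) \<le> n"
  using degree_mult_le'[of p a q b] by linarith

text \<open>Each derivative is kept together with a factor \<open>k\<close>, since their product
  does not raise the degree. For constant \<open>\<mu>\<close> the last term of
  \<open>reduced_K\<close> vanishes with the derivative of \<open>\<mu>\<close>, whence the case
  \<open>s = 0\<close>.\<close>

lemma coef_degree_bounds:
  fixes p q r \<mu> :: "real poly"
  defines "N \<equiv> max (degree p) (degree q)" and "l \<equiv> degree r" and "s \<equiv> degree \<mu>"
  shows "degree (reduced_K p q r \<mu>) \<le> max (N + l + 2 * s + max 2 s + 2) (if s = 0 then 0 else 2 * l + s + max 2 s + 2)" (is "_ \<le> ?MK")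
    and "degree (reduced_E p q r \<mu>) \<le> max (N + l + 2 * s + max 2 s + 2) (2 * l + 2 * s + 2)" (is "_ \<le> ?ME")
proof -
  let ?X = "[:0, 1:] :: real poly"
  define y where "y = 2 * s + max 2 s"
  define Z where "Z = (1 - \<mu>) * (\<mu> - ?X^2)"
  have dX: "degree ?X \<le> 1" and d1: "degree (1 - ?X^2) \<le> 2" by (simp_all only: degree_1_minus_X2) simp_all
  have dm: "degree (1 - \<mu>) \<le> s" and dmX: "degree (\<mu> - ?X^2) \<le> max 2 s" "degree (?X^2 - \<mu>) \<le> max 2 s"
    unfolding s_def by (auto intro!: degree_diff_le simp: degree_power_eq)
  have dZ: "degree Z \<le> s + max 2 s" unfolding Z_def by (rule degree_mult_le'[OF dm dmX(1)])
  have dY: "degree (sing_poly \<mu>) \<le> y" unfolding sing_poly_def Z_def[symmetric] by (rule degree_mult_leI[OF _ dZ]) (auto simp: s_def y_def)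
  have dXm: "degree (?X * pderiv \<mu>) \<le> s" unfolding s_def by (rule degree_X_pderiv)
  have dT: "degree (?X * weight_poly \<mu>) \<le> y"
  proof -
    have "?X * weight_poly \<mu> = \<mu> * (?X * pderiv Z) - (?X * pderiv \<mu>) * Z"
      unfolding weight_poly_eq[OF Z_def] by (simp only: right_diff_distrib mult_ac)
    also have "degree \<dots> \<le> y"
      by (intro degree_diff_le degree_mult_leI[OF _ order.trans[OF degree_X_pderiv dZ]] degree_mult_leI[OF dXm dZ])
         (auto simp: s_def y_def)
    finally show ?thesis .
  qed
  have main: "degree (2 * sing_poly \<mu> * (r * (?X * pderiv f) - (?X * pderiv r) * f) + r * f * (?X * weight_poly \<mu>)) \<le> N + l + y"
    if f: "degree f \<le> N" for f
  proof (rule degree_add_le)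
    have rf: "degree (r * (?X * pderiv f) - (?X * pderiv r) * f) \<le> l + N"
      by (intro degree_diff_le degree_mult_leI[of r l _ N] degree_mult_leI[of _ l f N])
         (use degree_X_pderiv[of f] degree_X_pderiv[of r] f in \<open>auto simp: l_def\<close>)
    have "degree (2 * sing_poly \<mu>) \<le> y" using two_poly(1)[of "sing_poly \<mu>"] dY by linarith
    then show "degree (2 * sing_poly \<mu> * (r * (?X * pderiv f) - (?X * pderiv r) * f)) \<le> N + l + y"
      by (rule degree_mult_leI[OF _ rf]) simp
    show "degree (r * f * (?X * weight_poly \<mu>)) \<le> N + l + y"
      by (rule degree_mult_leI[OF degree_mult_le' dT]) (use f in \<open>auto simp: l_def\<close>)
  qed
  have side: "degree (2 * r * sing_poly \<mu> * f) \<le> N + l + y" if f: "degree f \<le> N" for f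
    using two_poly(1)[of r] dY f by (intro degree_mult_leI[OF degree_mult_le'[of _ l]]) (auto simp: l_def)
  have dpq: "degree p \<le> N" "degree q \<le> N" "degree (p + q) \<le> N"
    unfolding N_def by (auto intro: degree_add_le)
  have dr: "degree (r^2) \<le> 2 * l" unfolding power2_eq_square mult_2 by (rule degree_mult_le') (auto simp: l_def)
  have K: "reduced_K p q r \<mu> = (1 - ?X^2) * ((2 * sing_poly \<mu> * (r * (?X * pderiv p) - (?X * pderiv r) * p) + r * p * (?X * weight_poly \<mu>))
      - 2 * r * sing_poly \<mu> * (p + q) + r^2 * (?X * pderiv \<mu>) * (?X^2 - \<mu>))"
    unfolding reduced_K_def by (simp only: algebra_simps)
  have third: "degree (r^2 * (?X * pderiv \<mu>) * (?X^2 - \<mu>)) \<le> (if s = 0 then 0 else 2 * l + s + max 2 s)"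
  proof (cases "s = 0")
    case True
    then have "pderiv \<mu> = 0" by (simp add: s_def pderiv_eq_0_iff)
    then show ?thesis by simp
  next
    case False
    then show ?thesis using degree_mult_le'[OF degree_mult_le'[OF dr dXm] dmX(2)] by (simp only: if_False)
  qed
  show "degree (reduced_K p q r \<mu>) \<le> ?MK"
    unfolding K
  proof (rule degree_mult_leI[OF d1])
    show "degree ((2 * sing_poly \<mu> * (r * (?X * pderiv p) - (?X * pderiv r) * p) + r * p * (?X * weight_poly \<mu>))
      - 2 * r * sing_poly \<mu> * (p + q) + r^2 * (?X * pderiv \<mu>) * (?X^2 - \<mu>)) \<le> max (N + l + y) (if s = 0 then 0 else 2 * l + s + max 2 s)"
      by (rule degree_add_le[OF degree_diff_le[OF max.coboundedI1[OF main[OF dpq(1)]] max.coboundedI1[OF side[OF dpq(3)]]]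
            max.coboundedI2[OF third]])
  qed (auto simp: y_def)
  have E: "reduced_E p q r \<mu> = (1 - ?X^2) * ((2 * sing_poly \<mu> * (r * (?X * pderiv q) - (?X * pderiv r) * q) + r * q * (?X * weight_poly \<mu>))
      + 2 * r * sing_poly \<mu> * q) + 2 * r * sing_poly \<mu> * p + r^2 * (\<mu> * (?X * forcing_poly \<mu>))"
    unfolding reduced_E_def by (simp only: algebra_simps)
  have "?X * forcing_poly \<mu> = (1 - ?X^2) * (?X * pderiv \<mu>) - (?X * (2 * ?X)) * (1 - \<mu>)"
    unfolding forcing_poly_def by (simp only: algebra_simps)
  also have "degree \<dots> \<le> 2 + s"
    by (intro degree_diff_le degree_mult_le' d1 dXm dm) simp
  finally have dN: "degree (\<mu> * (?X * forcing_poly \<mu>)) \<le> s + (2 + s)"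
    by (rule degree_mult_le'[rotated]) (simp add: s_def)
  have e1: "degree ((1 - ?X^2) * ((2 * sing_poly \<mu> * (r * (?X * pderiv q) - (?X * pderiv r) * q) + r * q * (?X * weight_poly \<mu>)) + 2 * r * sing_poly \<mu> * q)) \<le> N + l + 2 * s + max 2 s + 2"
    by (rule degree_mult_leI[OF d1 degree_add_le[OF main[OF dpq(2)] side[OF dpq(2)]]]) (simp add: y_def)
  have e2: "degree (2 * r * sing_poly \<mu> * p) \<le> N + l + 2 * s + max 2 s + 2" using side[OF dpq(1)] by (simp add: y_def)
  have e3: "degree (r^2 * (\<mu> * (?X * forcing_poly \<mu>))) \<le> 2 * l + 2 * s + 2"
    by (rule degree_mult_leI[OF dr dN]) simp
  show "degree (reduced_E p q r \<mu>) \<le> ?ME"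
    unfolding E by (rule degree_add_le[OF degree_add_le[OF max.coboundedI1[OF e1] max.coboundedI1[OF e2]] max.coboundedI2[OF e3]])
qed

text \<open>The origin of \<open>zero_bound\<close>: it is the sum of the two degree bounds, of
  \<open>degree r\<close> and of 3, and exceeds this sum, by 1, only for \<open>s = 1\<close> and
  \<open>l > max m n + 1\<close>. The case distinctions in \<open>l\<close> decide which member of
  each maximum is the larger.\<close>

lemma coef_degrees_le_zero_bound:
  "degree (reduced_K p q r \<mu>) + degree (reduced_E p q r \<mu>) + degree r + 3
     \<le> zero_bound (degree p) (degree q) (degree r) (degree (\<mu> :: real poly))"
  using coef_degree_bounds[of p q r \<mu>] unfolding zero_bound_def by (simp split: if_splits) linarith+

section \<open>Multiplicities as extended natural numbers\<close>

lemma enat_le_zero_mult_iff: "enat n \<le> zero_mult f x \<longleftrightarrow> (\<forall>j<n. (deriv ^^ j) f x = 0)"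
proof
  assume le: "enat n \<le> zero_mult f x"
  show "\<forall>j<n. (deriv ^^ j) f x = 0"
  proof (rule ccontr)
    assume "\<not> ?thesis"
    then obtain j where j: "j < n" "(deriv ^^ j) f x \<noteq> 0" by blast
    then have "zero_mult f x \<le> enat j" unfolding zero_mult_def by (intro INF_lower) simp
    with le have "enat n \<le> enat j" by (rule order.trans)
    with j show False by simp
  qed
next
  assume "\<forall>j<n. (deriv ^^ j) f x = 0"
  then show "enat n \<le> zero_mult f x"
    unfolding zero_mult_def by (intro INF_greatest) (auto simp: not_less[symmetric])
qed

text \<open>Finite sets with finite weights suffice as tests: an infinite set has a subset of
  \<open>N + 1\<close> points, and an infinite weight may be replaced by \<open>N + 1\<close>,
  either of which would violate the bound.\<close>

lemma sum_weights_le: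
  fixes w :: "'a \<Rightarrow> enat"
  assumes w: "\<And>c. c \<in> Z \<Longrightarrow> 1 \<le> w c"
    and le: "\<And>C a. finite C \<Longrightarrow> C \<subseteq> Z \<Longrightarrow> \<forall>c\<in>C. 0 < a c \<and> enat (a c) \<le> w c \<Longrightarrow> sum a C \<le> N"
  shows "finite Z" "(\<Sum>c\<in>Z. w c) \<le> enat N"
proof -
  show fin: "finite Z"
  proof (rule ccontr)
    assume "infinite Z"
    then obtain C where "C \<subseteq> Z" "finite C" "card C = Suc N" using infinite_arbitrarily_large by blast
    then show False using le[of C "\<lambda>_. 1"] w by (auto simp: one_enat_def)
  qed
  have wfin: "w c \<noteq> \<infinity>" if "c \<in> Z" for c
  proof
    assume "w c = \<infinity>"
    then show False using le[of "{c}" "\<lambda>_. Suc N"] that by simp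
  qed
  have a: "w c = enat (the_enat (w c))" if "c \<in> Z" for c using wfin[OF that] by (cases "w c") auto
  have "(\<Sum>c\<in>Z. w c) = (\<Sum>c\<in>Z. of_nat (the_enat (w c)))"
    by (rule sum.cong) (use a in \<open>auto simp: of_nat_eq_enat\<close>)
  also have "\<dots> = enat (\<Sum>c\<in>Z. the_enat (w c))" by (simp only: of_nat_eq_enat[symmetric] of_nat_sum)
  also have "(\<Sum>c\<in>Z. the_enat (w c)) \<le> N"
    by (rule le[OF fin order.refl]) (metis a w enat_ord_simps(1) one_enat_def order.refl Suc_le_eq One_nat_def)
  finally show "(\<Sum>c\<in>Z. w c) \<le> enat N" by simp
qed

section \<open>Combinations with many zeros\<close>

text \<open>Induction on the number of functions. By independence the new function differs somewhere
  on \<open>S\<close> from its interpolant at the old points; any such point can be added, and the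
  difference \<open>g\<close> corrects the value there without disturbing the others.\<close>

lemma interpolation:
  fixes u :: "nat \<Rightarrow> 'a \<Rightarrow> real"
  assumes "\<And>c. (\<And>x. x \<in> S \<Longrightarrow> (\<Sum>i<N. c i * u i x) = 0) \<Longrightarrow> \<forall>i<N. c i = 0"
  shows "\<exists>y. y ` {..<N} \<subseteq> S \<and> inj_on y {..<N} \<and> (\<forall>t. \<exists>c. \<forall>j<N. (\<Sum>i<N. c i * u i (y j)) = t j)"
  using assms
proof (induction N)
  case (Suc N)
  have "\<forall>i<N. c i = 0" if "\<And>x. x \<in> S \<Longrightarrow> (\<Sum>i<N. c i * u i x) = 0" for c
  proof -
    have "\<forall>i<Suc N. (c(N := 0)) i = 0" by (rule Suc.prems) (use that in simp)
    then show ?thesis by (metis fun_upd_apply less_SucI less_irrefl)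
  qed
  from Suc.IH[OF this] obtain y where y: "y ` {..<N} \<subseteq> S" "inj_on y {..<N}"
    and ex: "\<And>t. \<exists>c. \<forall>j<N. (\<Sum>i<N. c i * u i (y j)) = t j" by blast
  obtain c0 where c0: "\<And>j. j < N \<Longrightarrow> (\<Sum>i<N. c0 i * u i (y j)) = u N (y j)"
    using ex[of "\<lambda>j. u N (y j)"] by blast
  define g where "g x = u N x - (\<Sum>i<N. c0 i * u i x)" for x
  have "\<exists>x\<in>S. g x \<noteq> 0"
  proof (rule ccontr)
    assume "\<not> ?thesis"
    then have "\<forall>i<Suc N. ((\<lambda>i. - c0 i)(N := 1)) i = 0"
      by (intro Suc.prems) (auto simp: g_def sum_negf)
    then show False by auto
  qed
  then obtain x where x: "x \<in> S" "g x \<noteq> 0" by blast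
  define y' where "y' = y(N := x)"
  have "x \<notin> y ` {..<N}" using c0 x(2) by (auto simp: g_def)
  moreover have im: "y' ` {..<N} = y ` {..<N}" by (auto simp: y'_def)
  moreover have "inj_on y' {..<N}" using y(2) by (auto simp: y'_def inj_on_def)
  ultimately have "inj_on y' {..<Suc N}" "y' ` {..<Suc N} \<subseteq> S"
    using y(1) x(1) by (simp_all add: lessThan_Suc) (simp_all add: y'_def)
  moreover have "\<exists>c. \<forall>j<Suc N. (\<Sum>i<Suc N. c i * u i (y' j)) = t j" for t
  proof -
    obtain c1 where c1: "\<And>j. j < N \<Longrightarrow> (\<Sum>i<N. c1 i * u i (y j)) = t j" using ex[of t] by blast
    define s where "s = (t N - (\<Sum>i<N. c1 i * u i x)) / g x"
    define c where "c i = (if i < N then c1 i - s * c0 i else s)" for i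
    have "(\<Sum>i<Suc N. c i * u i z) = (\<Sum>i<N. c1 i * u i z) + s * g z" for z
      by (simp add: c_def g_def algebra_simps sum_subtractf sum_distrib_left)
    then have "\<forall>j<Suc N. (\<Sum>i<Suc N. c i * u i (y' j)) = t j"
      using c1 c0 x(2) by (auto simp: y'_def less_Suc_eq s_def g_def)
    then show ?thesis by blast
  qed
  ultimately show ?case by blast
qed simp

text \<open>Alternating values 1 and -1 are interpolated. A small common shift \<open>e\<close> of
  all coefficients keeps the signs and makes every coefficient nonzero, which later gives the
  polynomials their exact degrees.\<close>

lemma alternating_combination:
  fixes u :: "nat \<Rightarrow> real \<Rightarrow> real"
  assumes "\<And>c. (\<And>x. x \<in> S \<Longrightarrow> (\<Sum>i<N. c i * u i x) = 0) \<Longrightarrow> \<forall>i<N. c i = 0"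
  shows "\<exists>c Y. finite Y \<and> Y \<subseteq> S \<and> card Y = N \<and> (\<forall>i<N. c i \<noteq> 0) \<and>
    (\<forall>x\<in>Y. (-1) ^ card {w\<in>Y. w < x} * (\<Sum>i<N. c i * u i x) > 0)"
proof -
  have "\<exists>y. y ` {..<N} \<subseteq> S \<and> inj_on y {..<N} \<and> (\<forall>t. \<exists>c. \<forall>j<N. (\<Sum>i<N. c i * u i (y j)) = t j)"
    using assms by (rule interpolation)
  then obtain y where y: "y ` {..<N} \<subseteq> S" "inj_on y {..<N}"
    and ex: "\<forall>t. \<exists>c. \<forall>j<N. (\<Sum>i<N. c i * u i (y j)) = t j"
    by (elim exE conjE)
  define Y where "Y = y ` {..<N}"
  \<comment> \<open>The interpolation points come in no particular order, so the sign is taken from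
    the rank of \<open>x\<close> in \<open>Y\<close>.\<close>
  define t where "t x = (-1 :: real) ^ card {w\<in>Y. w < x}" for x
  have Y: "finite Y" "Y \<subseteq> S" "card Y = N" using y by (auto simp: Y_def card_image)
  obtain c where "\<forall>j<N. (\<Sum>i<N. c i * u i (y j)) = t (y j)"
    using ex[THEN spec, of "\<lambda>j. t (y j)"] by (elim exE)
  then have c: "(\<Sum>i<N. c i * u i x) = t x" if "x \<in> Y" for x
    using that by (auto simp: Y_def)
  define b where "b x = (\<Sum>i<N. u i x)" for x
  \<comment> \<open>\<open>e < 1 / B\<close> keeps the change \<open>e * b x\<close> below 1 in
    absolute value at every point of \<open>Y\<close>.\<close>
  define B where "B = 1 + (\<Sum>x\<in>Y. \<bar>b x\<bar>)"
  have B: "B \<ge> 1" by (simp add: B_def sum_nonneg)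
  then have "infinite {0<..<1 / B}" by simp
  then have "infinite ({0<..<1 / B} - (\<lambda>i. - c i) ` {..<N})" by simp
  then have "\<exists>e. e \<in> {0<..<1 / B} - (\<lambda>i. - c i) ` {..<N}" by (metis all_not_in_conv finite.emptyI)
  then obtain e where "e \<in> {0<..<1 / B} - (\<lambda>i. - c i) ` {..<N}" by (elim exE)
  then have e: "0 < e" "e < 1 / B" "e \<notin> (\<lambda>i. - c i) ` {..<N}" by auto
  show ?thesis
  proof (rule exI[of _ "\<lambda>i. c i + e"], rule exI[of _ Y], intro conjI allI ballI impI Y)
    show "c i + e \<noteq> 0" if i: "i < N" for i
    proof
      assume "c i + e = 0"
      then have "e = - c i" by simp
      then show False using e(3) i by blast
    qed
    fix x assume x: "x \<in> Y"
    have tt: "t x * t x = 1" "\<bar>t x\<bar> = 1" by (simp_all add: t_def flip: power_mult_distrib)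
    have "\<bar>b x\<bar> \<le> (\<Sum>x\<in>Y. \<bar>b x\<bar>)" by (rule member_le_sum) (use x Y in auto)
    then have "\<bar>e * b x\<bar> \<le> e * B" using e(1) by (simp add: abs_mult B_def)
    also have "\<dots> < 1" using e(2) B by (simp add: field_simps)
    finally have "\<bar>t x * (e * b x)\<bar> < 1" using tt(2) by (simp add: abs_mult)
    moreover have "(\<Sum>i<N. (c i + e) * u i x) = t x + e * b x"
      using c[OF x] by (simp add: b_def algebra_simps sum.distrib sum_distrib_left)
    ultimately show "(-1) ^ card {w\<in>Y. w < x} * (\<Sum>i<N. (c i + e) * u i x) > 0"
      unfolding t_def[symmetric] by (simp add: tt(1) distrib_left)
  qed
qed

text \<open>Neighbouring points have ranks of different parity, so every gap contains a zero; with
  no excluded points, \<open>gap_count\<close> provides the \<open>card Y - 1\<close> gaps.\<close>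

lemma alternating_imp_zeros:
  fixes f :: "real \<Rightarrow> real"
  assumes cont: "continuous_on S f" and S: "is_interval S" and Y: "finite Y" "Y \<subseteq> S"
    and alt: "\<And>x. x \<in> Y \<Longrightarrow> (-1) ^ card {w\<in>Y. w < x} * f x > 0"
    and fin: "finite {x\<in>S. f x = 0}"
  shows "card Y \<le> card {x\<in>S. f x = 0} + 1"
proof (rule gap_count[OF Y(1) empty_subsetI], goal_cases)
  case R: (1 R nx)
  have finR: "finite R" using R(1) Y(1) finite_subset by blast
  have "\<exists>z. x < z \<and> z < nx x \<and> z \<in> S \<and> f z = 0" if x: "x \<in> R" for x
  proof -
    have n: "x \<in> Y" "nx x \<in> Y" "x < nx x" "{x<..<nx x} \<inter> Y = {}" using R(1) R(2)[OF x] x by auto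
    have sub: "{x..nx x} \<subseteq> S" using S n(1,2) Y(2) unfolding is_interval_1 by (meson atLeastAtMost_iff subsetD subsetI)
    have "w \<le> x" if "w \<in> Y" "w < nx x" for w
    proof -
      have "w \<notin> {x<..<nx x}" using n(4) that by blast
      then show ?thesis using that by auto
    qed
    then have "{w\<in>Y. w < nx x} = insert x {w\<in>Y. w < x}" using n by (auto simp: less_le)
    then have "card {w\<in>Y. w < nx x} = Suc (card {w\<in>Y. w < x})" using Y(1) by simp
    then have "f x > 0 \<and> f (nx x) < 0 \<or> f x < 0 \<and> f (nx x) > 0"
      using alt[OF n(1)] alt[OF n(2)] by (cases "even (card {w\<in>Y. w < x})") auto
    then obtain z where z: "x \<le> z" "z \<le> nx x" "f z = 0"
      using IVT'[of f x 0 "nx x"] IVT2'[of f "nx x" 0 x] n(3) continuous_on_subset[OF cont sub] by fastforce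
    moreover have "z \<noteq> x" "z \<noteq> nx x" using alt[OF n(1)] alt[OF n(2)] z(3) by auto
    ultimately show ?thesis using sub by (intro exI[of _ z]) auto
  qed
  then obtain z where z: "\<And>x. x \<in> R \<Longrightarrow> x < z x \<and> z x < nx x \<and> z x \<in> S \<and> f (z x) = 0" by metis
  have "inj_on z R"
  proof (rule linorder_inj_onI)
    fix x y assume "x < y" "x \<in> R" "y \<in> R"
    then have "z x < nx x" "nx x \<le> y" "y < z y" using z R(4) by auto
    then show "z x \<noteq> z y" by simp
  qed auto
  then have "card R \<le> card {x\<in>S. f x = 0}" by (rule card_inj_on_le) (use z fin in auto)
  then show ?case using R(3) by simp
qed

lemma sum_lessThan_add: "(\<Sum>i<a + b. f i) = (\<Sum>i<a. f i) + (\<Sum>i<b. f (a + i :: nat) :: real)"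
  by (induction b) (simp_all add: add.assoc)

lemma isolated_zeros_finite: "finite {y\<in>S. f y = 0} \<Longrightarrow> isolated_zeros f S = {y\<in>S. f y = 0}"
  unfolding isolated_zeros_def by (auto simp: isolated_in_islimpt_iff islimpt_finite)

section \<open>Both claims for an admissible \<open>\<mu>\<close>\<close>

context elliptic_mu
begin

lemma sum_multiplicities_le:
  assumes "r \<noteq> 0" "finite C" "C \<subseteq> {-1<..<1}"
    and "\<And>c. c \<in> C \<Longrightarrow> 0 < a c \<and> enat (a c) \<le> zero_mult (elliptic_comb p q r \<mu>) c"
  shows "sum a C \<le> zero_bound (degree p) (degree q) (degree r) (degree \<mu>)"
  using multiplicities_le[OF assms(1-3), of a p q] assms(4) coef_degrees_le_zero_bound[of p q r \<mu>]
  unfolding enat_le_zero_mult_iff by fastforce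

lemma zero_mult_ge_1: "elliptic_comb p q r \<mu> c = 0 \<Longrightarrow> 1 \<le> zero_mult (elliptic_comb p q r \<mu>) c"
  using enat_le_zero_mult_iff[of 1] by (simp add: one_enat_def)

lemma num_zeros_le:
  assumes "r \<noteq> 0"
  shows "num_zeros_mult (elliptic_comb p q r \<mu>) {-1<..<1} \<le> enat (zero_bound (degree p) (degree q) (degree r) (degree \<mu>))"
proof -
  let ?Z = "isolated_zeros (elliptic_comb p q r \<mu>) {-1<..<1}"
  have Z: "c \<in> {-1<..<1} \<and> elliptic_comb p q r \<mu> c = 0" if "c \<in> ?Z" for c
    using that by (auto simp: isolated_zeros_def isolated_in_islimpt_iff)
  have w: "1 \<le> zero_mult (elliptic_comb p q r \<mu>) c" if "c \<in> ?Z" for c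
    using zero_mult_ge_1 Z[OF that] by simp
  have le: "sum a C \<le> zero_bound (degree p) (degree q) (degree r) (degree \<mu>)"
    if "finite C" "C \<subseteq> ?Z" "\<forall>c\<in>C. 0 < a c \<and> enat (a c) \<le> zero_mult (elliptic_comb p q r \<mu>) c" for C a
  proof (rule sum_multiplicities_le[OF assms that(1)])
    show "C \<subseteq> {-1<..<1}"
    proof
      fix c assume "c \<in> C"
      then show "c \<in> {-1<..<1}" using Z[of c] that(2) by (simp add: subset_iff)
    qed
    show "0 < a c \<and> enat (a c) \<le> zero_mult (elliptic_comb p q r \<mu>) c" if c: "c \<in> C" for c
      by (rule bspec[OF _ c]) fact
  qed
  have "finite ?Z" "(\<Sum>c\<in>?Z. zero_mult (elliptic_comb p q r \<mu>) c) \<le> enat (zero_bound (degree p) (degree q) (degree r) (degree \<mu>))"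
    by (rule sum_weights_le; (erule w | rule le; assumption))+
  then show ?thesis unfolding num_zeros_mult_def by simp
qed

lemma finite_zeros:
  assumes "r \<noteq> 0"
  shows "finite {x\<in>{-1<..<1}. elliptic_comb p q r \<mu> x = 0}"
proof (rule sum_weights_le(1)[of _ "zero_mult (elliptic_comb p q r \<mu>)"])
  fix C a assume "finite C" "C \<subseteq> {x\<in>{-1<..<1}. elliptic_comb p q r \<mu> x = 0}"
    "\<forall>c\<in>C. 0 < a c \<and> enat (a c) \<le> zero_mult (elliptic_comb p q r \<mu>) c"
  then show "sum a C \<le> zero_bound (degree p) (degree q) (degree r) (degree \<mu>)"
    by (intro sum_multiplicities_le[OF assms]) auto
qed (use zero_mult_ge_1 in auto)

text \<open>A nonzero \<open>r\<close> leaves only finitely many zeros by the upper bound; once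
  \<open>r = 0\<close>, the independence of \<open>K\<close> and \<open>E\<close> over the
  polynomials applies.\<close>

lemma elliptic_comb_eq_0_imp:
  assumes 0: "\<And>x. x \<in> {-1<..<1} \<Longrightarrow> elliptic_comb p q r \<mu> x = 0"
  shows "p = 0 \<and> q = 0 \<and> r = 0"
proof -
  have r: "r = 0"
  proof (rule ccontr)
    assume "r \<noteq> 0"
    from finite_zeros[OF this, of p q] have "finite {-1<..<1::real}" by (rule finite_subset[rotated]) (use 0 in auto)
    then show False using infinite_Ioo[of "-1" "1::real"] by simp
  qed
  have "p = 0 \<and> q = 0"
  proof (rule two_term_eq_0_imp)
    fix x :: real assume x: "0 < x" "x < 1"
    then have "comb_ext p q r \<mu> (of_real x) = 0" using 0[of x] comb_higher_deriv_0[of x 0 p q r] by simp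
    then show "two_term p q (of_real x) = 0" using x r by (subst two_term_eq) (simp_all add: comb_ext_def)
  qed
  with r show ?thesis by simp
qed

text \<open>Alternating signs at \<open>m + n + l + 3\<close> points give one zero fewer. As
  \<open>R c \<noteq> 0\<close>, the zero set is finite, and so all of its points are
  isolated.\<close>

lemma exists_many_zeros:
  "\<exists>p q r. p \<noteq> 0 \<and> q \<noteq> 0 \<and> r \<noteq> 0 \<and> degree p = m \<and> degree q = n \<and> degree r = l \<and>
     (\<exists>k\<in>{-1<..<1}. elliptic_comb p q r \<mu> k \<noteq> 0) \<and>
     card (isolated_zeros (elliptic_comb p q r \<mu>) {-1<..<1}) \<ge> m + n + l + 2"
proof -
  define pol where "pol d k = (\<Sum>i<Suc k. monom (d i :: real) i)" for d k
  have coeff_pol: "coeff (pol d k) i = (if i < Suc k then d i else 0)" for d k i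
    by (simp add: pol_def coeff_sum del: sum.lessThan_Suc)
  have poly_pol: "poly (pol d k) x = (\<Sum>i<Suc k. d i * x ^ i)" for d k x
    by (simp add: pol_def poly_sum poly_monom del: sum.lessThan_Suc)
  have degree_pol: "degree (pol d k) = k \<and> pol d k \<noteq> 0" if "d k \<noteq> 0" for d k
  proof -
    have "degree (pol d k) \<le> k" by (rule degree_le) (simp add: coeff_pol)
    moreover have "coeff (pol d k) k \<noteq> 0" using that by (simp add: coeff_pol)
    ultimately show ?thesis using le_degree[of "pol d k" k] by auto
  qed
  define N where "N = Suc m + Suc n + Suc l"
  define u where "u i x = (if i < Suc m then x ^ i * elliptic_K x else if i < Suc m + Suc n then x ^ (i - Suc m) * elliptic_E x
     else x ^ (i - (Suc m + Suc n)) * elliptic_Pi (poly \<mu> x) x)" for i :: nat and x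
  define P Q R where "P c = pol c m" and "Q c = pol (\<lambda>i. c (Suc m + i)) n"
    and "R c = pol (\<lambda>i. c (Suc m + Suc n + i)) l" for c
  have comb: "(\<Sum>i<N. c i * u i x) = elliptic_comb (P c) (Q c) (R c) \<mu> x" for c x
  proof -
    have "(\<Sum>i<Suc m. c i * u i x) = poly (P c) x * elliptic_K x"
      unfolding P_def poly_pol sum_distrib_right by (rule sum.cong) (auto simp: u_def)
    moreover have "(\<Sum>i<Suc n. c (Suc m + i) * u (Suc m + i) x) = poly (Q c) x * elliptic_E x"
      unfolding Q_def poly_pol sum_distrib_right by (rule sum.cong) (auto simp: u_def)
    moreover have "(\<Sum>i<Suc l. c (Suc m + Suc n + i) * u (Suc m + Suc n + i) x) = poly (R c) x * elliptic_Pi (poly \<mu> x) x"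
      unfolding R_def poly_pol sum_distrib_right by (rule sum.cong) (auto simp: u_def)
    ultimately show ?thesis unfolding N_def sum_lessThan_add elliptic_comb_def by simp
  qed
  have indep: "\<forall>i<N. c i = 0" if "\<And>x. x \<in> {-1<..<1} \<Longrightarrow> (\<Sum>i<N. c i * u i x) = 0" for c
  proof -
    have 0: "P c = 0" "Q c = 0" "R c = 0"
      using elliptic_comb_eq_0_imp[of "P c" "Q c" "R c"] that unfolding comb by auto
    show ?thesis
    proof (intro allI impI)
      fix i assume i: "i < N"
      consider "i < Suc m" | "Suc m \<le> i" "i - Suc m < Suc n" | "Suc m + Suc n \<le> i" "i - (Suc m + Suc n) < Suc l"
        using i unfolding N_def by linarith
      then show "c i = 0"
      proof cases
        case 1
        then show ?thesis using coeff_pol[of c m i] 0(1) unfolding P_def by simp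
      next
        case 2
        then show ?thesis using coeff_pol[of "\<lambda>i. c (Suc m + i)" n "i - Suc m"] 0(2) unfolding Q_def by simp
      next
        case 3
        then obtain j where "i = Suc m + Suc n + j" "j < Suc l" by (metis le_add_diff_inverse)
        then show ?thesis using coeff_pol[of "\<lambda>i. c (Suc m + Suc n + i)" l j] 0(3) unfolding R_def by simp
      qed
    qed
  qed
  have "\<exists>c Y. finite Y \<and> Y \<subseteq> {-1<..<1} \<and> card Y = N \<and> (\<forall>i<N. c i \<noteq> 0) \<and>
      (\<forall>x\<in>Y. (-1) ^ card {w\<in>Y. w < x} * (\<Sum>i<N. c i * u i x) > 0)"
    by (rule alternating_combination) (rule indep)
  then obtain c Y where Y: "finite Y" "Y \<subseteq> {-1<..<1}" "card Y = N" "\<forall>i<N. c i \<noteq> 0"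
      "\<forall>x\<in>Y. (-1) ^ card {w\<in>Y. w < x} * (\<Sum>i<N. c i * u i x) > 0"
    by (elim exE conjE)
  let ?f = "elliptic_comb (P c) (Q c) (R c) \<mu>"
  have deg: "degree (P c) = m \<and> P c \<noteq> 0" "degree (Q c) = n \<and> Q c \<noteq> 0" "degree (R c) = l \<and> R c \<noteq> 0"
    unfolding P_def Q_def R_def by (intro degree_pol Y(4)[rule_format]; simp add: N_def)+
  have fin: "finite {x\<in>{-1<..<1}. ?f x = 0}" using finite_zeros deg by blast
  have "continuous_on {-1<..<1} ?f"
    using comb_has_derivative(1) by (intro continuous_at_imp_continuous_on ballI DERIV_isCont) auto
  then have "card Y \<le> card {x\<in>{-1<..<1}. ?f x = 0} + 1"
    by (rule alternating_imp_zeros[OF _ _ Y(1,2) _ fin]) (use Y(5) in \<open>auto simp: comb is_interval_1\<close>)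
  then have "m + n + l + 2 \<le> card (isolated_zeros ?f {-1<..<1})"
    using Y(3) by (simp add: isolated_zeros_finite[OF fin] N_def)
  moreover have "\<exists>k\<in>{-1<..<1}. ?f k \<noteq> 0"
  proof (rule ccontr)
    assume "\<not> ?thesis"
    then show False using elliptic_comb_eq_0_imp[of "P c" "Q c" "R c"] deg by blast
  qed
  ultimately show ?thesis using deg by blast
qed

end

theorem theorem1p3:
  fixes \<mu> :: "real poly" and m n l s :: nat
  assumes deg_mu: "degree \<mu> = s"
    and mu_nonneg: "\<And>k. k \<in> {-1<..<1} \<Longrightarrow> poly \<mu> k \<ge> 0"
    and mu_neq_1: "\<And>k. k \<in> {-1<..<1} \<Longrightarrow> poly \<mu> k \<noteq> 1"
    and mu_neq_sq: "\<mu> \<noteq> monom 1 2"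
    and mu_const: "s = 0 \<Longrightarrow> \<mu> \<noteq> 0"
    and Pi_conv: "\<And>k. k \<in> {-1<..<1} \<Longrightarrow> elliptic_Pi_integrand (poly \<mu> k) k integrable_on {0..1}"
  shows "(\<forall>p q r :: real poly.
            degree p = m \<longrightarrow> degree q = n \<longrightarrow> degree r = l \<longrightarrow> r \<noteq> 0 \<longrightarrow>
              num_zeros_mult (elliptic_comb p q r \<mu>) {-1<..<1} \<le> enat (zero_bound m n l s)) \<and>
         (\<exists>p q r :: real poly.
            p \<noteq> 0 \<and> q \<noteq> 0 \<and> r \<noteq> 0 \<and> degree p = m \<and> degree q = n \<and> degree r = l \<and>
            (\<exists>k \<in> {-1<..<1}. elliptic_comb p q r \<mu> k \<noteq> 0) \<and>
            card (isolated_zeros (elliptic_comb p q r \<mu>) {-1<..<1}) \<ge> m + n + l + 2)"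
proof (intro conjI allI impI)
  have sq: "monom 1 2 = ([:0, 1:] :: real poly)^2"
    by (simp add: monom_altdef)
  have \<mu>0: "\<mu> \<noteq> 0" using mu_const deg_mu by auto
  interpret elliptic_mu \<mu>
  proof
    \<comment> \<open>Convergence of the integral of the third kind sharpens
      \<open>\<mu> \<noteq> 1\<close> to \<open>\<mu> < 1\<close>, so that its series is available
      on the whole interval.\<close>
    show "0 \<le> poly \<mu> x \<and> poly \<mu> x < 1" if x: "x \<in> {-1<..<1}" for x
      using mu_nonneg[OF x] Pi_integrable_imp_less_1[OF x mu_nonneg[OF x] mu_neq_1[OF x] Pi_conv[OF x]]
      by simp
    show "\<mu> \<noteq> 0" by (rule \<mu>0)
    show "\<mu> \<noteq> [:0, 1:]^2" using mu_neq_sq unfolding sq .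
  qed
  show "num_zeros_mult (elliptic_comb p q r \<mu>) {-1<..<1} \<le> enat (zero_bound m n l s)"
    if "degree p = m" "degree q = n" "degree r = l" "r \<noteq> 0" for p q r
    using num_zeros_le[OF that(4), of p q] unfolding that deg_mu .
  show "\<exists>p q r. p \<noteq> 0 \<and> q \<noteq> 0 \<and> r \<noteq> 0 \<and> degree p = m \<and> degree q = n \<and> degree r = l \<and>
      (\<exists>k\<in>{-1<..<1}. elliptic_comb p q r \<mu> k \<noteq> 0) \<and>
      m + n + l + 2 \<le> card (isolated_zeros (elliptic_comb p q r \<mu>) {-1<..<1})"
    by (rule exists_many_zeros)
qed

end
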